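(* Let $P$ be a Borel probability measure on $\mathbb{R}_+$ with finite mean $\mu\neq0$, Laplace transform $\phi(t)=\int_{\mathbb{R}_+}e^{-tx}P(dx)$, and $\mathbf{p}_0:=P(\{0\})$. Suppose the (random or deterministic) vectors $\mathbf{w}^{(n)}=(w_1^{(n)},\ldots,w_n^{(n)})$, $n\in\mathbb{N}$, satisfy condition LLN-$P$-ex (defined in the context), and let $S^{(n)}(t)$ be the search-cost, and $S_{\mathbf{o}}^{(n)}(t)$ its out-of-equilibrium part, in the move-to-front Markov chain with popularities $p^{(n)}_i=w^{(n)}_i/\sum_{j=1}^n w^{(n)}_j$. Let $S^{(\infty)}$ be a random variable in $[0,1]$ with density $$f_{S^{(\infty)}}(x)=-\frac1\mu\,\frac{\phi''(\phi^{-1}(1-x))}{\phi'(\phi^{-1}(1-x))}\,\mathbf{1}_{[0,1-\mathbf{p}_0]}(x).$$ Then for each $t>0$ we have the convergence in distribution, as $n\to\infty$, $$\frac{S^{(n)}(n\mu t)}{n}\longrightarrow^dS(t),$$ where $S(t)$ satisfies the relation in distribution $$S(t)=^{d}S^{(\infty)}\mathbf{1}_{\{S^{(\infty)}\le1-\phi(t)\}}+U\,\mathbf{1}_{\{S^{(\infty)}>1-\phi(t)\}},$$ with $U$ a uniform random variable in $[1-\phi(t),1]$ independent of $S^{(\infty)}$. Moreover, when $n\to\infty$, $$\mathbb{P}\bigl(S_{\mathbf{o}}^{(n)}(n\mu t)>0\bigr)\longrightarrow\mathbb{P}\bigl(S^{(\infty)}>1-\phi(t)\bigr)=\frac{|\phi'(t)|}{\mu}.$$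 Finally, $S(t)$ has density $$f_{S(t)}(x)=f_{S^{(\infty)}}(x)\mathbf{1}_{[0,1-\phi(t)]}(x)+\frac{|\phi'(t)|}{\mu\,\phi(t)}\mathbf{1}_{[1-\phi(t),1]}(x),$$ and, with $\|\cdot\|_{\mathrm{TV}}$ denoting the total variation distance, $$\bigl\|\mathrm{law}(S(t))-\mathrm{law}(S^{(\infty)})\bigr\|_{\mathrm{TV}}=\int_{1-\phi(t)}^{1-\mathbf{p}_0}\Bigl|f_{S^{(\infty)}}(x)-\frac{|\phi'(t)|}{\mu\phi(t)}\Bigr|\,dx+\frac{|\phi'(t)|\,\mathbf{p}_0}{\mu\,\phi(t)}\le2\,\frac{|\phi'(t)|}{\mu}.$$
   Context: The total variation norm is normalized so that for laws with densities $f,g$ it equals $\int|f-g|\,dx$. $\phi^{-1}$ denotes the inverse of the strictly decreasing function $\phi:[0,\infty)\to(\mathbf{p}_0,1]$; densities are understood up to Lebesgue-null sets. Condition LLN-$P$. A sequence of random or deterministic vectors $\mathbf{w}^{(n)}=(w_1^{(n)},\ldots,w_n^{(n)})$, $n\in\mathbb{N}$, with nonnegative coordinates satisfies LLN-$P$, where $P$ is a Borel probability measure on $\mathbb{R}_+=[0,\infty)$ with finite first moment $\mu\neq0$, if there exist positive random variables $Z_n$ (with $Z_n$ defined on the same probability space as $\mathbf{w}^{(n)}$) such that the random probability measures $\hat\nu^{(n)}:=\frac1n\sum_{i=1}^n\delta_{Z_nw_i^{(n)}}$ converge in law to the deterministic limit $P$ (as random elements of the space $\mathcal{P}(\mathbb{R}_+)$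 of Borel probability measures with the weak topology), and the empirical means $\frac1n\sum_{i=1}^nZ_nw_i^{(n)}$ converge in law to $\mu$. Move-to-front chain. Let $p_i^{(n)}:=w_i^{(n)}/\sum_{j=1}^nw_j^{(n)}$ (convention $0/0:=0$). Objects labeled $1,\ldots,n$ are kept in a list; at time $0$ object $i$ is at position $\pi(i)$, where $\pi$ is some permutation of $\{1,\ldots,n\}$ (position $1$ is the front of the list). Conditionally on $\mathbf{w}^{(n)}$, object $i$ is requested at the instants of a Poisson process on $[0,\infty)$ of rate $p_i^{(n)}$, independently for different $i$. Instantaneously after a request the requested object is moved to the front of the list, the relative order of the other objects being unchanged. $N_t$ is the total number of requests up to time $t$, and $I_k\in\{1,\ldots,n\}$ is the label of the $k$-th requested object, so that $I_{N_{t^-}+1}$ is the first object requested in $[t,\infty)$. $S^{(n,i)}(t)$ is the position of object $i$ at time $t$ (left-continuous in $t$: a request occurring exactly at time $t$ has not yet modified the list). The search-cost is $S^{(n)}(t):=\sum_{i=1}^nS^{(n,i)}(t)\mathbf{1}_{\{I_{N_{t^-}+1}=i\}}$; if all $w_j^{(n)}$ are zero there are no requests and $S^{(n)}(t)=0$. $R_t$ is the set of objects requested at least once in $[0,t)$. The out-of-equilibrium part of the search-cost is $S_{\mathbf{o}}^{(n)}(t):=S^{(n)}(t)\mathbf{1}_{\{I_{N_{t^-}+1}\notin R_t\}}$. LLN-$P$-ex: LLN-$P$ holds, $\pi$ is the identity, and for each $n$ the vector $\mathbf{w}^{(n)}$ is exchangeable (its law is invariant under permutations of its coordinates). *)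

theory Defs
  imports "HOL-Probability.Probability" "HOL-Combinatorics.Permutations"
begin

section \<open>Probability measures on the half-line, and the law of large numbers condition\<close>

text \<open>A Borel probability measure on the half-line is represented by a Borel probability measure on
  the reals that gives no mass to the negative reals.\<close>

definition prob_measures_Rplus :: "real measure set" where
  "prob_measures_Rplus = {m. real_distribution m \<and> (AE x in m. 0 \<le> x)}"

definition weak_topology_Rplus :: "real measure topology" where
  "weak_topology_Rplus = topology_generated_by
     {{m \<in> prob_measures_Rplus. (LINT x:{0..}|m. f x) \<in> V} | f V.
        continuous_on {0..} f \<and> bounded (f ` {0..}) \<and> open (V :: real set)}"

text \<open>Convergence in law of random elements \<open>X n\<close> (defined on possibly different probability
  spaces) of a topological space to a deterministic element \<open>c\<close>: the integral of a test functional
  against the limit law, which is the point mass at \<open>c\<close>, is its value at \<open>c\<close>.\<close>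

definition converges_in_law_to_point ::
  "(nat \<Rightarrow> 'a measure) \<Rightarrow> (nat \<Rightarrow> 'a \<Rightarrow> 'b) \<Rightarrow> 'b topology \<Rightarrow> 'b \<Rightarrow> bool" where
  "converges_in_law_to_point M X T c \<longleftrightarrow>
     (\<forall>F :: 'b \<Rightarrow> real. continuous_map T euclidean F \<and> bounded (F ` topspace T) \<longrightarrow>
        (\<lambda>n. LINT \<omega>|M n. F (X n \<omega>)) \<longlonglongrightarrow> F c)"

text \<open>The vector of length \<open>n\<close> is the restriction of \<open>v :: nat \<Rightarrow> real\<close> to \<open>{1..n}\<close>; values
  outside that set are never used.\<close>

definition empirical_measure :: "nat \<Rightarrow> (nat \<Rightarrow> real) \<Rightarrow> real measure" where
  "empirical_measure n v = distr (uniform_count_measure {1..n}) borel v"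

definition LLN :: "(nat \<Rightarrow> 'a measure) \<Rightarrow> (nat \<Rightarrow> 'a \<Rightarrow> nat \<Rightarrow> real) \<Rightarrow> real measure \<Rightarrow> bool" where
  "LLN M w P \<longleftrightarrow>
     (\<forall>n. prob_space (M n)) \<and>
     (\<forall>n. \<forall>i\<in>{1..n}. (\<lambda>\<omega>. w n \<omega> i) \<in> borel_measurable (M n) \<and>
        (\<forall>\<omega>\<in>space (M n). 0 \<le> w n \<omega> i)) \<and>
     (\<exists>Z :: nat \<Rightarrow> 'a \<Rightarrow> real.
        (\<forall>n. Z n \<in> borel_measurable (M n) \<and> (\<forall>\<omega>\<in>space (M n). 0 < Z n \<omega>)) \<and>
        converges_in_law_to_point M (\<lambda>n \<omega>. empirical_measure n (\<lambda>i. Z n \<omega> * w n \<omega> i))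
          weak_topology_Rplus P \<and>
        weak_conv_m (\<lambda>n. distr (M n) borel (\<lambda>\<omega>. (\<Sum>i=1..n. Z n \<omega> * w n \<omega> i) / real n))
          (return borel (LINT x|P. x)))"

definition exchangeable :: "'a measure \<Rightarrow> nat \<Rightarrow> ('a \<Rightarrow> nat \<Rightarrow> real) \<Rightarrow> bool" where
  "exchangeable M n w \<longleftrightarrow>
     (\<forall>\<sigma>. \<sigma> permutes {1..n} \<longrightarrow>
        distr M (\<Pi>\<^sub>M i\<in>{1..n}. borel) (\<lambda>\<omega>. \<lambda>i\<in>{1..n}. w \<omega> (\<sigma> i)) =
        distr M (\<Pi>\<^sub>M i\<in>{1..n}. borel) (\<lambda>\<omega>. \<lambda>i\<in>{1..n}. w \<omega> i))"


section \<open>The request processes\<close>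

definition popularity :: "nat \<Rightarrow> (nat \<Rightarrow> real) \<Rightarrow> nat \<Rightarrow> real" where
  "popularity n v i = v i / (\<Sum>j=1..n. v j)"

definition weight_algebra :: "'a measure \<Rightarrow> nat \<Rightarrow> ('a \<Rightarrow> nat \<Rightarrow> real) \<Rightarrow> 'a measure" where
  "weight_algebra M n w =
     vimage_algebra (space M) (\<lambda>\<omega>. \<lambda>i\<in>{1..n}. w \<omega> i) (\<Pi>\<^sub>M i\<in>{1..n}. borel)"

text \<open>Not the library's \<open>poisson_pmf\<close>, because the rate may be zero.\<close>

definition poisson_prob :: "real \<Rightarrow> nat \<Rightarrow> real" where
  "poisson_prob r k = r ^ k / fact k * exp (- r)"

text \<open>\<open>A \<omega> i\<close> is the set of request instants of object \<open>i\<close>. Conditionally on the weights, the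
  numbers of requests of the different objects in consecutive time intervals are independent and
  Poisson distributed, with mean the popularity times the length of the interval.\<close>

definition poisson_requests ::
  "'a measure \<Rightarrow> nat \<Rightarrow> ('a \<Rightarrow> nat \<Rightarrow> real) \<Rightarrow> ('a \<Rightarrow> nat \<Rightarrow> real set) \<Rightarrow> bool" where
  "poisson_requests M n w A \<longleftrightarrow>
     (\<forall>\<omega>\<in>space M. \<forall>i\<in>{1..n}. A \<omega> i \<subseteq> {0..} \<and> (\<forall>b. finite (A \<omega> i \<inter> {..<b}))) \<and>
     (\<forall>i\<in>{1..n}. \<forall>a b. (\<lambda>\<omega>. card (A \<omega> i \<inter> {a..<b})) \<in> measurable M (count_space UNIV)) \<and>
     (\<forall>(m::nat) (s::nat \<Rightarrow> real) (k::nat \<Rightarrow> nat \<Rightarrow> nat). 0 \<le> s 0 \<and> mono s \<longrightarrow>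
        (AE \<omega> in M.
           real_cond_exp M (weight_algebra M n w)
             (indicator {\<omega>\<in>space M. \<forall>i\<in>{1..n}. \<forall>j<m. card (A \<omega> i \<inter> {s j..<s (Suc j)}) = k i j}) \<omega> =
           (\<Prod>i\<in>{1..n}. \<Prod>j<m. poisson_prob (popularity n (w \<omega>) i * (s (Suc j) - s j)) (k i j))))"


section \<open>The move-to-front list\<close>

text \<open>Below, \<open>B i\<close> is a realization of the set of request instants of object \<open>i\<close>. Requests of two
  different objects at the same instant have probability zero; the choice of the smallest label in
  that case is immaterial.\<close>

definition request_instants :: "nat \<Rightarrow> (nat \<Rightarrow> real set) \<Rightarrow> real set" where
  "request_instants n B = (\<Union>i\<in>{1..n}. B i)"

definition requested_at :: "nat \<Rightarrow> (nat \<Rightarrow> real set) \<Rightarrow> real \<Rightarrow> nat" where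
  "requested_at n B s = (LEAST i. i \<in> {1..n} \<and> s \<in> B i)"

text \<open>The number of requests before time \<open>t\<close>, a request at time \<open>t\<close> not being counted.\<close>

definition num_requests_before :: "nat \<Rightarrow> (nat \<Rightarrow> real set) \<Rightarrow> real \<Rightarrow> nat" where
  "num_requests_before n B t = card (request_instants n B \<inter> {..<t})"

text \<open>The label of the \<open>k\<close>-th requested object (\<open>k \<ge> 1\<close>). The value \<open>0\<close>, which is not a label,
  means that there are fewer than \<open>k\<close> requests.\<close>

definition request_label :: "nat \<Rightarrow> (nat \<Rightarrow> real set) \<Rightarrow> nat \<Rightarrow> nat" where
  "request_label n B k =
     (if \<exists>s\<in>request_instants n B. card (request_instants n B \<inter> {..s}) = k
      then requested_at n B (THE s. s \<in> request_instants n B \<and> card (request_instants n B \<inter> {..s}) = k)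
      else 0)"

definition next_requested :: "nat \<Rightarrow> (nat \<Rightarrow> real set) \<Rightarrow> real \<Rightarrow> nat" where
  "next_requested n B t = request_label n B (num_requests_before n B t + 1)"

definition move_to_front :: "nat \<Rightarrow> nat list \<Rightarrow> nat list" where
  "move_to_front i L = i # removeAll i L"

text \<open>The list in which object \<open>i\<close> is at position \<open>\<pi> i\<close>.\<close>

definition initial_list :: "nat \<Rightarrow> (nat \<Rightarrow> nat) \<Rightarrow> nat list" where
  "initial_list n \<pi> = map (inv_into {1..n} \<pi>) [1..<Suc n]"

definition list_at :: "nat \<Rightarrow> (nat \<Rightarrow> nat) \<Rightarrow> (nat \<Rightarrow> real set) \<Rightarrow> real \<Rightarrow> nat list" where
  "list_at n \<pi> B t =
     fold (\<lambda>s. move_to_front (requested_at n B s))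
       (sorted_list_of_set (request_instants n B \<inter> {..<t})) (initial_list n \<pi>)"

definition position :: "nat \<Rightarrow> nat list \<Rightarrow> nat" where
  "position i L = Suc (length (takeWhile (\<lambda>j. j \<noteq> i) L))"

definition search_cost :: "nat \<Rightarrow> (nat \<Rightarrow> nat) \<Rightarrow> (nat \<Rightarrow> real set) \<Rightarrow> real \<Rightarrow> nat" where
  "search_cost n \<pi> B t =
     (\<Sum>i=1..n. position i (list_at n \<pi> B t) * of_bool (next_requested n B t = i))"

definition requested_set :: "nat \<Rightarrow> (nat \<Rightarrow> real set) \<Rightarrow> real \<Rightarrow> nat set" where
  "requested_set n B t = {i\<in>{1..n}. B i \<inter> {0..<t} \<noteq> {}}"

definition search_cost_out :: "nat \<Rightarrow> (nat \<Rightarrow> nat) \<Rightarrow> (nat \<Rightarrow> real set) \<Rightarrow> real \<Rightarrow> nat" where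
  "search_cost_out n \<pi> B t =
     search_cost n \<pi> B t * of_bool (next_requested n B t \<notin> requested_set n B t)"


section \<open>The limit\<close>

definition laplace_transform :: "real measure \<Rightarrow> real \<Rightarrow> real" where
  "laplace_transform P t = (LINT x|P. exp (- (t * x)))"

text \<open>At the two end points of the interval this may be a junk value: the inverse
  of the Laplace transform is not defined at \<open>P {0}\<close>, and at \<open>x = 0\<close> the two-sided derivatives at
  \<open>0\<close> need not exist.\<close>

definition limit_density :: "real measure \<Rightarrow> real \<Rightarrow> real" where
  "limit_density P x =
     - (1 / (LINT y|P. y)) *
     (deriv (deriv (laplace_transform P)) (inv_into {0..} (laplace_transform P) (1 - x)) /
      deriv (laplace_transform P) (inv_into {0..} (laplace_transform P) (1 - x))) *
     indicator {0..1 - measure P {0}} x"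

text \<open>The total variation norm of the signed measure \<open>M - N\<close>, for probability measures \<open>M\<close> and \<open>N\<close>
  on the same measurable space; this is twice the supremum of \<open>\<bar>M A - N A\<bar>\<close>.\<close>

definition tv_dist :: "'a measure \<Rightarrow> 'a measure \<Rightarrow> real" where
  "tv_dist M N =
     (SUP \<A>\<in>{\<A>. finite \<A> \<and> disjoint \<A> \<and> \<A> \<subseteq> sets M}. \<Sum>A\<in>\<A>. \<bar>measure M A - measure N A\<bar>)"

end

theory Submission
  imports Defs
begin

text \<open>
The distribution function of the search cost is computed at well chosen random points, where it is
the probability of an event that does not mention the list.

Put the clock at time \<open>n * \<mu> * t\<close> and look back over a window of length \<open>n * \<mu> * u\<close> with
\<open>u \<le> t\<close>. The objects requested in the window occupy the first positions of the list, and all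
others are behind them. So the search cost is at most the number of objects requested in the window
if and only if the next object is one of them (\<open>search_cost_le_iff\<close>). Given the weights, object
\<open>i\<close> avoids the window with probability \<open>exp (- (p i * n * \<mu> * u))\<close>, where \<open>p i\<close> is its
popularity. By the law of large numbers condition, \<open>n * \<mu> * p i\<close> is close to the normalized
weight of \<open>i\<close>, hence:

  \<^item> the fraction of objects that avoid the window tends in probability to \<open>\<phi> u\<close>, because its
    conditional mean does and the conditional variance of the number of these objects is at most
    \<open>n\<close> (\<open>card_unreq_tends\<close>);

  \<^item> the next object is \<open>i\<close> with probability \<open>p i\<close>, independently of the past, so that it avoids
    the window with probability the mean of \<open>\<Sum>i. p i * exp (- (p i * n * \<mu> * u))\<close>, which tends
    to \<open>- \<phi>' u / \<mu>\<close> (\<open>prob_next_unrequested\<close>).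

Together these give the limit \<open>1 + \<phi>' u / \<mu>\<close> of the distribution function at \<open>1 - \<phi> u\<close>
(\<open>cost_cdf_requested\<close>), which is the value there of the distribution function of \<open>S_inf\<close>
(\<open>D_atMost\<close>, by the fundamental theorem of calculus). Taking \<open>u = t\<close> gives the probability of
the out-of-equilibrium event.

Beyond \<open>1 - \<phi> t\<close> the cost is that of an object never requested before. It stands behind all
requested objects, and its rank among the unrequested ones is given by the order of the labels. By
exchangeability this rank is uniform, given the set of unrequested objects
(\<open>joint_weight_large_ranks\<close>), and this produces the uniform part of the limit
(\<open>cost_cdf_unrequested\<close>). Monotonicity then turns convergence at random points into weak
convergence (\<open>weak_convI_random_points\<close>).

The joint law of the set of unrequested objects and the next object is obtained in two steps. The
counts in finitely many windows determine lower bounds \<open>joint_weight\<close> for the probabilities of its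
values (\<open>joint_weight_le\<close>). These bounds add up to the probability that not all weights vanish,
which tends to \<open>1\<close>; hence nothing is lost in the limit (\<open>prob_pair_approx\<close>).

The density of the limit comes from splitting according to whether \<open>S_inf\<close> exceeds \<open>1 - \<phi> t\<close>, and the
total variation norm is the \<open>L\<^sup>1\<close> distance of the two densities.
\<close>

section \<open>Laplace transforms on the half-line\<close>

text \<open>Up to the sign, this is the \<open>k\<close>-th derivative of the Laplace transform.\<close>

definition tilted_moment :: "real measure \<Rightarrow> nat \<Rightarrow> real \<Rightarrow> real" where
  "tilted_moment P k s = (LINT x|P. x ^ k * exp (- (s * x)))"

text \<open>One term of the power series of \<open>exp (s * x)\<close> is at most its sum.\<close>

lemma power_times_exp_le:
  assumes "0 \<le> (x::real)" "0 < s"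
  shows "x ^ k * exp (- (s * x)) \<le> fact k / s ^ k"
proof -
  have "(s * x) ^ k / fact k \<le> exp (s * x)"
  proof -
    have "sum (\<lambda>n. (s * x) ^ n /\<^sub>R fact n) {k} \<le> (\<Sum>n. (s * x) ^ n /\<^sub>R fact n)"
      by (rule sum_le_suminf[OF summable_exp_generic]) (use assms in auto)
    then show ?thesis
      by (simp add: exp_def divide_inverse mult.commute)
  qed
  then have "x ^ k * s ^ k \<le> fact k * exp (s * x)"
    by (simp add: power_mult_distrib field_simps)
  then show ?thesis
    using assms by (simp add: exp_minus field_simps)
qed

text \<open>From \<open>1 + y \<le> exp y\<close>, used at \<open>y\<close> and at \<open>- y\<close>.\<close>

lemma exp_remainder_le: "\<bar>exp y - 1 - y\<bar> \<le> y\<^sup>2 * exp \<bar>y\<bar>" for y :: real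
proof -
  have 1: "1 + y \<le> exp y" "1 - y \<le> exp (- y)"
    using exp_ge_add_one_self[of y] exp_ge_add_one_self[of "- y"] by auto
  then have 0: "\<bar>exp y - 1 - y\<bar> = exp y - 1 - y"
    by linarith
  have 2: "exp y - 1 \<le> y * exp y"
    using mult_right_mono[OF 1(2), of "exp y"] by (simp add: exp_minus field_simps)
  show ?thesis
  proof (cases "0 \<le> y")
    case True
    have "exp y - 1 - y \<le> y * (exp y - 1)"
      using 2 by (simp add: algebra_simps)
    also have "\<dots> \<le> y * (y * exp y)"
      using True 2 by (intro mult_left_mono) auto
    finally show ?thesis
      using 0 True by (simp add: power2_eq_square mult.assoc)
  next
    case False
    have "exp y - 1 - y \<le> y * (exp y - 1)"
      using 2 by (simp add: algebra_simps)
    also have "\<dots> \<le> y * y"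
      using False 1(1) by (intro mult_left_mono_neg; linarith)
    also have "\<dots> \<le> y\<^sup>2 * exp \<bar>y\<bar>"
      using mult_left_mono[of 1 "exp \<bar>y\<bar>" "y\<^sup>2"] by (simp add: power2_eq_square)
    finally show ?thesis
      using 0 by simp
  qed
qed

lemma exp_neg_mult_at_top:
  fixes X :: "nat \<Rightarrow> real"
  assumes X: "filterlim X at_top F" and x: "0 < x"
  shows "((\<lambda>n. exp (- (max 0 (X n) * x))) \<longlongrightarrow> 0) F"
proof -
  have "filterlim (\<lambda>n. max 0 (X n)) at_top F"
    by (rule filterlim_at_top_mono[OF X]) simp
  then have "filterlim (\<lambda>n. x * max 0 (X n)) at_top F"
    by (rule filterlim_tendsto_pos_mult_at_top[OF tendsto_const x])
  then have "filterlim (\<lambda>n. - (max 0 (X n) * x)) at_bot F"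
    by (simp add: filterlim_uminus_at_top mult.commute)
  then show ?thesis
    by (rule filterlim_compose[OF exp_at_bot])
qed

locale halfline_law = real_distribution P for P :: "real measure" +
  assumes AE_nonneg: "AE x in P. 0 \<le> x"
    and integrable_mean: "integrable P (\<lambda>x. x)"
    and mean_nonzero: "(LINT x|P. x) \<noteq> 0"
begin

abbreviation "\<mu> \<equiv> (LINT x|P. x)"
abbreviation "\<phi> \<equiv> laplace_transform P"
abbreviation "mom \<equiv> tilted_moment P"

lemma sets_P [measurable_cong]: "sets P = sets borel"
  using events_eq_borel by simp

lemma mean_pos: "0 < \<mu>"
  using integral_nonneg_AE[of "\<lambda>x. x" P] AE_nonneg mean_nonzero by auto

lemma phi_eq_mom: "\<phi> = mom 0"
  by (auto simp: laplace_transform_def tilted_moment_def)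

lemma integrable_tilted:
  assumes "0 < s" shows "integrable P (\<lambda>x. x ^ k * exp (- (s * x)))"
proof (rule integrable_const_bound[where B = "fact k / s ^ k"])
  show "AE x in P. norm (x ^ k * exp (- (s * x))) \<le> fact k / s ^ k"
    using AE_nonneg by eventually_elim (use power_times_exp_le assms in auto)
qed simp

lemma integrable_laplace:
  assumes "0 \<le> s" shows "integrable P (\<lambda>x. exp (- (s * x)))"
proof (rule integrable_const_bound[where B = 1])
  show "AE x in P. norm (exp (- (s * x))) \<le> 1"
    using AE_nonneg by eventually_elim (use assms in auto)
qed simp

text \<open>Differentiation under the integral sign. The remainder of the difference quotient is bounded
  uniformly in \<open>x \<ge> 0\<close>, because the factor \<open>exp (- (s * x))\<close> of the integrand absorbs all powers of \<open>x\<close>.\<close>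

lemma tilted_moment_deriv:
  assumes s: "0 < s"
  shows "(mom k has_real_derivative - mom (Suc k) s) (at s)"
proof -
  \<comment> \<open>This bounds \<open>x ^ (k + 2) * exp (- (s / 2 * x))\<close>; half of the rate \<open>s\<close> is given away to the increment \<open>h\<close>.\<close>
  define C where "C = fact (k + 2) / (s / 2) ^ (k + 2)"
  have bound: "\<bar>(mom k (s + h) - mom k s) / h + mom (Suc k) s\<bar> \<le> C * \<bar>h\<bar>"
    if h: "\<bar>h\<bar> < s / 2" "h \<noteq> 0" for h
  proof -
    have sh: "0 < s + h" using h by linarith
    let ?D = "\<lambda>x. x ^ k * exp (- ((s + h) * x)) - x ^ k * exp (- (s * x))
                + h * (x ^ Suc k * exp (- (s * x)))"
    have eq: "(LINT x|P. ?D x) = mom k (s + h) - mom k s + h * mom (Suc k) s"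
      using integrable_tilted[OF sh, of k] integrable_tilted[OF s, of k]
        integrable_tilted[OF s, of "Suc k"]
      by (simp add: tilted_moment_def del: power_Suc)
    have pt: "\<bar>?D x\<bar> \<le> h\<^sup>2 * C" if x: "0 \<le> x" for x
    proof -
      have "?D x = x ^ k * exp (- (s * x)) * (exp (- h * x) - 1 - (- h * x))"
        by (simp add: algebra_simps exp_add[symmetric])
      then have "\<bar>?D x\<bar> = x ^ k * exp (- (s * x)) * \<bar>exp (- h * x) - 1 - (- h * x)\<bar>"
        using x by (simp only: abs_mult) simp
      also have "\<dots> \<le> x ^ k * exp (- (s * x)) * ((- h * x)\<^sup>2 * exp \<bar>- h * x\<bar>)"
        by (rule mult_left_mono[OF exp_remainder_le]) (use x in auto)
      also have "\<dots> = h\<^sup>2 * (x ^ (k + 2) * exp (- (s * x) + \<bar>h\<bar> * x))"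
        unfolding exp_add using x by (simp add: power_mult_distrib power_add power2_eq_square abs_mult mult_ac)
      also have "\<dots> \<le> h\<^sup>2 * (x ^ (k + 2) * exp (- (s / 2 * x)))"
        using x h mult_right_mono[of "\<bar>h\<bar>" "s / 2" x] by (intro mult_left_mono) auto
      also have "\<dots> \<le> h\<^sup>2 * C"
        unfolding C_def using x s by (intro mult_left_mono power_times_exp_le) auto
      finally show ?thesis .
    qed
    have "\<bar>LINT x|P. ?D x\<bar> \<le> (LINT x|P. \<bar>?D x\<bar>)"
      by (rule integral_abs_bound)
    also have "\<dots> \<le> (LINT x|P. h\<^sup>2 * C)"
    proof (rule integral_mono_AE)
      show "integrable P (\<lambda>x. \<bar>?D x\<bar>)"
        using integrable_tilted[OF sh, of k] integrable_tilted[OF s, of k]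
          integrable_tilted[OF s, of "Suc k"]
        by (intro integrable_abs Bochner_Integration.integrable_add
            Bochner_Integration.integrable_diff integrable_mult_right) auto
      show "AE x in P. \<bar>?D x\<bar> \<le> h\<^sup>2 * C"
        using AE_nonneg by eventually_elim (rule pt)
    qed simp
    finally have "\<bar>mom k (s + h) - mom k s + h * mom (Suc k) s\<bar> \<le> h\<^sup>2 * C"
      unfolding eq using prob_space by simp
    then have "\<bar>(mom k (s + h) - mom k s + h * mom (Suc k) s) / h\<bar> \<le> h\<^sup>2 * C / \<bar>h\<bar>"
      using h by (simp add: abs_divide divide_right_mono)
    moreover have "h\<^sup>2 * C / \<bar>h\<bar> = C * \<bar>h\<bar>"
      using h by (simp add: power2_eq_square abs_if)
    moreover have "(mom k (s + h) - mom k s + h * mom (Suc k) s) / h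
        = (mom k (s + h) - mom k s) / h + mom (Suc k) s"
      using h by (simp add: field_simps)
    ultimately show ?thesis by simp
  qed
  have "((\<lambda>h. (mom k (s + h) - mom k s) / h + mom (Suc k) s) \<longlongrightarrow> 0) (at 0)"
  proof (rule Lim_null_comparison)
    show "\<forall>\<^sub>F h in at 0. norm ((mom k (s + h) - mom k s) / h + mom (Suc k) s) \<le> C * \<bar>h\<bar>"
      using bound s unfolding eventually_at by (intro exI[of _ "s / 2"]) (auto simp: dist_norm)
    show "((\<lambda>h. C * \<bar>h\<bar>) \<longlongrightarrow> 0) (at 0)"
      by (auto intro!: tendsto_eq_intros)
  qed
  then have "((\<lambda>h. (mom k (s + h) - mom k s) / h) \<longlongrightarrow> - mom (Suc k) s) (at 0)"
    using LIM_zero_iff[of "\<lambda>h. (mom k (s + h) - mom k s) / h" "- mom (Suc k) s" "at 0"] by simp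
  then show ?thesis
    by (simp add: DERIV_def)
qed

lemma deriv_phi: "0 < s \<Longrightarrow> deriv \<phi> s = - mom 1 s"
  unfolding phi_eq_mom using tilted_moment_deriv[of s 0] by (auto intro: DERIV_imp_deriv)

lemma deriv_deriv_phi:
  assumes s: "0 < s" shows "deriv (deriv \<phi>) s = mom 2 s"
proof -
  have "((\<lambda>s. - mom 1 s) has_real_derivative mom 2 s) (at s)"
    using DERIV_minus[OF tilted_moment_deriv[OF s, of 1]] by (simp add: numeral_2_eq_2)
  then have "(deriv \<phi> has_real_derivative mom 2 s) (at s)"
    by (rule has_field_derivative_transform_within_open[of _ _ _ "{0<..}"])
       (use s deriv_phi in auto)
  then show ?thesis by (rule DERIV_imp_deriv)
qed

lemma not_AE_zero: "\<not> (AE x in P. x = 0)"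
proof
  assume "AE x in P. x = 0"
  then have "\<mu> = (LINT x|P. 0)"
    by (intro integral_cong_AE) auto
  then show False using mean_nonzero by simp
qed

lemma mom_pos:
  assumes "0 < s" shows "0 < mom k s"
proof -
  have nn: "AE x in P. 0 \<le> x ^ k * exp (- (s * x))"
    using AE_nonneg by eventually_elim simp
  then have "0 \<le> mom k s"
    unfolding tilted_moment_def by (rule integral_nonneg_AE)
  moreover have "mom k s \<noteq> 0"
  proof
    assume "mom k s = 0"
    then have "AE x in P. x ^ k * exp (- (s * x)) = 0"
      using integral_nonneg_eq_0_iff_AE[OF integrable_tilted[OF assms, of k] nn]
      by (simp add: tilted_moment_def)
    then have "AE x in P. x = 0"
      by eventually_elim auto
    then show False using not_AE_zero by simp
  qed
  ultimately show ?thesis by simp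
qed

lemma phi_0: "\<phi> 0 = 1"
  using prob_space by (simp add: laplace_transform_def)

text \<open>Strictness uses that \<open>P\<close> is not the point mass at \<open>0\<close>, that is, \<open>\<mu> \<noteq> 0\<close>.\<close>

lemma phi_strict_antimono:
  assumes "0 \<le> r" "r < s" shows "\<phi> s < \<phi> r"
proof -
  have int: "integrable P (\<lambda>x. exp (- (r * x)) - exp (- (s * x)))"
    using integrable_laplace assms by auto
  have eq: "(LINT x|P. exp (- (r * x)) - exp (- (s * x))) = \<phi> r - \<phi> s"
    using integrable_laplace assms by (simp add: laplace_transform_def)
  have nn: "AE x in P. 0 \<le> exp (- (r * x)) - exp (- (s * x))"
    using AE_nonneg by eventually_elim (use assms in \<open>auto intro: mult_right_mono\<close>)
  have "0 \<le> \<phi> r - \<phi> s"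
    using integral_nonneg_AE[OF nn] eq by simp
  moreover have "\<phi> r - \<phi> s \<noteq> 0"
  proof
    assume "\<phi> r - \<phi> s = 0"
    then have "AE x in P. exp (- (r * x)) - exp (- (s * x)) = 0"
      using integral_nonneg_eq_0_iff_AE[OF int nn] eq by simp
    then have "AE x in P. x = 0"
      by eventually_elim (use assms in auto)
    then show False using not_AE_zero by simp
  qed
  ultimately show ?thesis by simp
qed

lemma tendsto_laplace_seq:
  assumes X: "X \<longlonglongrightarrow> s" and nn: "\<And>n. 0 \<le> X n"
  shows "(\<lambda>n. \<phi> (X n)) \<longlonglongrightarrow> \<phi> s"
  unfolding laplace_transform_def
proof (rule integral_dominated_convergence[where w = "\<lambda>_. 1"])
  show "AE x in P. (\<lambda>n. exp (- (X n * x))) \<longlonglongrightarrow> exp (- (s * x))"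
    by (intro AE_I2 tendsto_intros X)
  show "AE x in P. norm (exp (- (X n * x))) \<le> 1" for n
    using AE_nonneg by eventually_elim (use nn in auto)
qed auto

lemma continuous_on_phi: "continuous_on {0..} \<phi>"
  by (rule continuous_on_sequentiallyI) (use tendsto_laplace_seq in auto)

text \<open>As the rate grows, only the atom at \<open>0\<close> survives.\<close>

lemma integral_times_exp_at_top:
  fixes X :: "nat \<Rightarrow> real"
  assumes g: "integrable P g" and X: "filterlim X at_top sequentially"
  shows "(\<lambda>n. LINT x|P. g x * exp (- (X n * x))) \<longlonglongrightarrow> (LINT x|P. g x * indicator {0} x)"
proof -
  \<comment> \<open>The maximum makes \<open>\<bar>g\<bar>\<close> a dominating function for all \<open>n\<close>, not only eventually.\<close>
  have "(\<lambda>n. LINT x|P. g x * exp (- (max 0 (X n) * x))) \<longlonglongrightarrow> (LINT x|P. g x * indicator {0} x)"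
  proof (rule integral_dominated_convergence[where w = "\<lambda>x. \<bar>g x\<bar>"])
    show "integrable P (\<lambda>x. \<bar>g x\<bar>)" using g by simp
    show "AE x in P. (\<lambda>n. g x * exp (- (max 0 (X n) * x))) \<longlonglongrightarrow> g x * indicator {0} x"
      using AE_nonneg
    proof eventually_elim
      case (elim x)
      show ?case
      proof (cases "x = 0")
        case False
        with elim have "0 < x" by simp
        from tendsto_mult[OF tendsto_const exp_neg_mult_at_top[OF X this]] False show ?thesis by simp
      qed simp
    qed
    show "AE x in P. norm (g x * exp (- (max 0 (X n) * x))) \<le> \<bar>g x\<bar>" for n
      using AE_nonneg by eventually_elim (auto simp: abs_mult intro!: mult_left_le)
  qed (use borel_measurable_integrable[OF g] in auto)
  moreover have "\<forall>\<^sub>F n in sequentially.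
      (LINT x|P. g x * exp (- (max 0 (X n) * x))) = (LINT x|P. g x * exp (- (X n * x)))"
    using filterlim_at_top_dense[THEN iffD1, OF X, rule_format, of 0]
    by eventually_elim (simp add: max_def)
  ultimately show ?thesis by (rule Lim_transform_eventually)
qed

lemma phi_at_top: "(\<phi> \<longlongrightarrow> measure P {0}) at_top"
  by (rule tendsto_at_topI_sequentially)
     (use integral_times_exp_at_top[of "\<lambda>_. 1"] in \<open>simp add: laplace_transform_def\<close>)

lemma mom_1_at_top: "(mom 1 \<longlongrightarrow> 0) at_top"
proof (rule tendsto_at_topI_sequentially)
  fix X :: "nat \<Rightarrow> real" assume X: "filterlim X at_top sequentially"
  have "(LINT x|P. x * indicator {0} x) = (LINT x|P. 0)"
    by (rule Bochner_Integration.integral_cong) (auto simp: indicator_def)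
  then show "(\<lambda>n. mom 1 (X n)) \<longlonglongrightarrow> 0"
    using integral_times_exp_at_top[OF integrable_mean X] by (simp add: tilted_moment_def)
qed

lemma phi_gt_mass_zero:
  assumes "0 \<le> s" shows "measure P {0} < \<phi> s"
proof -
  have "measure P {0} \<le> \<phi> (s + 1)"
  proof (rule tendsto_upperbound[OF phi_at_top])
    show "\<forall>\<^sub>F x in at_top. \<phi> x \<le> \<phi> (s + 1)"
      using eventually_gt_at_top[of "s + 1"]
      by eventually_elim (use phi_strict_antimono[of "s + 1"] assms in force)
  qed simp
  then show ?thesis using phi_strict_antimono[of s "s + 1"] assms by simp
qed

lemma phi_less_1: "0 < s \<Longrightarrow> \<phi> s < 1"
  using phi_strict_antimono[of 0 s] phi_0 by simp

lemma phi_pos: "0 \<le> s \<Longrightarrow> 0 < \<phi> s"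
  using phi_gt_mass_zero[of s] measure_nonneg[of P "{0}"] by linarith

lemma inj_on_phi: "inj_on \<phi> {0..}"
  by (rule linorder_inj_onI) (use phi_strict_antimono in force)+

lemma inv_phi: "0 \<le> s \<Longrightarrow> inv_into {0..} \<phi> (\<phi> s) = s"
  by (simp add: inv_into_f_f[OF inj_on_phi])

end

section \<open>The limit law\<close>

context halfline_law
begin

abbreviation "p0 \<equiv> measure P {0}"
abbreviation "dens \<equiv> limit_density P"

lemma phi_onto:
  assumes "p0 < y" "y < 1"
  obtains s where "0 < s" "\<phi> s = y"
proof -
  obtain b where b: "0 < b" "\<phi> b < y"
    using order_tendstoD(2)[OF phi_at_top assms(1)] eventually_gt_at_top[of 0]
    by (metis (mono_tags, lifting) eventually_conj eventually_happens trivial_limit_at_top_linorder)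
  have "\<exists>s\<ge>0. s \<le> b \<and> \<phi> s = y"
    by (rule IVT2') (use b assms phi_0 in \<open>auto intro: continuous_on_subset[OF continuous_on_phi]\<close>)
  then obtain s where s: "0 \<le> s" "\<phi> s = y" by blast
  with assms phi_0 have "s \<noteq> 0" by auto
  with s have "0 < s" by simp
  with s that show ?thesis by blast
qed

lemma limit_density_eq:
  assumes "0 < s" shows "dens (1 - \<phi> s) = mom 2 s / (\<mu> * mom 1 s)"
proof -
  have "1 - \<phi> s \<in> {0..1 - p0}"
    using phi_gt_mass_zero[of s] phi_less_1[of s] assms by auto
  then show ?thesis
    using assms mom_pos[of s 1] mean_pos
    by (simp add: limit_density_def inv_phi deriv_phi deriv_deriv_phi field_simps)
qed

text \<open>At the two excluded points the inverse function or the derivatives may have arbitrary values.\<close>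

lemma limit_density_nonneg:
  assumes "x \<notin> {0, 1 - p0}" shows "0 \<le> dens x"
proof (cases "0 < x \<and> x < 1 - p0")
  case True
  then obtain s where "0 < s" "\<phi> s = 1 - x"
    using phi_onto[of "1 - x"] by auto
  then have "dens x = mom 2 s / (\<mu> * mom 1 s)"
    using limit_density_eq[of s] by simp
  then show ?thesis
    using mom_pos[OF \<open>0 < s\<close>] mean_pos by (simp add: less_imp_le)
next
  case False
  then have "x \<notin> {0..1 - p0}" using assms by auto
  then show ?thesis by (simp add: limit_density_def)
qed

lemma AE_limit_density_nonneg: "AE x in lborel. 0 \<le> dens x"
proof -
  have "AE x in lborel. x \<noteq> 0 \<and> x \<noteq> 1 - p0"
    using AE_lborel_singleton[of 0] AE_lborel_singleton[of "1 - p0"] by (auto simp: eventually_conj_iff)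
  then show ?thesis
    by eventually_elim (rule limit_density_nonneg, auto)
qed

text \<open>On \<open>{0<..<1 - p0}\<close> the density has the antiderivative \<open>- mom 1 (\<phi>\<^sup>-\<^sup>1 (1 - x)) / \<mu>\<close>.\<close>

lemma limit_cdf_deriv:
  assumes s: "0 < s"
  shows "((\<lambda>x. - mom 1 (inv_into {0..} \<phi> (1 - x)) / \<mu>) has_real_derivative dens (1 - \<phi> s)) (at (1 - \<phi> s))"
proof -
  have "DERIV (inv_into {0..} \<phi>) (\<phi> s) :> inverse (- mom 1 s)"
    unfolding has_field_derivative_def
  proof (rule has_derivative_inverse_strong[where S = "{0<..}" and f = \<phi> and x = s])
    show "(\<phi> has_derivative (*) (- mom 1 s)) (at s)"
      using tilted_moment_deriv[OF s, of 0] by (simp add: phi_eq_mom has_field_derivative_def)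
    show "continuous_on {0<..} \<phi>"
      by (rule continuous_on_subset[OF continuous_on_phi]) auto
  qed (use s mom_pos[OF s, of 1] inv_phi in auto)
  then have "((\<lambda>x. inv_into {0..} \<phi> (1 - x)) has_real_derivative inverse (- mom 1 s) * (- 1)) (at (1 - \<phi> s))"
    by (intro DERIV_chain') (auto intro!: derivative_eq_intros)
  moreover have "(mom 1 has_real_derivative - mom 2 s) (at (inv_into {0..} \<phi> (1 - (1 - \<phi> s))))"
    using tilted_moment_deriv[OF s, of 1] s by (simp add: inv_phi numeral_2_eq_2)
  ultimately have "((\<lambda>x. mom 1 (inv_into {0..} \<phi> (1 - x))) has_real_derivative
      - mom 2 s * (inverse (- mom 1 s) * (- 1))) (at (1 - \<phi> s))"
    by (rule DERIV_chain')
  then have "((\<lambda>x. - mom 1 (inv_into {0..} \<phi> (1 - x)) / \<mu>) has_real_derivative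
      - (- mom 2 s * (inverse (- mom 1 s) * (- 1))) / \<mu>) (at (1 - \<phi> s))"
    by (intro DERIV_cdivide DERIV_minus)
  moreover have "- (- mom 2 s * (inverse (- mom 1 s) * (- 1))) / \<mu> = dens (1 - \<phi> s)"
    using mom_pos[OF s, of 1] mean_pos by (simp add: limit_density_eq[OF s] field_simps)
  ultimately show ?thesis by simp
qed

end

text \<open>The assumptions hold as soon as some random variable has the density \<open>dens\<close>. So the total mass \<open>1\<close> is
  given, and only the tail of the density has to be integrated.\<close>

locale limit_density_law = halfline_law +
  assumes ennreal_density_measurable: "(\<lambda>x. ennreal (dens x)) \<in> borel_measurable borel"
    and prob_space_density: "prob_space (density lborel (\<lambda>x. ennreal (dens x)))"
begin

abbreviation "D \<equiv> density lborel (\<lambda>x. ennreal (dens x))"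

sublocale D: prob_space D
  by (rule prob_space_density)

text \<open>Passing to \<open>ennreal\<close> forgets negative values, but these can occur only at \<open>0\<close> and \<open>1 - p0\<close>.\<close>

lemma dens_measurable [measurable]: "dens \<in> borel_measurable borel"
proof (rule measurable_discrete_difference)
  show "(\<lambda>x. enn2real (ennreal (dens x))) \<in> borel_measurable borel"
    using ennreal_density_measurable by measurable
  show "countable {0, 1 - p0}" by simp
qed (use limit_density_nonneg in auto)

lemma D_atLeastAtMost:
  assumes "0 < r" "r \<le> s"
  shows "measure D {1 - \<phi> r..1 - \<phi> s} = (mom 1 r - mom 1 s) / \<mu>"
proof -
  let ?H = "\<lambda>x. - mom 1 (inv_into {0..} \<phi> (1 - x)) / \<mu>"
  have ex: "\<exists>u>0. x = 1 - \<phi> u" if "x \<in> {1 - \<phi> r..1 - \<phi> s}" for x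
  proof -
    have "p0 < 1 - x" "1 - x < 1"
      using that phi_gt_mass_zero[of s] phi_less_1[of r] assms by auto
    from phi_onto[OF this] show ?thesis by (metis add_diff_cancel_left' diff_add_cancel)
  qed
  have le: "1 - \<phi> r \<le> 1 - \<phi> s"
    using phi_strict_antimono[of r s] assms by (cases "r = s") auto
  have "(\<integral>\<^sup>+x. ennreal (dens x) * indicator {1 - \<phi> r..1 - \<phi> s} x \<partial>lborel)
      = ?H (1 - \<phi> s) - ?H (1 - \<phi> r)"
  proof (rule nn_integral_FTC_Icc[OF _ _ _ le])
    fix x assume "x \<in> {1 - \<phi> r..1 - \<phi> s}"
    then obtain u where u: "u > 0" "x = 1 - \<phi> u" using ex by blast
    show "(?H has_real_derivative dens x) (at x)"
      unfolding u(2) by (rule limit_cdf_deriv[OF u(1)])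
    show "0 \<le> dens x"
      unfolding u(2) limit_density_eq[OF u(1)] using mom_pos[OF u(1)] mean_pos by (simp add: less_imp_le)
  qed simp
  also have "?H (1 - \<phi> s) - ?H (1 - \<phi> r) = (mom 1 r - mom 1 s) / \<mu>"
    using assms by (simp add: inv_phi diff_divide_distrib)
  finally have "emeasure D {1 - \<phi> r..1 - \<phi> s} = (mom 1 r - mom 1 s) / \<mu>"
    by (simp add: emeasure_density)
  moreover have "mom 1 s \<le> mom 1 r"
    unfolding tilted_moment_def
  proof (rule integral_mono_AE)
    show "AE x in P. x ^ 1 * exp (- (s * x)) \<le> x ^ 1 * exp (- (r * x))"
      using AE_nonneg by eventually_elim (use assms in \<open>auto intro!: mult_left_mono mult_right_mono\<close>)
  qed (use integrable_tilted[of _ 1] assms in auto)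
  ultimately show ?thesis
    using mean_pos by (simp add: measure_def)
qed

lemma D_null: "A \<in> sets borel \<Longrightarrow> (\<And>x. x \<in> A \<Longrightarrow> x \<noteq> c \<Longrightarrow> dens x = 0) \<Longrightarrow> measure D A = 0"
proof -
  assume A: "A \<in> sets borel" "\<And>x. x \<in> A \<Longrightarrow> x \<noteq> c \<Longrightarrow> dens x = 0"
  have "emeasure D A = (\<integral>\<^sup>+x. ennreal (dens x) * indicator A x \<partial>lborel)"
    using A by (simp add: emeasure_density)
  also have "\<dots> = (\<integral>\<^sup>+x. 0 \<partial>(lborel :: real measure))"
  proof (rule nn_integral_cong_AE)
    show "AE x in lborel. ennreal (dens x) * indicator A x = 0"
      using AE_lborel_singleton[of c] by eventually_elim (use A(2) in \<open>auto simp: indicator_def\<close>)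
  qed
  finally show ?thesis by (simp add: measure_def)
qed

text \<open>The mass between \<open>1 - \<phi> r\<close> and \<open>1 - \<phi> s\<close> is known for all \<open>s\<close>; let \<open>s\<close> tend to infinity.\<close>

lemma D_greaterThan:
  assumes r: "0 < r"
  shows "measure D {1 - \<phi> r<..} = mom 1 r / \<mu>"
proof -
  let ?A = "\<lambda>n. {1 - \<phi> r..1 - \<phi> (r + real n)}"
  have phi_mono: "\<phi> (r + y) \<le> \<phi> (r + x)" if "0 \<le> x" "x \<le> y" for x y
    using phi_strict_antimono[of "r + x" "r + y"] that r by (cases "x = y") auto
  have un: "(\<Union>n. ?A n) = {1 - \<phi> r..<1 - p0}"
  proof (intro equalityI subsetI)
    fix x assume "x \<in> (\<Union>n. ?A n)"
    then obtain n where "1 - \<phi> r \<le> x" "x \<le> 1 - \<phi> (r + real n)" by auto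
    then show "x \<in> {1 - \<phi> r..<1 - p0}"
      using phi_gt_mass_zero[of "r + real n"] r by simp
  next
    fix x assume x: "x \<in> {1 - \<phi> r..<1 - p0}"
    have "\<forall>\<^sub>F s in at_top. \<phi> s < 1 - x"
      using x by (intro order_tendstoD(2)[OF phi_at_top]) auto
    moreover have "filterlim (\<lambda>n. r + real n) at_top sequentially"
      by (rule filterlim_tendsto_add_at_top[OF tendsto_const filterlim_real_sequentially])
    ultimately have "\<forall>\<^sub>F n in sequentially. \<phi> (r + real n) < 1 - x"
      by (rule eventually_compose_filterlim)
    then obtain n where "\<phi> (r + real n) < 1 - x"
      by (auto simp: eventually_sequentially)
    with x show "x \<in> (\<Union>n. ?A n)" by (auto intro!: exI[of _ n])
  qed
  have "(\<lambda>n. measure D (?A n)) \<longlonglongrightarrow> measure D (\<Union>n. ?A n)"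
    by (rule D.finite_Lim_measure_incseq) (auto intro!: incseq_SucI elim!: order_trans simp: phi_mono)
  moreover have "(\<lambda>n. measure D (?A n)) \<longlonglongrightarrow> (mom 1 r - 0) / \<mu>"
  proof -
    have "filterlim (\<lambda>n. r + real n) at_top sequentially"
      by (rule filterlim_tendsto_add_at_top[OF tendsto_const filterlim_real_sequentially])
    then have "(\<lambda>n. mom 1 (r + real n)) \<longlonglongrightarrow> 0"
      by (rule filterlim_compose[OF mom_1_at_top])
    then show ?thesis
      using r mean_nonzero by (subst D_atLeastAtMost) (auto intro!: tendsto_eq_intros)
  qed
  ultimately have 1: "measure D {1 - \<phi> r..<1 - p0} = mom 1 r / \<mu>"
    unfolding un using LIMSEQ_unique by fastforce
  have 2: "measure D {1 - p0..} = 0"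
    by (rule D_null[of _ "1 - p0"]) (auto simp: limit_density_def)
  have 3: "measure D {1 - \<phi> r} = 0"
    by (rule D_null[of _ "1 - \<phi> r"]) auto
  have eq: "{1 - \<phi> r<..} = ({1 - \<phi> r..<1 - p0} \<union> {1 - p0..}) - {1 - \<phi> r}"
    using phi_gt_mass_zero[of r] r by auto
  have "measure D ({1 - \<phi> r..<1 - p0} \<union> {1 - p0..}) = mom 1 r / \<mu>"
    using 1 2 by (subst D.finite_measure_Union) auto
  then show ?thesis
    unfolding eq
    by (subst measure_Diff_null_set) (use 3 in \<open>simp_all add: null_setsI D.emeasure_eq_measure\<close>)
qed

lemma D_atMost:
  assumes r: "0 < r"
  shows "measure D {..1 - \<phi> r} = 1 - mom 1 r / \<mu>"
proof -
  have "{..1 - \<phi> r} = space D - {1 - \<phi> r<..}" by auto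
  then show ?thesis using D.prob_compl[of "{1 - \<phi> r<..}"] D_greaterThan[OF r] by simp
qed

lemma D_nonpos:
  assumes "y \<le> 0" shows "measure D {..y} = 0"
  by (rule D_null[of _ 0]) (use assms in \<open>auto simp: limit_density_def\<close>)

end

text \<open>Splitting according to whether \<open>X\<close> exceeds \<open>c\<close> and using independence.\<close>

lemma (in prob_space) distributed_switch_to_uniform:
  fixes X U :: "'a \<Rightarrow> real" and f :: "real \<Rightarrow> ennreal"
  assumes X: "distributed M lborel X f"
    and U: "U \<in> borel_measurable M" "distr M borel U = uniform_measure lborel {c..d}" "c < d"
    and indep: "indep_var borel X borel U"
  shows "distributed M lborel (\<lambda>\<omega>. X \<omega> * of_bool (X \<omega> \<le> c) + U \<omega> * of_bool (X \<omega> > c))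
     (\<lambda>x. f x * indicator {..c} x
            + ennreal (prob {\<omega>\<in>space M. X \<omega> > c} / (d - c)) * indicator {c..d} x)"
    (is "distributed M lborel ?Y ?g")
proof -
  have fm [measurable]: "f \<in> borel_measurable borel" and Xm [measurable]: "X \<in> borel_measurable M"
    using X by (auto simp: distributed_def)
  note Um [measurable] = U(1)
  have Ym [measurable]: "?Y \<in> borel_measurable M" by measurable
  have "emeasure (distr M lborel ?Y) B = emeasure (density lborel ?g) B" if B: "B \<in> sets (distr M lborel ?Y)" for B
  proof -
    have B' [measurable]: "B \<in> sets borel" using B by simp
    have "?Y -` B \<inter> space M = (X -` (B \<inter> {..c}) \<inter> space M) \<union> ((X -` {c<..} \<inter> space M) \<inter> (U -` B \<inter> space M))"
      by (auto simp: of_bool_def split: if_splits)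
    then have "emeasure M (?Y -` B \<inter> space M) =
        emeasure M (X -` (B \<inter> {..c}) \<inter> space M) + emeasure M ((X -` {c<..} \<inter> space M) \<inter> (U -` B \<inter> space M))"
      by (simp only:) (rule plus_emeasure[symmetric], auto intro!: measurable_sets[OF Xm] sets.Int measurable_sets[OF Um])
    also have "emeasure M (X -` (B \<inter> {..c}) \<inter> space M) = (\<integral>\<^sup>+x. f x * indicator (B \<inter> {..c}) x \<partial>lborel)"
      by (rule distributed_emeasure[OF X]) auto
    also have "emeasure M ((X -` {c<..} \<inter> space M) \<inter> (U -` B \<inter> space M)) =
        emeasure M (X -` {c<..} \<inter> space M) * emeasure M (U -` B \<inter> space M)"
    proof -
      have "prob ((X -` {c<..} \<inter> space M) \<inter> (U -` B \<inter> space M)) =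
          prob (X -` {c<..} \<inter> space M) * prob (U -` B \<inter> space M)"
        using indep_varD[OF indep, of "{c<..}" B] by (simp add: vimage_Times Int_assoc Int_left_commute comp_def)
      then show ?thesis by (simp add: emeasure_eq_measure ennreal_mult)
    qed
    also have "emeasure M (U -` B \<inter> space M) = emeasure (uniform_measure lborel {c..d}) B"
      unfolding U(2)[symmetric] by (simp add: emeasure_distr)
    also have "\<dots> = emeasure lborel ({c..d} \<inter> B) / ennreal (d - c)"
      using U(3) by (subst emeasure_uniform_measure) auto
    also have "emeasure M (X -` {c<..} \<inter> space M) * (emeasure lborel ({c..d} \<inter> B) / ennreal (d - c))
      = ennreal (prob {\<omega>\<in>space M. X \<omega> > c} / (d - c)) * emeasure lborel ({c..d} \<inter> B)"
    proof -
      have "X -` {c<..} \<inter> space M = {\<omega>\<in>space M. X \<omega> > c}" by auto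
      then show ?thesis
        using U(3) by (simp add: emeasure_eq_measure divide_ennreal[symmetric] ennreal_times_divide ennreal_divide_times mult_ac)
    qed
    also have "\<dots> = (\<integral>\<^sup>+x. ennreal (prob {\<omega>\<in>space M. X \<omega> > c} / (d - c)) * indicator ({c..d} \<inter> B) x \<partial>lborel)"
      by (subst nn_integral_cmult_indicator) auto
    finally show ?thesis
      by (simp add: emeasure_distr emeasure_density nn_integral_add[symmetric] indicator_inter_arith
          distrib_left distrib_right mult_ac)
  qed
  then have "distr M lborel ?Y = density lborel ?g"
    by (intro measure_eqI) auto
  then show ?thesis by (simp add: distributed_def)
qed

section \<open>Total variation distance\<close>

lemma measure_density_eq_set_integral:
  fixes k :: "'a \<Rightarrow> real"
  assumes "integrable L k" "AE x in L. 0 \<le> k x" "A \<in> sets L"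
  shows "measure (density L (\<lambda>x. ennreal (k x))) A = (LINT x:A|L. k x)"
proof -
  note [measurable] = borel_measurable_integrable[OF assms(1)] assms(3)
  have "emeasure (density L (\<lambda>x. ennreal (k x))) A = (\<integral>\<^sup>+x. ennreal (indicator A x *\<^sub>R k x) \<partial>L)"
    by (simp add: emeasure_density) (auto intro!: nn_integral_cong simp: indicator_def)
  also have "\<dots> = ennreal (LINT x|L. indicator A x *\<^sub>R k x)"
  proof (rule nn_integral_eq_integral)
    show "AE x in L. 0 \<le> indicator A x *\<^sub>R k x"
      using assms(2) by eventually_elim simp
  qed (use integrable_mult_indicator[OF assms(3,1)] in simp)
  finally have "emeasure (density L (\<lambda>x. ennreal (k x))) A = ennreal (LINT x|L. indicator A x *\<^sub>R k x)" .
  moreover have "0 \<le> (LINT x|L. indicator A x *\<^sub>R k x)"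
  proof (rule integral_nonneg_AE)
    show "AE x in L. 0 \<le> indicator A x *\<^sub>R k x"
      using assms(2) by eventually_elim simp
  qed
  ultimately show ?thesis
    by (simp only: measure_def set_lebesgue_integral_def enn2real_ennreal)
qed

text \<open>The supremum is attained at the partition into the two sets where \<open>g > h\<close> and \<open>g \<le> h\<close>.\<close>

lemma tv_dist_density:
  fixes g h :: "'a \<Rightarrow> real"
  assumes g: "integrable L g" "AE x in L. 0 \<le> g x" and h: "integrable L h" "AE x in L. 0 \<le> h x"
  shows "tv_dist (density L (\<lambda>x. ennreal (g x))) (density L (\<lambda>x. ennreal (h x)))
       = (LINT x|L. \<bar>g x - h x\<bar>)"
proof -
  note [measurable] = borel_measurable_integrable[OF g(1)] borel_measurable_integrable[OF h(1)]
  note meas = measure_density_eq_set_integral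
  have int: "integrable L (\<lambda>x. g x - h x)" using g h by simp
  have diff: "measure (density L (\<lambda>x. ennreal (g x))) A - measure (density L (\<lambda>x. ennreal (h x))) A
      = (LINT x:A|L. g x - h x)" if "A \<in> sets L" for A
  proof -
    have "set_integrable L A g" "set_integrable L A h"
      unfolding set_integrable_def by (intro integrable_mult_indicator that g(1) h(1))+
    then show ?thesis
      using meas[OF g that] meas[OF h that] by (subst set_integral_diff(2)) auto
  qed
  have si: "set_integrable L A (\<lambda>x. \<bar>g x - h x\<bar>)" "set_integrable L A (\<lambda>x. g x - h x)" if "A \<in> sets L" for A
    unfolding set_integrable_def by (intro integrable_mult_indicator that int integrable_abs)+
  show ?thesis
    unfolding tv_dist_def
  proof (rule cSup_eq_maximum)
    let ?P = "{x\<in>space L. g x > h x}" and ?Q = "{x\<in>space L. \<not> g x > h x}"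
    have sets: "?P \<in> sets L" "?Q \<in> sets L" by measurable
    have "(LINT x|L. \<bar>g x - h x\<bar>) = (LINT x:?P|L. \<bar>g x - h x\<bar>) + (LINT x:?Q|L. \<bar>g x - h x\<bar>)"
    proof -
      have "?P \<union> ?Q = space L" by auto
      then have "(LINT x|L. \<bar>g x - h x\<bar>) = (LINT x:?P \<union> ?Q|L. \<bar>g x - h x\<bar>)"
        using set_integral_space[OF integrable_abs[OF int]] by simp
      also have "\<dots> = (LINT x:?P|L. \<bar>g x - h x\<bar>) + (LINT x:?Q|L. \<bar>g x - h x\<bar>)"
        by (rule set_integral_Un) (use si sets in auto)
      finally show ?thesis .
    qed
    also have "(LINT x:?P|L. \<bar>g x - h x\<bar>) = (LINT x:?P|L. g x - h x)"
      using sets by (intro set_lebesgue_integral_cong) auto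
    also have "(LINT x:?Q|L. \<bar>g x - h x\<bar>) = (LINT x:?Q|L. - (g x - h x))"
      using sets by (intro set_lebesgue_integral_cong) auto
    also have uminus_Q: "\<dots> = - (LINT x:?Q|L. g x - h x)"
      unfolding set_lebesgue_integral_def by (subst integral_minus[symmetric]) (simp add: algebra_simps)
    also have "(LINT x:?P|L. g x - h x) = \<bar>LINT x:?P|L. g x - h x\<bar>"
      by (rule abs_of_nonneg[symmetric]) (auto simp: set_lebesgue_integral_def indicator_def intro!: integral_nonneg_AE)
    also have "- (LINT x:?Q|L. g x - h x) = \<bar>LINT x:?Q|L. g x - h x\<bar>"
    proof -
      have "0 \<le> (LINT x:?Q|L. - (g x - h x))"
        by (auto simp: set_lebesgue_integral_def indicator_def intro!: integral_nonneg_AE)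
      then show ?thesis using uminus_Q by linarith
    qed
    finally have eq: "(LINT x|L. \<bar>g x - h x\<bar>) =
        \<bar>LINT x:?P|L. g x - h x\<bar> + \<bar>LINT x:?Q|L. g x - h x\<bar>" .
    let ?f = "\<lambda>A. \<bar>measure (density L (\<lambda>x. ennreal (g x))) A - measure (density L (\<lambda>x. ennreal (h x))) A\<bar>"
    have "(\<Sum>A\<in>{?P, ?Q}. ?f A) = (LINT x|L. \<bar>g x - h x\<bar>)"
    proof (cases "?P = ?Q")
      case True
      then have "?P = {}" "?Q = {}" by auto
      then show ?thesis using eq by (simp add: set_lebesgue_integral_def)
    next
      case False
      then show ?thesis using eq diff[OF sets(1)] diff[OF sets(2)] by simp
    qed
    then show "(LINT x|L. \<bar>g x - h x\<bar>) \<in> (\<lambda>\<A>. \<Sum>A\<in>\<A>. ?f A) ` {\<A>. finite \<A> \<and> disjoint \<A> \<and> \<A> \<subseteq> sets (density L (\<lambda>x. ennreal (g x)))}"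
      using sets by (intro image_eqI[of _ _ "{?P, ?Q}"]) (auto simp: disjoint_def)
  next
    fix y assume "y \<in> (\<lambda>\<A>. \<Sum>A\<in>\<A>. \<bar>measure (density L (\<lambda>x. ennreal (g x))) A - measure (density L (\<lambda>x. ennreal (h x))) A\<bar>) ` {\<A>. finite \<A> \<and> disjoint \<A> \<and> \<A> \<subseteq> sets (density L (\<lambda>x. ennreal (g x)))}"
    then obtain \<A> where A: "finite \<A>" "disjoint \<A>" "\<A> \<subseteq> sets L"
      and y: "y = (\<Sum>A\<in>\<A>. \<bar>measure (density L (\<lambda>x. ennreal (g x))) A - measure (density L (\<lambda>x. ennreal (h x))) A\<bar>)" by auto
    have "y = (\<Sum>A\<in>\<A>. \<bar>LINT x:A|L. g x - h x\<bar>)"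
      unfolding y using A(3) by (intro sum.cong) (auto simp: diff subset_iff)
    also have "\<dots> \<le> (\<Sum>A\<in>\<A>. LINT x:A|L. \<bar>g x - h x\<bar>)"
      unfolding set_lebesgue_integral_def
      by (intro sum_mono order_trans[OF integral_abs_bound]) (auto simp: abs_mult)
    also have "\<dots> = (LINT x:\<Union>\<A>|L. \<bar>g x - h x\<bar>)"
      using set_integral_finite_Union[of \<A> "\<lambda>A. A" L "\<lambda>x. \<bar>g x - h x\<bar>"] A si
      by (auto simp: disjoint_family_on_def disjoint_def subset_iff)
    also have "\<dots> \<le> (LINT x|L. \<bar>g x - h x\<bar>)"
      unfolding set_lebesgue_integral_def
    proof (rule integral_mono)
      have "\<Union>\<A> \<in> sets L" using A by auto
      then show "integrable L (\<lambda>x. indicat_real (\<Union>\<A>) x *\<^sub>R \<bar>g x - h x\<bar>)"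
        using si(1) by (simp add: set_integrable_def)
    qed (use int in \<open>auto simp: indicator_def\<close>)
    finally show "y \<le> (LINT x|L. \<bar>g x - h x\<bar>)" .
  qed
qed

context limit_density_law
begin

lemma integral_dens: "integrable lborel dens"
proof (rule integrableI_nonneg)
  show "AE x in lborel. 0 \<le> dens x" by (rule AE_limit_density_nonneg)
  have "(\<integral>\<^sup>+x. ennreal (dens x) \<partial>lborel) = emeasure D (space D)"
    by (simp add: emeasure_density)
  also have "\<dots> = 1" by (rule D.emeasure_space_1)
  finally show "(\<integral>\<^sup>+x. ennreal (dens x) \<partial>lborel) < \<infinity>" by simp
qed simp

lemma dens_tail_integral:
  assumes t: "0 < t"
  shows "(LINT x:{1 - \<phi> t..1 - p0}|lborel. dens x) = mom 1 t / \<mu>"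
proof -
  have "(LINT x:{1 - \<phi> t..1 - p0}|lborel. dens x) = measure D {1 - \<phi> t..1 - p0}"
    by (rule measure_density_eq_set_integral[symmetric]) (simp_all add: integral_dens AE_limit_density_nonneg)
  also have "\<dots> = measure D {1 - \<phi> t<..}"
  proof -
    have "measure D {1 - \<phi> t} = 0" by (rule D_null[of _ "1 - \<phi> t"]) auto
    moreover have "measure D {1 - p0<..} = 0" by (rule D_null[of _ 0]) (auto simp: limit_density_def)
    moreover have "measure D ({1 - \<phi> t<..} \<union> {1 - \<phi> t}) = measure D {1 - \<phi> t<..} + measure D {1 - \<phi> t}"
      by (rule D.finite_measure_Union) auto
    moreover have "measure D ({1 - \<phi> t..1 - p0} \<union> {1 - p0<..}) = measure D {1 - \<phi> t..1 - p0} + measure D {1 - p0<..}"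
      by (rule D.finite_measure_Union) auto
    moreover have "{1 - \<phi> t<..} \<union> {1 - \<phi> t} = {1 - \<phi> t..1 - p0} \<union> {1 - p0<..}"
      using phi_gt_mass_zero[of t] t by auto
    ultimately show ?thesis by simp
  qed
  finally show ?thesis using D_greaterThan[OF t] by simp
qed

text \<open>The density of the uniform part: the mass \<open>mom 1 t / \<mu>\<close> of the tail of \<open>D\<close>, spread over an interval of
  length \<open>\<phi> t\<close>.\<close>

definition kappa :: "real \<Rightarrow> real" where
  "kappa t = mom 1 t / (\<mu> * \<phi> t)"

lemma kappa_nonneg: "0 < t \<Longrightarrow> 0 \<le> kappa t"
  unfolding kappa_def using mom_pos[of t 1] mean_pos phi_pos[of t] by simp

definition switched_density :: "real \<Rightarrow> real \<Rightarrow> real" where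
  "switched_density t x = dens x * indicator {0..1 - \<phi> t} x + kappa t * indicator {1 - \<phi> t..1} x"

lemma switched_density_measurable [measurable]: "switched_density t \<in> borel_measurable borel"
  unfolding switched_density_def[abs_def] by measurable

text \<open>\<open>ennreal\<close> is additive only where \<open>dens\<close> is nonnegative, which may fail at the end points.\<close>

lemma AE_switched_density:
  assumes t: "0 < t"
  shows "AE x in lborel. ennreal (dens x) * indicator {..1 - \<phi> t} x + ennreal (kappa t) * indicator {1 - \<phi> t..1} x
    = ennreal (switched_density t x)"
  using AE_limit_density_nonneg
proof eventually_elim
  case (elim x)
  have "dens x = 0" if "x < 0" using that by (simp add: limit_density_def)
  then show ?case
    using elim kappa_nonneg[OF t] by (auto simp: switched_density_def indicator_def ennreal_plus[symmetric] not_le simp del: ennreal_plus)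
qed

lemma AE_switched_density_nonneg:
  assumes t: "0 < t" shows "AE x in lborel. 0 \<le> switched_density t x"
  using AE_limit_density_nonneg by eventually_elim (use kappa_nonneg[OF t] in \<open>auto simp: switched_density_def\<close>)

lemma integrable_switched_density: "integrable lborel (switched_density t)"
proof -
  have "integrable lborel (\<lambda>x. dens x * indicator {0..1 - \<phi> t} x)"
    by (rule integrable_real_mult_indicator) (auto simp: integral_dens)
  moreover have "integrable lborel (\<lambda>x. kappa t * indicator {1 - \<phi> t..1} x)"
    by (intro integrable_mult_right) (simp add: integrable_indicator_iff emeasure_lborel_Icc_eq)
  ultimately show ?thesis unfolding switched_density_def[abs_def] by simp
qed

lemma measure_switched:
  assumes t: "0 < t"
  shows "measure (density lborel (\<lambda>x. ennreal (switched_density t x))) {..y}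
    = measure D {..min y (1 - \<phi> t)} + kappa t * measure lborel ({1 - \<phi> t..1} \<inter> {..y})"
proof -
  have "emeasure (density lborel (\<lambda>x. ennreal (switched_density t x))) {..y} =
      emeasure (density lborel (\<lambda>x. ennreal (dens x) * indicator {..1 - \<phi> t} x + ennreal (kappa t) * indicator {1 - \<phi> t..1} x)) {..y}"
    by (rule arg_cong[where f = "\<lambda>m. emeasure m {..y}"], rule density_cong)
       (use AE_switched_density[OF t] in \<open>auto elim: eventually_mono\<close>)
  also have "\<dots> = (\<integral>\<^sup>+x. ennreal (dens x) * indicator {..min y (1 - \<phi> t)} x
      + ennreal (kappa t) * indicator ({1 - \<phi> t..1} \<inter> {..y}) x \<partial>lborel)"
    by (subst emeasure_density) (auto intro!: nn_integral_cong split: split_indicator)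
  also have "\<dots> = emeasure D {..min y (1 - \<phi> t)} + ennreal (kappa t) * emeasure lborel ({1 - \<phi> t..1} \<inter> {..y})"
    by (subst nn_integral_add) (simp_all add: emeasure_density nn_integral_cmult_indicator)
  also have "\<dots> = ennreal (measure D {..min y (1 - \<phi> t)} + kappa t * measure lborel ({1 - \<phi> t..1} \<inter> {..y}))"
  proof -
    have "emeasure lborel ({1 - \<phi> t..1} \<inter> {..y}) \<le> emeasure lborel {1 - \<phi> t..1}"
      by (rule emeasure_mono) auto
    also have "\<dots> < \<infinity>" by (simp add: emeasure_lborel_Icc_eq)
    finally have "emeasure lborel ({1 - \<phi> t..1} \<inter> {..y}) = ennreal (measure lborel ({1 - \<phi> t..1} \<inter> {..y}))"
      by (intro emeasure_eq_ennreal_measure) auto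
    then show ?thesis using kappa_nonneg[OF t] by (simp add: D.emeasure_eq_measure ennreal_mult ennreal_plus)
  qed
  finally show ?thesis
    by (rule measure_eq_emeasure_eq_ennreal[rotated]) (use kappa_nonneg[OF t] in auto)
qed

lemma switched_cdf_early:
  assumes u: "0 < u" "u \<le> t"
  shows "measure (density lborel (\<lambda>x. ennreal (switched_density t x))) {..1 - \<phi> u} = 1 - mom 1 u / \<mu>"
proof -
  have le: "1 - \<phi> u \<le> 1 - \<phi> t"
    using phi_strict_antimono[of u t] u by (cases "u = t") auto
  have "{1 - \<phi> t..1} \<inter> {..1 - \<phi> u} \<subseteq> {1 - \<phi> t}" using le by auto
  then have "{1 - \<phi> t..1} \<inter> {..1 - \<phi> u} \<in> null_sets lborel"
    by (intro null_sets_subset[OF countable_imp_null_set_lborel[of "{1 - \<phi> t}"]]) auto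
  then have null: "measure lborel ({1 - \<phi> t..1} \<inter> {..1 - \<phi> u}) = 0" by (rule measure_eq_0_null_sets)
  have "0 < t" using u by simp
  then show ?thesis
    by (simp only: measure_switched null min_absorb1[OF le] D_atMost[OF u(1)] mult_zero_right add_0_right)
qed

lemma switched_cdf_late:
  assumes t: "0 < t" and c: "0 \<le> c" "c \<le> 1"
  shows "measure (density lborel (\<lambda>x. ennreal (switched_density t x))) {..1 - \<phi> t + c * \<phi> t}
    = 1 - mom 1 t / \<mu> + c * (mom 1 t / \<mu>)"
proof -
  have le: "0 \<le> c * \<phi> t" "c * \<phi> t \<le> \<phi> t"
    using c phi_pos[of t] t by (auto simp: mult_left_le_one_le)
  have "{1 - \<phi> t..1} \<inter> {..1 - \<phi> t + c * \<phi> t} = {1 - \<phi> t..1 - \<phi> t + c * \<phi> t}" using le by auto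
  then show ?thesis
    using t le D_atMost[OF t] phi_pos[of t] by (subst measure_switched) (auto simp: min_def kappa_def field_simps)
qed

lemma switched_cdf_nonpos:
  assumes t: "0 < t" and y: "y < 0"
  shows "measure (density lborel (\<lambda>x. ennreal (switched_density t x))) {..y} = 0"
proof -
  have "{1 - \<phi> t..1} \<inter> {..y} = {}" using phi_less_1[OF t] y by auto
  then show ?thesis using t y D_nonpos[of "min y (1 - \<phi> t)"] by (subst measure_switched) auto
qed

lemma switched_cdf_ge_1:
  assumes t: "0 < t" and y: "1 \<le> y"
  shows "measure (density lborel (\<lambda>x. ennreal (switched_density t x))) {..y} = 1"
proof -
  have "{1 - \<phi> t..1} \<inter> {..y} = {1 - \<phi> t..1}" using y by auto
  then show ?thesis
    using t y D_atMost[OF t] phi_pos[of t] mean_pos by (subst measure_switched) (auto simp: min_def kappa_def field_simps)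
qed

lemma tv_switched_eq:
  assumes t: "0 < t"
  shows "tv_dist (density lborel (\<lambda>x. ennreal (switched_density t x))) D
    = (LINT x:{1 - \<phi> t..1 - p0}|lborel. \<bar>dens x - kappa t\<bar>) + kappa t * p0"
proof -
  have "tv_dist (density lborel (\<lambda>x. ennreal (switched_density t x))) D
      = (LINT x|lborel. \<bar>switched_density t x - dens x\<bar>)"
    by (rule tv_dist_density) (use AE_switched_density_nonneg[OF t] AE_limit_density_nonneg integral_dens integrable_switched_density in auto)
  also have "\<dots> = (LINT x|lborel. indicator {1 - \<phi> t..1 - p0} x *\<^sub>R \<bar>dens x - kappa t\<bar> + kappa t * indicator {1 - p0<..1} x)"
  proof (rule integral_cong_AE)
    show "AE x in lborel. \<bar>switched_density t x - dens x\<bar> =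
        indicator {1 - \<phi> t..1 - p0} x *\<^sub>R \<bar>dens x - kappa t\<bar> + kappa t * indicator {1 - p0<..1} x"
      using AE_lborel_singleton[of "1 - \<phi> t"]
    proof eventually_elim
      case (elim x)
      have outside: "x < 0 \<or> 1 - p0 < x \<Longrightarrow> dens x = 0" by (auto simp: limit_density_def)
      have p0: "p0 < \<phi> t" "\<phi> t < 1" "0 \<le> p0"
        using phi_gt_mass_zero[of t] phi_less_1[OF t] t by auto
      note kappa = kappa_nonneg[OF t]
      consider "x < 0" | "0 \<le> x" "x < 1 - \<phi> t" | "1 - \<phi> t < x" "x \<le> 1 - p0"
        | "1 - p0 < x" "x \<le> 1" | "1 < x"
        using elim by linarith
      then show ?case
      proof cases
        case 1
        then have "dens x = 0" using outside by simp
        then show ?thesis using 1 p0 by (simp add: switched_density_def)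
      next
        case 2
        then show ?thesis using p0 by (simp add: switched_density_def)
      next
        case 3
        then have "x \<in> {1 - \<phi> t..1}" using p0 unfolding atLeastAtMost_iff by linarith
        then have one: "indicat_real {1 - \<phi> t..1} x = 1" by (rule indicator_simps(1))
        show ?thesis
          unfolding switched_density_def one using 3 p0 by (simp add: abs_minus_commute)
      next
        case 4
        then have "dens x = 0" using outside by simp
        then show ?thesis using 4 p0 kappa by (simp add: switched_density_def)
      next
        case 5
        then have "x \<notin> {1 - \<phi> t..1 - p0}" "dens x = 0"
          using outside p0 unfolding atLeastAtMost_iff by linarith+
        then show ?thesis using 5 by (simp add: switched_density_def)
      qed
    qed
  qed measurable
  also have "\<dots> = (LINT x:{1 - \<phi> t..1 - p0}|lborel. \<bar>dens x - kappa t\<bar>) + (LINT x|lborel. kappa t * indicator {1 - p0<..1} x)"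
    unfolding set_lebesgue_integral_def
  proof (rule Bochner_Integration.integral_add)
    have "integrable lborel (\<lambda>x. indicator {1 - \<phi> t..1 - p0} x *\<^sub>R \<bar>dens x\<bar> + kappa t * indicator {1 - \<phi> t..1 - p0} x)"
      by (intro Bochner_Integration.integrable_add integrable_mult_indicator integrable_abs integral_dens integrable_mult_right)
         (auto simp: integrable_indicator_iff emeasure_lborel_Icc_eq)
    then show "integrable lborel (\<lambda>x. indicator {1 - \<phi> t..1 - p0} x *\<^sub>R \<bar>dens x - kappa t\<bar>)"
      by (rule Bochner_Integration.integrable_bound) (use kappa_nonneg[OF t] in \<open>auto simp: indicator_def\<close>)
    show "integrable lborel (\<lambda>x. kappa t * indicator {1 - p0<..1} x)"
      by (intro integrable_mult_right) (simp add: integrable_indicator_iff emeasure_lborel_Icc_eq)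
  qed
  also have "(LINT x|lborel. kappa t * indicator {1 - p0<..1} x) = kappa t * p0"
    using measure_nonneg[of P "{0}"] by simp
  finally show ?thesis .
qed

text \<open>The triangle inequality: both \<open>dens\<close> and the constant \<open>kappa t\<close> have mass \<open>mom 1 t / \<mu>\<close> on the
  interval from \<open>1 - \<phi> t\<close> to \<open>1\<close>.\<close>

lemma tv_switched_le:
  assumes t: "0 < t"
  shows "(LINT x:{1 - \<phi> t..1 - p0}|lborel. \<bar>dens x - kappa t\<bar>) + kappa t * p0 \<le> 2 * (mom 1 t / \<mu>)"
proof -
  have pt: "p0 < \<phi> t" using phi_gt_mass_zero[of t] t by simp
  have int: "integrable lborel (\<lambda>x. indicator {1 - \<phi> t..1 - p0} x *\<^sub>R dens x)"
    "integrable lborel (\<lambda>x. kappa t * indicator {1 - \<phi> t..1 - p0} x)"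
    by (intro integrable_mult_indicator integral_dens integrable_mult_right; simp add: integrable_indicator_iff emeasure_lborel_Icc_eq)+
  have "(LINT x:{1 - \<phi> t..1 - p0}|lborel. \<bar>dens x - kappa t\<bar>)
      \<le> (LINT x|lborel. indicator {1 - \<phi> t..1 - p0} x *\<^sub>R dens x + kappa t * indicator {1 - \<phi> t..1 - p0} x)"
    unfolding set_lebesgue_integral_def
  proof (rule integral_mono_AE')
    show "integrable lborel (\<lambda>x. indicator {1 - \<phi> t..1 - p0} x *\<^sub>R dens x + kappa t * indicator {1 - \<phi> t..1 - p0} x)"
      using int by (rule Bochner_Integration.integrable_add)
    show "AE x in lborel. indicator {1 - \<phi> t..1 - p0} x *\<^sub>R \<bar>dens x - kappa t\<bar>
        \<le> indicator {1 - \<phi> t..1 - p0} x *\<^sub>R dens x + kappa t * indicator {1 - \<phi> t..1 - p0} x"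
      using AE_limit_density_nonneg by eventually_elim (use kappa_nonneg[OF t] in \<open>auto simp: indicator_def\<close>)
    show "AE x in lborel. 0 \<le> indicator {1 - \<phi> t..1 - p0} x *\<^sub>R dens x + kappa t * indicator {1 - \<phi> t..1 - p0} x"
      using AE_limit_density_nonneg by eventually_elim (use kappa_nonneg[OF t] in auto)
  qed
  also have "\<dots> = mom 1 t / \<mu> + kappa t * (\<phi> t - p0)"
    using dens_tail_integral[OF t] pt
    by (subst Bochner_Integration.integral_add[OF int]) (simp add: set_lebesgue_integral_def)
  finally have "(LINT x:{1 - \<phi> t..1 - p0}|lborel. \<bar>dens x - kappa t\<bar>) + kappa t * p0
      \<le> mom 1 t / \<mu> + kappa t * \<phi> t"
    by (simp add: algebra_simps)
  also have "kappa t * \<phi> t = mom 1 t / \<mu>"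
    using phi_pos[of t] t by (simp add: kappa_def)
  finally show ?thesis by simp
qed

end

section \<open>Convergence in probability to a constant\<close>

definition tends_in_prob :: "(nat \<Rightarrow> 'a measure) \<Rightarrow> (nat \<Rightarrow> 'a \<Rightarrow> real) \<Rightarrow> real \<Rightarrow> bool" where
  "tends_in_prob M X c \<longleftrightarrow>
     (\<forall>n. X n \<in> borel_measurable (M n)) \<and>
     (\<forall>\<epsilon>>0. (\<lambda>n. \<P>(\<omega> in M n. \<epsilon> \<le> \<bar>X n \<omega> - c\<bar>)) \<longlonglongrightarrow> 0)"

lemma tends_in_probD:
  assumes "tends_in_prob M X c"
  shows "X n \<in> borel_measurable (M n)"
    and "0 < \<epsilon> \<Longrightarrow> (\<lambda>n. \<P>(\<omega> in M n. \<epsilon> \<le> \<bar>X n \<omega> - c\<bar>)) \<longlonglongrightarrow> 0"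
  using assms by (auto simp: tends_in_prob_def)

lemma tends_in_prob_deterministic:
  assumes "x \<longlonglongrightarrow> c"
  shows "tends_in_prob M (\<lambda>n _. x n) c"
  unfolding tends_in_prob_def
proof (intro conjI allI impI)
  fix \<epsilon> :: real assume "0 < \<epsilon>"
  from tendstoD[OF assms this] have "\<forall>\<^sub>F n in sequentially. \<bar>x n - c\<bar> < \<epsilon>"
    by (simp add: dist_real_def)
  then have "\<forall>\<^sub>F n in sequentially. \<P>(\<omega> in M n. \<epsilon> \<le> \<bar>x n - c\<bar>) = 0"
    by eventually_elim (simp add: not_le[symmetric])
  then show "(\<lambda>n. \<P>(\<omega> in M n. \<epsilon> \<le> \<bar>x n - c\<bar>)) \<longlonglongrightarrow> 0"
    by (rule tendsto_eventually)
qed simp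

text \<open>A continuous mapping theorem. The random variables \<open>W n\<close> need not be functions of \<open>X n\<close> and
  \<open>Y n\<close>: they only have to be close to \<open>c\<close>, uniformly, where \<open>X n\<close> and \<open>Y n\<close> are close to
  their limits.\<close>

lemma tends_in_prob_transfer:
  assumes prob: "\<And>n. prob_space (M n)"
    and X: "tends_in_prob M X a" and Y: "tends_in_prob M Y b"
    and W: "\<And>n. W n \<in> borel_measurable (M n)"
    and close: "\<And>\<epsilon>. 0 < \<epsilon> \<Longrightarrow> \<exists>\<delta>>0. \<forall>n\<ge>1. \<forall>\<omega>\<in>space (M n).
       \<bar>X n \<omega> - a\<bar> < \<delta> \<longrightarrow> \<bar>Y n \<omega> - b\<bar> < \<delta> \<longrightarrow> \<bar>W n \<omega> - c\<bar> < \<epsilon>"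
  shows "tends_in_prob M W c"
  unfolding tends_in_prob_def
proof (intro conjI allI impI W)
  fix \<epsilon> :: real assume "0 < \<epsilon>"
  from close[OF this] obtain \<delta> where \<delta>: "0 < \<delta>" "\<And>n \<omega>. 1 \<le> n \<Longrightarrow> \<omega> \<in> space (M n) \<Longrightarrow>
       \<bar>X n \<omega> - a\<bar> < \<delta> \<Longrightarrow> \<bar>Y n \<omega> - b\<bar> < \<delta> \<Longrightarrow> \<bar>W n \<omega> - c\<bar> < \<epsilon>" by blast
  note [measurable] = W tends_in_probD(1)[OF X] tends_in_probD(1)[OF Y]
  let ?b = "\<lambda>n. \<P>(\<omega> in M n. \<delta> \<le> \<bar>X n \<omega> - a\<bar>)
              + \<P>(\<omega> in M n. \<delta> \<le> \<bar>Y n \<omega> - b\<bar>)"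
  have le: "\<P>(\<omega> in M n. \<epsilon> \<le> \<bar>W n \<omega> - c\<bar>) \<le> ?b n" if "1 \<le> n" for n
  proof -
    interpret prob_space "M n" by (rule prob)
    have "\<P>(\<omega> in M n. \<epsilon> \<le> \<bar>W n \<omega> - c\<bar>) \<le>
        measure (M n) ({\<omega>\<in>space (M n). \<delta> \<le> \<bar>X n \<omega> - a\<bar>} \<union> {\<omega>\<in>space (M n). \<delta> \<le> \<bar>Y n \<omega> - b\<bar>})"
    proof (rule finite_measure_mono)
      show "{\<omega>\<in>space (M n). \<epsilon> \<le> \<bar>W n \<omega> - c\<bar>} \<subseteq>
          {\<omega>\<in>space (M n). \<delta> \<le> \<bar>X n \<omega> - a\<bar>} \<union> {\<omega>\<in>space (M n). \<delta> \<le> \<bar>Y n \<omega> - b\<bar>}"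
        using \<delta>(2)[OF that] by (auto simp: not_le[symmetric])
    qed measurable
    also have "\<dots> \<le> ?b n" by (rule measure_Un_le) measurable
    finally show ?thesis .
  qed
  have "?b \<longlonglongrightarrow> 0 + 0"
    by (intro tendsto_add tends_in_probD(2)[OF X \<delta>(1)] tends_in_probD(2)[OF Y \<delta>(1)])
  then have "?b \<longlonglongrightarrow> 0" by simp
  then show "(\<lambda>n. \<P>(\<omega> in M n. \<epsilon> \<le> \<bar>W n \<omega> - c\<bar>)) \<longlonglongrightarrow> 0"
  proof (rule Lim_null_comparison[rotated])
    show "\<forall>\<^sub>F n in sequentially.
        norm (\<P>(\<omega> in M n. \<epsilon> \<le> \<bar>W n \<omega> - c\<bar>)) \<le> ?b n"
      using eventually_ge_at_top[of 1] by eventually_elim (simp add: le)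
  qed
qed

lemma tends_in_prob_expectation:
  assumes prob: "\<And>n. prob_space (M n)" and X: "tends_in_prob M X c"
    and B: "\<And>n \<omega>. \<omega> \<in> space (M n) \<Longrightarrow> \<bar>X n \<omega>\<bar> \<le> B"
  shows "(\<lambda>n. LINT \<omega>|M n. X n \<omega>) \<longlonglongrightarrow> c"
proof -
  note [measurable] = tends_in_probD(1)[OF X]
  have le: "\<bar>(LINT \<omega>|M n. X n \<omega>) - c\<bar> \<le> e + (\<bar>B\<bar> + \<bar>c\<bar>) * \<P>(\<omega> in M n. e \<le> \<bar>X n \<omega> - c\<bar>)"
    if e: "0 < e" for e n
  proof -
    interpret prob_space "M n" by (rule prob)
    have [simp]: "integrable (M n) (indicat_real {\<omega>\<in>space (M n). e \<le> \<bar>X n \<omega> - c\<bar>})"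
      by (rule integrable_const_bound[where B = 1]) auto
    have int: "integrable (M n) (X n)"
      by (rule integrable_const_bound[where B = B]) (use B in auto)
    have "\<bar>(LINT \<omega>|M n. X n \<omega>) - c\<bar> = \<bar>LINT \<omega>|M n. X n \<omega> - c\<bar>"
      using int prob_space by simp
    also have "\<dots> \<le> (LINT \<omega>|M n. \<bar>X n \<omega> - c\<bar>)"
      by (rule integral_abs_bound)
    also have "\<dots> \<le> (LINT \<omega>|M n. e + (\<bar>B\<bar> + \<bar>c\<bar>) * indicator {\<omega>\<in>space (M n). e \<le> \<bar>X n \<omega> - c\<bar>} \<omega>)"
    proof (rule integral_mono)
      fix \<omega> assume \<omega>: "\<omega> \<in> space (M n)"
      have "\<bar>X n \<omega> - c\<bar> \<le> \<bar>B\<bar> + \<bar>c\<bar>" using B[OF \<omega>] by linarith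
      then show "\<bar>X n \<omega> - c\<bar> \<le> e + (\<bar>B\<bar> + \<bar>c\<bar>) * indicator {\<omega>\<in>space (M n). e \<le> \<bar>X n \<omega> - c\<bar>} \<omega>"
        using e \<omega> by (auto simp: indicator_def)
    qed (use int in auto)
    also have "\<dots> = e + (\<bar>B\<bar> + \<bar>c\<bar>) * \<P>(\<omega> in M n. e \<le> \<bar>X n \<omega> - c\<bar>)"
      using prob_space by (subst Bochner_Integration.integral_add) auto
    finally show ?thesis .
  qed
  show ?thesis
  proof (rule LIMSEQ_I)
    fix r :: real assume r: "0 < r"
    have "(\<lambda>n. (\<bar>B\<bar> + \<bar>c\<bar>) * \<P>(\<omega> in M n. r / 2 \<le> \<bar>X n \<omega> - c\<bar>)) \<longlonglongrightarrow> (\<bar>B\<bar> + \<bar>c\<bar>) * 0"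
      using r by (intro tendsto_mult_left tends_in_probD(2)[OF X]) auto
    then have "(\<lambda>n. (\<bar>B\<bar> + \<bar>c\<bar>) * \<P>(\<omega> in M n. r / 2 \<le> \<bar>X n \<omega> - c\<bar>)) \<longlonglongrightarrow> 0"
      by simp
    from order_tendstoD(2)[OF this, of "r / 2"] r
    have "\<forall>\<^sub>F n in sequentially. (\<bar>B\<bar> + \<bar>c\<bar>) * \<P>(\<omega> in M n. r / 2 \<le> \<bar>X n \<omega> - c\<bar>) < r / 2"
      by simp
    then have "\<forall>\<^sub>F n in sequentially. norm ((LINT \<omega>|M n. X n \<omega>) - c) < r"
    proof eventually_elim
      case (elim n)
      then show ?case using le[of "r / 2" n] r by simp
    qed
    then show "\<exists>no. \<forall>n\<ge>no. norm ((LINT \<omega>|M n. X n \<omega>) - c) < r"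
      by (simp add: eventually_sequentially)
  qed
qed

text \<open>Markov's inequality.\<close>

lemma tends_in_probI_expectation:
  fixes D :: "nat \<Rightarrow> 'a \<Rightarrow> real"
  assumes prob: "\<And>n. prob_space (M n)" and X: "\<And>n. X n \<in> borel_measurable (M n)"
    and D: "\<And>n. integrable (M n) (D n)" "\<And>n \<omega>. \<omega> \<in> space (M n) \<Longrightarrow> 0 \<le> D n \<omega>"
      "(\<lambda>n. LINT \<omega>|M n. D n \<omega>) \<longlonglongrightarrow> 0"
    and lower: "\<And>\<epsilon>. 0 < \<epsilon> \<Longrightarrow> \<exists>\<delta>>0. \<forall>n\<ge>1. \<forall>\<omega>\<in>space (M n). \<epsilon> \<le> \<bar>X n \<omega> - c\<bar> \<longrightarrow> \<delta> \<le> D n \<omega>"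
  shows "tends_in_prob M X c"
  unfolding tends_in_prob_def
proof (intro conjI allI impI X)
  fix \<epsilon> :: real assume "0 < \<epsilon>"
  from lower[OF this] obtain \<delta> where \<delta>: "0 < \<delta>"
    "\<And>n \<omega>. 1 \<le> n \<Longrightarrow> \<omega> \<in> space (M n) \<Longrightarrow> \<epsilon> \<le> \<bar>X n \<omega> - c\<bar> \<Longrightarrow> \<delta> \<le> D n \<omega>" by blast
  note [measurable] = X borel_measurable_integrable[OF D(1)]
  have le: "\<P>(\<omega> in M n. \<epsilon> \<le> \<bar>X n \<omega> - c\<bar>) \<le> (LINT \<omega>|M n. D n \<omega>) / \<delta>" if "1 \<le> n" for n
  proof -
    interpret prob_space "M n" by (rule prob)
    have "\<P>(\<omega> in M n. \<epsilon> \<le> \<bar>X n \<omega> - c\<bar>) \<le> \<P>(\<omega> in M n. \<delta> \<le> D n \<omega>)"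
      by (rule finite_measure_mono) (use \<delta>(2)[OF that] in auto)
    also have "\<dots> \<le> (LINT \<omega>|M n. D n \<omega>) / \<delta>"
      by (rule integral_Markov_inequality_measure[where A = "{}"]) (use D \<delta> in auto)
    finally show ?thesis .
  qed
  have "(\<lambda>n. (LINT \<omega>|M n. D n \<omega>) / \<delta>) \<longlonglongrightarrow> 0"
    using tendsto_divide[OF D(3) tendsto_const[of \<delta>]] \<delta>(1) by simp
  then show "(\<lambda>n. \<P>(\<omega> in M n. \<epsilon> \<le> \<bar>X n \<omega> - c\<bar>)) \<longlonglongrightarrow> 0"
  proof (rule Lim_null_comparison[rotated])
    show "\<forall>\<^sub>F n in sequentially.
        norm (\<P>(\<omega> in M n. \<epsilon> \<le> \<bar>X n \<omega> - c\<bar>)) \<le> (LINT \<omega>|M n. D n \<omega>) / \<delta>"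
      using eventually_ge_at_top[of 1] by eventually_elim (simp add: le)
  qed
qed

lemma weak_conv_return_imp_tends_in_prob:
  assumes prob: "\<And>n. prob_space (M n)" and X: "\<And>n. X n \<in> borel_measurable (M n)"
    and conv: "weak_conv_m (\<lambda>n. distr (M n) borel (X n)) (return borel c)"
  shows "tends_in_prob M X c"
  unfolding tends_in_prob_def
proof (intro conjI allI impI X)
  note [measurable] = X
  have cdf_eq: "cdf (distr (M n) borel (X n)) x = \<P>(\<omega> in M n. X n \<omega> \<le> x)" for n x
    by (simp add: cdf_def measure_distr vimage_def Int_def conj_commute)
  have cdf_ret: "cdf (return borel c) x = (if c \<le> x then 1 else 0)" for x
    by (simp add: cdf_def measure_def)
  have lim: "(\<lambda>n. \<P>(\<omega> in M n. X n \<omega> \<le> x)) \<longlonglongrightarrow> (if c \<le> x then 1 else 0)" if "x \<noteq> c" for x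
  proof -
    have "isCont (cdf (return borel c)) x"
      unfolding isCont_def
    proof (rule tendsto_eventually)
      show "\<forall>\<^sub>F y in at x. cdf (return borel c) y = cdf (return borel c) x"
      proof (cases "c < x")
        case True
        have "\<forall>\<^sub>F y in at x. c < y"
          using True by (intro order_tendstoD(1)[OF tendsto_ident_at])
        then show ?thesis by eventually_elim (use True cdf_ret in auto)
      next
        case False
        have "\<forall>\<^sub>F y in at x. y < c"
          using False that by (intro order_tendstoD(2)[OF tendsto_ident_at]) auto
        then show ?thesis by eventually_elim (use False that cdf_ret in auto)
      qed
    qed
    then have "(\<lambda>n. cdf (distr (M n) borel (X n)) x) \<longlonglongrightarrow> cdf (return borel c) x"
      using conv unfolding weak_conv_m_def weak_conv_def by blast
    then show ?thesis by (simp only: cdf_eq cdf_ret)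
  qed
  fix \<epsilon> :: real assume \<epsilon>: "0 < \<epsilon>"
  let ?b = "\<lambda>n. \<P>(\<omega> in M n. X n \<omega> \<le> c - \<epsilon>) + (1 - \<P>(\<omega> in M n. X n \<omega> \<le> c + \<epsilon> / 2))"
  have le: "\<P>(\<omega> in M n. \<epsilon> \<le> \<bar>X n \<omega> - c\<bar>) \<le> ?b n" for n
  proof -
    interpret prob_space "M n" by (rule prob)
    have "\<P>(\<omega> in M n. \<epsilon> \<le> \<bar>X n \<omega> - c\<bar>) \<le>
        measure (M n) ({\<omega>\<in>space (M n). X n \<omega> \<le> c - \<epsilon>} \<union> {\<omega>\<in>space (M n). \<not> X n \<omega> \<le> c + \<epsilon> / 2})"
      by (rule finite_measure_mono) (use \<epsilon> in \<open>auto simp: abs_if split: if_splits\<close>)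
    also have "\<dots> \<le> \<P>(\<omega> in M n. X n \<omega> \<le> c - \<epsilon>) + \<P>(\<omega> in M n. \<not> X n \<omega> \<le> c + \<epsilon> / 2)"
      by (rule measure_Un_le) measurable
    also have "\<P>(\<omega> in M n. \<not> X n \<omega> \<le> c + \<epsilon> / 2) = 1 - \<P>(\<omega> in M n. X n \<omega> \<le> c + \<epsilon> / 2)"
      by (rule prob_neg) measurable
    finally show ?thesis .
  qed
  have "?b \<longlonglongrightarrow> 0 + (1 - 1)"
    using lim[of "c - \<epsilon>"] lim[of "c + \<epsilon> / 2"] \<epsilon> by (intro tendsto_intros) auto
  then have "?b \<longlonglongrightarrow> 0" by simp
  then show "(\<lambda>n. \<P>(\<omega> in M n. \<epsilon> \<le> \<bar>X n \<omega> - c\<bar>)) \<longlonglongrightarrow> 0"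
    by (rule Lim_null_comparison[rotated]) (simp add: le)
qed

text \<open>A way to prove convergence in law when the distribution functions of \<open>X n\<close> are only accessible
  at random points \<open>Y n\<close> that are asymptotically deterministic: monotonicity gives the value at the
  fixed points in between.\<close>

lemma weak_convI_random_points:
  assumes prob: "\<And>n. prob_space (M n)" and X: "\<And>n. X n \<in> borel_measurable (M n)"
    and dense: "\<And>a b. a < b \<Longrightarrow> \<exists>y\<in>E. a < y \<and> y < b"
    and points: "\<And>y. y \<in> E \<Longrightarrow> \<exists>Y. tends_in_prob M Y y \<and>
       (\<lambda>n. \<P>(\<omega> in M n. X n \<omega> \<le> Y n \<omega>)) \<longlonglongrightarrow> cdf N y"
  shows "weak_conv_m (\<lambda>n. distr (M n) borel (X n)) N"
  unfolding weak_conv_m_def weak_conv_def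
proof (intro allI impI)
  fix x assume cont: "isCont (cdf N) x"
  note [measurable] = X
  let ?F = "\<lambda>n. \<P>(\<omega> in M n. X n \<omega> \<le> x)"
  have cdf_eq: "cdf (distr (M n) borel (X n)) x = ?F n" for n
    by (simp add: cdf_def measure_distr vimage_def Int_def conj_commute)
  have "?F \<longlonglongrightarrow> cdf N x"
  proof (rule order_tendstoI)
    fix a assume "a < cdf N x"
    then have "\<forall>\<^sub>F y in at x. a < cdf N y"
      using cont by (auto simp: isCont_def intro: order_tendstoD(1))
    then obtain d where d: "0 < d" "\<And>y. y \<noteq> x \<Longrightarrow> \<bar>y - x\<bar> < d \<Longrightarrow> a < cdf N y"
      by (auto simp: eventually_at dist_real_def)
    obtain y where y: "y \<in> E" "x - d < y" "y < x" using dense[of "x - d" x] d by auto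
    then have ay: "a < cdf N y" using d(2)[of y] by auto
    obtain Y where Y: "tends_in_prob M Y y"
      "(\<lambda>n. \<P>(\<omega> in M n. X n \<omega> \<le> Y n \<omega>)) \<longlonglongrightarrow> cdf N y"
      using points[OF y(1)] by blast
    note [measurable] = tends_in_probD(1)[OF Y(1)]
    let ?e = "\<lambda>n. \<P>(\<omega> in M n. x - y \<le> \<bar>Y n \<omega> - y\<bar>)"
    have le: "\<P>(\<omega> in M n. X n \<omega> \<le> Y n \<omega>) - ?e n \<le> ?F n" for n
    proof -
      interpret prob_space "M n" by (rule prob)
      have "\<P>(\<omega> in M n. X n \<omega> \<le> Y n \<omega>) \<le>
          measure (M n) ({\<omega>\<in>space (M n). X n \<omega> \<le> x} \<union> {\<omega>\<in>space (M n). x - y \<le> \<bar>Y n \<omega> - y\<bar>})"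
        by (rule finite_measure_mono) auto
      also have "\<dots> \<le> ?F n + ?e n" by (rule measure_Un_le) measurable
      finally show ?thesis by simp
    qed
    have "(\<lambda>n. \<P>(\<omega> in M n. X n \<omega> \<le> Y n \<omega>) - ?e n) \<longlonglongrightarrow> cdf N y - 0"
      using y by (intro tendsto_diff Y(2) tends_in_probD(2)[OF Y(1)]) auto
    then have "\<forall>\<^sub>F n in sequentially. a < \<P>(\<omega> in M n. X n \<omega> \<le> Y n \<omega>) - ?e n"
      using ay by (intro order_tendstoD(1)) auto
    then show "\<forall>\<^sub>F n in sequentially. a < ?F n"
      by eventually_elim (use le in \<open>auto intro: less_le_trans\<close>)
  next
    fix a assume "cdf N x < a"
    then have "\<forall>\<^sub>F y in at x. cdf N y < a"
      using cont by (auto simp: isCont_def intro: order_tendstoD(2))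
    then obtain d where d: "0 < d" "\<And>y. y \<noteq> x \<Longrightarrow> \<bar>y - x\<bar> < d \<Longrightarrow> cdf N y < a"
      by (auto simp: eventually_at dist_real_def)
    obtain y where y: "y \<in> E" "x < y" "y < x + d" using dense[of x "x + d"] d by auto
    then have ay: "cdf N y < a" using d(2)[of y] by auto
    obtain Y where Y: "tends_in_prob M Y y"
      "(\<lambda>n. \<P>(\<omega> in M n. X n \<omega> \<le> Y n \<omega>)) \<longlonglongrightarrow> cdf N y"
      using points[OF y(1)] by blast
    note [measurable] = tends_in_probD(1)[OF Y(1)]
    let ?e = "\<lambda>n. \<P>(\<omega> in M n. y - x \<le> \<bar>Y n \<omega> - y\<bar>)"
    have le: "?F n \<le> \<P>(\<omega> in M n. X n \<omega> \<le> Y n \<omega>) + ?e n" for n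
    proof -
      interpret prob_space "M n" by (rule prob)
      have "?F n \<le> measure (M n) ({\<omega>\<in>space (M n). X n \<omega> \<le> Y n \<omega>} \<union> {\<omega>\<in>space (M n). y - x \<le> \<bar>Y n \<omega> - y\<bar>})"
        by (rule finite_measure_mono) auto
      also have "\<dots> \<le> \<P>(\<omega> in M n. X n \<omega> \<le> Y n \<omega>) + ?e n"
        by (rule measure_Un_le) measurable
      finally show ?thesis .
    qed
    have "(\<lambda>n. \<P>(\<omega> in M n. X n \<omega> \<le> Y n \<omega>) + ?e n) \<longlonglongrightarrow> cdf N y + 0"
      using y by (intro tendsto_add Y(2) tends_in_probD(2)[OF Y(1)]) auto
    then have "\<forall>\<^sub>F n in sequentially. \<P>(\<omega> in M n. X n \<omega> \<le> Y n \<omega>) + ?e n < a"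
      using ay by (intro order_tendstoD(2)) auto
    then show "\<forall>\<^sub>F n in sequentially. ?F n < a"
      by eventually_elim (use le in \<open>auto intro: le_less_trans\<close>)
  qed
  then show "(\<lambda>n. cdf (distr (M n) borel (X n)) x) \<longlonglongrightarrow> cdf N x"
    by (simp add: cdf_eq)
qed

section \<open>Popularities\<close>

locale random_weights = prob_space M for M :: "'a measure" +
  fixes n :: nat and w :: "'a \<Rightarrow> nat \<Rightarrow> real"
  assumes w_measurable: "i \<in> {1..n} \<Longrightarrow> (\<lambda>\<omega>. w \<omega> i) \<in> borel_measurable M"
    and w_nonneg: "i \<in> {1..n} \<Longrightarrow> \<omega> \<in> space M \<Longrightarrow> 0 \<le> w \<omega> i"
begin

abbreviation "pop \<omega> i \<equiv> popularity n (w \<omega>) i"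

lemma sum_w_nonneg: "\<omega> \<in> space M \<Longrightarrow> 0 \<le> (\<Sum>i=1..n. w \<omega> i)"
  by (intro sum_nonneg w_nonneg)

lemma pop_nonneg: "i \<in> {1..n} \<Longrightarrow> \<omega> \<in> space M \<Longrightarrow> 0 \<le> pop \<omega> i"
  unfolding popularity_def by (intro divide_nonneg_nonneg w_nonneg sum_w_nonneg)

lemma pop_measurable: "i \<in> {1..n} \<Longrightarrow> (\<lambda>\<omega>. pop \<omega> i) \<in> borel_measurable M"
  unfolding popularity_def using w_measurable
  by (intro borel_measurable_divide borel_measurable_sum) auto

lemma sum_pop: "\<omega> \<in> space M \<Longrightarrow> (\<Sum>i=1..n. pop \<omega> i) = of_bool ((\<Sum>i=1..n. w \<omega> i) \<noteq> 0)"
  by (simp add: popularity_def sum_divide_distrib[symmetric])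

lemma sum_pop_le_1: "\<omega> \<in> space M \<Longrightarrow> (\<Sum>i=1..n. pop \<omega> i) \<le> 1"
  by (simp only: sum_pop) simp

lemma pop_le_1: "i \<in> {1..n} \<Longrightarrow> \<omega> \<in> space M \<Longrightarrow> pop \<omega> i \<le> 1"
  using member_le_sum[of i "{1..n}" "pop \<omega>"] sum_pop_le_1[of \<omega>] pop_nonneg by fastforce

end

section \<open>Consequences of the law of large numbers condition\<close>

lemma topspace_weak_topology_Rplus: "topspace weak_topology_Rplus = prob_measures_Rplus"
proof -
  have "prob_measures_Rplus \<subseteq> topspace weak_topology_Rplus"
    unfolding weak_topology_Rplus_def topology_generated_by_topspace
    by (rule Union_upper, rule CollectI, rule exI[of _ "\<lambda>_. 0"], rule exI[of _ UNIV])
       (auto simp: bounded_def)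
  moreover have "topspace weak_topology_Rplus \<subseteq> prob_measures_Rplus"
    unfolding weak_topology_Rplus_def topology_generated_by_topspace by auto
  ultimately show ?thesis by blast
qed

text \<open>These integrals are the maps that generate the topology.\<close>

lemma continuous_map_weak_topology_integral:
  assumes "continuous_on {0..} g" "bounded (g ` {0..})"
  shows "continuous_map weak_topology_Rplus euclidean (\<lambda>m. LINT x:{0..}|m. g x :: real)"
  unfolding continuous_map
proof (intro conjI allI impI)
  fix V :: "real set" assume "openin euclidean V"
  then have "open V" by simp
  then show "openin weak_topology_Rplus {m \<in> topspace weak_topology_Rplus. (LINT x:{0..}|m. g x) \<in> V}"
    unfolding topspace_weak_topology_Rplus unfolding weak_topology_Rplus_def
    by (intro topology_generated_by_Basis) (use assms in auto)
qed simp

lemma integral_empirical_measure: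
  assumes n: "1 \<le> n" and v: "\<And>i. i \<in> {1..n} \<Longrightarrow> 0 \<le> v i" and g: "continuous_on {0..} g"
  shows "(LINT x:{0..}|empirical_measure n v. g x) = (\<Sum>i=1..n. g (v i)) / real n"
proof -
  have meas: "(\<lambda>x. indicator {0..} x *\<^sub>R g x) \<in> borel_measurable borel"
    by (rule borel_measurable_continuous_on_indicator[OF _ g]) auto
  have "(LINT x:{0..}|empirical_measure n v. g x)
      = (LINT i|uniform_count_measure {1..n}. indicator {0..} (v i) *\<^sub>R g (v i))"
    unfolding set_lebesgue_integral_def empirical_measure_def
    by (rule integral_distr) (use meas in \<open>auto simp: uniform_count_measure_def\<close>)
  also have "\<dots> = (\<Sum>i=1..n. g (v i)) / real n"
    unfolding uniform_count_measure_def using n v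
    by (subst lebesgue_integral_point_measure_finite)
       (auto simp: sum_divide_distrib intro!: sum.cong)
  finally show ?thesis .
qed

locale lln_array = halfline_law +
  fixes M :: "nat \<Rightarrow> 'a measure" and w :: "nat \<Rightarrow> 'a \<Rightarrow> nat \<Rightarrow> real" and Z :: "nat \<Rightarrow> 'a \<Rightarrow> real"
  assumes prob_space_M: "\<And>n. prob_space (M n)"
    and w_measurable: "\<And>n i. i \<in> {1..n} \<Longrightarrow> (\<lambda>\<omega>. w n \<omega> i) \<in> borel_measurable (M n)"
    and w_nonneg: "\<And>n i \<omega>. i \<in> {1..n} \<Longrightarrow> \<omega> \<in> space (M n) \<Longrightarrow> 0 \<le> w n \<omega> i"
    and Z_measurable [measurable]: "\<And>n. Z n \<in> borel_measurable (M n)"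
    and Z_pos: "\<And>n \<omega>. \<omega> \<in> space (M n) \<Longrightarrow> 0 < Z n \<omega>"
    and empirical_conv: "converges_in_law_to_point M
      (\<lambda>n \<omega>. empirical_measure n (\<lambda>i. Z n \<omega> * w n \<omega> i)) weak_topology_Rplus P"
    and mean_conv: "weak_conv_m (\<lambda>n. distr (M n) borel (\<lambda>\<omega>. (\<Sum>i=1..n. Z n \<omega> * w n \<omega> i) / real n))
      (return borel \<mu>)"
begin

abbreviation "v n \<omega> i \<equiv> Z n \<omega> * w n \<omega> i"
abbreviation "avg n \<omega> \<equiv> (\<Sum>i=1..n. v n \<omega> i) / real n"

lemma v_measurable: "i \<in> {1..n} \<Longrightarrow> (\<lambda>\<omega>. v n \<omega> i) \<in> borel_measurable (M n)"
  using w_measurable by (intro borel_measurable_times) auto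

lemma v_nonneg: "i \<in> {1..n} \<Longrightarrow> \<omega> \<in> space (M n) \<Longrightarrow> 0 \<le> v n \<omega> i"
  using w_nonneg Z_pos by (simp add: less_imp_le)

lemma avg_tends: "tends_in_prob M avg \<mu>"
proof (rule weak_conv_return_imp_tends_in_prob[OF prob_space_M _ mean_conv])
  show "avg n \<in> borel_measurable (M n)" for n
    using v_measurable by (intro borel_measurable_divide borel_measurable_sum) auto
qed

text \<open>The truncated distance of the integral of \<open>g\<close> to its limit is a bounded continuous functional on the
  space of probability measures; hence its expectation tends to \<open>0\<close>, and Markov's inequality applies.\<close>

lemma empirical_integral_tends:
  assumes g: "continuous_on {0..} g" "bounded (g ` {0..})" "g \<in> borel_measurable borel"
  shows "tends_in_prob M (\<lambda>n \<omega>. (\<Sum>i=1..n. g (v n \<omega> i)) / real n) (LINT x|P. g x)"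
proof -
  define c where "c = (LINT x|P. g x)"
  let ?X = "\<lambda>n \<omega>. (\<Sum>i=1..n. g (v n \<omega> i)) / real n"
  let ?D = "\<lambda>n \<omega>. min 1 \<bar>?X n \<omega> - c\<bar>"
  define F where "F m = min 1 \<bar>(LINT x:{0..}|m. g x) - c\<bar>" for m :: "real measure"
  note [measurable] = g(3)
  have Xm [measurable]: "?X n \<in> borel_measurable (M n)" for n
    using v_measurable by (intro borel_measurable_divide borel_measurable_sum) auto
  have "continuous_map weak_topology_Rplus euclidean F"
    unfolding F_def
    by (intro continuous_map_real_min continuous_map_real_abs continuous_map_diff
        continuous_map_weak_topology_integral g) auto
  moreover have "bounded (F ` topspace weak_topology_Rplus)"
    by (rule boundedI[of _ 1]) (auto simp: F_def)
  ultimately have "(\<lambda>n. LINT \<omega>|M n. F (empirical_measure n (v n \<omega>))) \<longlonglongrightarrow> F P"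
    using empirical_conv unfolding converges_in_law_to_point_def by blast
  moreover have "F P = 0"
  proof -
    have "(LINT x:{0..}|P. g x) = c"
      unfolding c_def set_lebesgue_integral_def
    proof (rule integral_cong_AE)
      show "AE x in P. indicat_real {0..} x *\<^sub>R g x = g x"
        using AE_nonneg by eventually_elim simp
    qed auto
    then show ?thesis by (simp add: F_def)
  qed
  moreover have "\<forall>\<^sub>F n in sequentially. (LINT \<omega>|M n. F (empirical_measure n (v n \<omega>))) = (LINT \<omega>|M n. ?D n \<omega>)"
    using eventually_ge_at_top[of 1]
    by eventually_elim
      (rule Bochner_Integration.integral_cong[OF refl],
       unfold F_def, subst integral_empirical_measure, use v_nonneg g(1) in auto)
  ultimately have lim: "(\<lambda>n. LINT \<omega>|M n. ?D n \<omega>) \<longlonglongrightarrow> 0"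
    using Lim_transform_eventually by fastforce
  have "tends_in_prob M ?X c"
  proof (rule tends_in_probI_expectation[OF prob_space_M Xm _ _ lim])
    show "integrable (M n) (?D n)" for n
    proof -
      interpret Mn: prob_space "M n" by (rule prob_space_M)
      have "?D n \<in> borel_measurable (M n)" by measurable
      then show ?thesis by (rule Mn.integrable_const_bound[where B = 1, rotated]) simp
    qed
    show "\<exists>\<delta>>0. \<forall>n\<ge>1. \<forall>\<omega>\<in>space (M n). \<epsilon> \<le> \<bar>?X n \<omega> - c\<bar> \<longrightarrow> \<delta> \<le> ?D n \<omega>" if "0 < \<epsilon>" for \<epsilon>
      using that by (intro exI[of _ "min 1 \<epsilon>"]) auto
  qed auto
  then show ?thesis by (simp add: c_def)
qed

lemma popularity_eq: "\<omega> \<in> space (M n) \<Longrightarrow> popularity n (w n \<omega>) i = v n \<omega> i / (\<Sum>j=1..n. v n \<omega> j)"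
  using Z_pos[of \<omega> n] by (simp add: popularity_def sum_distrib_left[symmetric])

abbreviation "pop n \<omega> i \<equiv> popularity n (w n \<omega>) i"

lemma weights: "random_weights (M n) n (w n)"
  by (intro random_weights.intro random_weights_axioms.intro prob_space_M w_measurable w_nonneg)

lemmas pop_measurable = random_weights.pop_measurable[OF weights]
  and pop_nonneg = random_weights.pop_nonneg[OF weights]
  and sum_pop_le_1 = random_weights.sum_pop_le_1[OF weights]

text \<open>In the time scale \<open>n * \<mu>\<close> the request rates are \<open>\<mu> / avg\<close> times the normalized weights, and
  \<open>\<mu> / avg\<close> tends to \<open>1\<close>.\<close>

lemma rate_eq:
  assumes "1 \<le> n" "\<omega> \<in> space (M n)"
  shows "pop n \<omega> i * (real n * \<mu> * u) = u * \<mu> / avg n \<omega> * v n \<omega> i"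
  using assms by (simp add: popularity_eq)

lemma prob_all_zero_tends: "(\<lambda>n. \<P>(\<omega> in M n. (\<Sum>i=1..n. w n \<omega> i) = 0)) \<longlonglongrightarrow> 0"
proof (rule Lim_null_comparison[OF _ tends_in_probD(2)[OF avg_tends mean_pos]], intro always_eventually allI)
  fix n
  interpret Mn: prob_space "M n" by (rule prob_space_M)
  have "{\<omega>\<in>space (M n). (\<Sum>i=1..n. w n \<omega> i) = 0} \<subseteq> {\<omega>\<in>space (M n). \<mu> \<le> \<bar>avg n \<omega> - \<mu>\<bar>}"
    using mean_pos by (auto simp: sum_distrib_left[symmetric])
  moreover have "{\<omega>\<in>space (M n). \<mu> \<le> \<bar>avg n \<omega> - \<mu>\<bar>} \<in> sets (M n)"
    using tends_in_probD(1)[OF avg_tends, of n] by measurable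
  ultimately show "norm (\<P>(\<omega> in M n. (\<Sum>i=1..n. w n \<omega> i) = 0))
      \<le> \<P>(\<omega> in M n. \<mu> \<le> \<bar>avg n \<omega> - \<mu>\<bar>)"
    by (simp add: Mn.finite_measure_mono)
qed

end

lemma exp_minus_diff_le:
  assumes "0 \<le> (x::real)" "c \<le> a" "c \<le> b"
  shows "\<bar>exp (- (a * x)) - exp (- (b * x))\<bar> \<le> \<bar>a - b\<bar> * x * exp (- (c * x))"
proof -
  have *: "\<bar>exp (- (a * x)) - exp (- (b * x))\<bar> \<le> (b - a) * x * exp (- (c * x))"
    if "c \<le> a" "a \<le> b" for a b
  proof -
    have "exp (- (a * x)) - exp (- (b * x)) = exp (- (a * x)) * (1 - exp (- ((b - a) * x)))"
      by (simp add: algebra_simps exp_add[symmetric])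
    moreover have "exp (- ((b - a) * x)) \<le> 1"
      using that assms by simp
    ultimately have "\<bar>exp (- (a * x)) - exp (- (b * x))\<bar> = exp (- (a * x)) * (1 - exp (- ((b - a) * x)))"
      by (simp add: abs_mult)
    also have "\<dots> \<le> exp (- (c * x)) * ((b - a) * x)"
    proof (rule mult_mono)
      show "exp (- (a * x)) \<le> exp (- (c * x))"
        using that assms by (simp add: mult_right_mono)
      show "1 - exp (- ((b - a) * x)) \<le> (b - a) * x"
        using exp_ge_add_one_self[of "- ((b - a) * x)"] by linarith
    qed (use that assms in auto)
    finally show ?thesis by (simp add: mult_ac)
  qed
  show ?thesis
  proof (cases "a \<le> b")
    case True
    then show ?thesis using *[of a b] assms by simp
  next
    case False
    then show ?thesis using *[of b a] assms by (simp add: abs_minus_commute)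
  qed
qed

context lln_array
begin

lemma laplace_empirical_tends:
  assumes u: "0 < u"
  shows "tends_in_prob M (\<lambda>n \<omega>. (\<Sum>i=1..n. exp (- (u * v n \<omega> i))) / real n) (\<phi> u)"
  unfolding laplace_transform_def
proof (rule empirical_integral_tends)
  show "bounded ((\<lambda>x. exp (- (u * x))) ` {0..})"
    by (rule boundedI[of _ 1]) (use u in auto)
qed (auto intro!: continuous_intros)

lemma tilted_empirical_tends:
  assumes u: "0 < u"
  shows "tends_in_prob M (\<lambda>n \<omega>. (\<Sum>i=1..n. v n \<omega> i * exp (- (u * v n \<omega> i))) / real n) (mom 1 u)"
proof -
  have "tends_in_prob M (\<lambda>n \<omega>. (\<Sum>i=1..n. v n \<omega> i * exp (- (u * v n \<omega> i))) / real n)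
     (LINT x|P. x * exp (- (u * x)))"
  proof (rule empirical_integral_tends)
    show "bounded ((\<lambda>x. x * exp (- (u * x))) ` {0..})"
      by (rule boundedI[of _ "fact 1 / u ^ 1"]) (use power_times_exp_le[of _ u 1] u in auto)
  qed (auto intro!: continuous_intros)
  then show ?thesis by (simp add: tilted_moment_def)
qed

lemma q_measurable: "i \<in> {1..n} \<Longrightarrow> (\<lambda>\<omega>. exp (- (pop n \<omega> i * c))) \<in> borel_measurable (M n)"
  using pop_measurable[of i n] by simp

text \<open>\<open>exp (- (pop n \<omega> i * \<tau>))\<close> is the conditional probability that object \<open>i\<close> is not requested
  during a given time interval of length \<open>\<tau>\<close>.\<close>

lemma unrequested_fraction_tends:
  assumes u: "0 < u"
  shows "tends_in_prob M (\<lambda>n \<omega>. (\<Sum>i=1..n. exp (- (pop n \<omega> i * (real n * \<mu> * u)))) / real n) (\<phi> u)"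
proof (rule tends_in_prob_transfer[OF prob_space_M laplace_empirical_tends[OF u] avg_tends])
  show "(\<lambda>\<omega>. (\<Sum>i=1..n. exp (- (pop n \<omega> i * (real n * \<mu> * u)))) / real n) \<in> borel_measurable (M n)" for n
    by (intro borel_measurable_divide borel_measurable_sum q_measurable) auto
  fix \<epsilon> :: real assume \<epsilon>: "0 < \<epsilon>"
  show "\<exists>\<delta>>0. \<forall>n\<ge>1. \<forall>\<omega>\<in>space (M n).
      \<bar>(\<Sum>i=1..n. exp (- (u * v n \<omega> i))) / real n - \<phi> u\<bar> < \<delta> \<longrightarrow> \<bar>avg n \<omega> - \<mu>\<bar> < \<delta> \<longrightarrow>
      \<bar>(\<Sum>i=1..n. exp (- (pop n \<omega> i * (real n * \<mu> * u)))) / real n - \<phi> u\<bar> < \<epsilon>"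
  \<comment> \<open>If both arguments are within \<open>\<delta>\<close> of their limits, then the error is less than \<open>\<delta> + u * \<delta>\<close>;
      \<open>\<delta> \<le> \<mu>\<close> keeps the mean positive.\<close>
  proof (intro exI[of _ "min \<mu> (\<epsilon> / (1 + u))"] conjI allI ballI impI)
    show "0 < min \<mu> (\<epsilon> / (1 + u))" using mean_pos \<epsilon> u by simp
    fix n \<omega> assume n: "1 \<le> n" and \<omega>: "\<omega> \<in> space (M n)"
      and 1: "\<bar>(\<Sum>i=1..n. exp (- (u * v n \<omega> i))) / real n - \<phi> u\<bar> < min \<mu> (\<epsilon> / (1 + u))"
      and 2: "\<bar>avg n \<omega> - \<mu>\<bar> < min \<mu> (\<epsilon> / (1 + u))"
    have avg: "0 < avg n \<omega>" using 2 by linarith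
    let ?a = "u * \<mu> / avg n \<omega>"
    have "\<bar>(\<Sum>i=1..n. exp (- (?a * v n \<omega> i))) / real n - (\<Sum>i=1..n. exp (- (u * v n \<omega> i))) / real n\<bar>
        = \<bar>\<Sum>i=1..n. exp (- (?a * v n \<omega> i)) - exp (- (u * v n \<omega> i))\<bar> / real n"
      by (simp add: sum_subtractf diff_divide_distrib[symmetric] abs_divide)
    also have "\<dots> \<le> (\<Sum>i=1..n. \<bar>?a - u\<bar> * v n \<omega> i) / real n"
    proof (intro divide_right_mono order_trans[OF sum_abs] sum_mono)
      fix i assume i: "i \<in> {1..n}"
      show "\<bar>exp (- (?a * v n \<omega> i)) - exp (- (u * v n \<omega> i))\<bar> \<le> \<bar>?a - u\<bar> * v n \<omega> i"
      proof -
        have "0 \<le> ?a" using u avg mean_pos by (intro divide_nonneg_pos mult_nonneg_nonneg) auto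
        from exp_minus_diff_le[OF v_nonneg[OF i \<omega>] this, of u] u show ?thesis
          by (simp only: mult_zero_left minus_zero exp_zero mult_1_right less_imp_le)
      qed
    qed simp
    also have "\<dots> = \<bar>?a - u\<bar> * avg n \<omega>"
      by (simp only: sum_distrib_left[symmetric] times_divide_eq_right)
    also have "\<dots> = u * \<bar>avg n \<omega> - \<mu>\<bar>"
    proof -
      have "\<bar>u * \<mu> / m - u\<bar> * m = u * \<bar>m - \<mu>\<bar>" if "0 < m" for m
      proof -
        have "u * \<mu> / m - u = u * (\<mu> - m) / m" using that by (simp add: field_simps)
        then show ?thesis using that u by (simp add: abs_mult abs_minus_commute)
      qed
      from this[OF avg] show ?thesis .
    qed
    also have "\<dots> \<le> u * (\<epsilon> / (1 + u))" using 2 u by (intro mult_left_mono) auto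
    finally have "\<bar>(\<Sum>i=1..n. exp (- (?a * v n \<omega> i))) / real n - \<phi> u\<bar> < \<epsilon> / (1 + u) + u * (\<epsilon> / (1 + u))"
      using 1 by linarith
    also have "\<dots> = (1 + u) * (\<epsilon> / (1 + u))" by (simp only: distrib_right mult_1_left)
    also have "\<dots> = \<epsilon>" using u by simp
    finally show "\<bar>(\<Sum>i=1..n. exp (- (pop n \<omega> i * (real n * \<mu> * u)))) / real n - \<phi> u\<bar> < \<epsilon>"
      by (simp only: rate_eq[OF n \<omega>])
  qed
qed

text \<open>The weights in the numerator of \<open>pop\<close> bring in the derivative of the Laplace transform.\<close>

lemma size_biased_tends:
  assumes u: "0 < u"
  shows "tends_in_prob M (\<lambda>n \<omega>. \<Sum>i=1..n. pop n \<omega> i * exp (- (pop n \<omega> i * (real n * \<mu> * u)))) (mom 1 u / \<mu>)"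
proof (rule tends_in_prob_transfer[OF prob_space_M tilted_empirical_tends[OF u] avg_tends])
  show "(\<lambda>\<omega>. \<Sum>i=1..n. pop n \<omega> i * exp (- (pop n \<omega> i * (real n * \<mu> * u)))) \<in> borel_measurable (M n)" for n
    by (intro borel_measurable_sum borel_measurable_times q_measurable pop_measurable) auto
  fix \<epsilon> :: real assume \<epsilon>: "0 < \<epsilon>"
  define \<psi> where "\<psi> = mom 1 u"
  have \<psi>: "0 < \<psi>" unfolding \<psi>_def by (rule mom_pos[OF u])
  \<comment> \<open>If both arguments are within \<open>\<delta> \<le> \<mu> / 2\<close> of their limits, then the numerator is within \<open>3 * \<delta>\<close>
    of \<open>\<psi>\<close> and the denominator is at least \<open>\<mu> / 2\<close>, so that the error is at most \<open>C * \<delta>\<close>.\<close>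
  define C where "C = 6 / \<mu> + 2 * \<psi> / \<mu>\<^sup>2"
  have C: "0 < C" unfolding C_def using mean_pos \<psi> by (intro add_pos_pos divide_pos_pos) auto
  define \<delta> where "\<delta> = min (\<mu> / 2) (\<epsilon> / (2 * C))"
  have \<delta>: "0 < \<delta>" "\<delta> \<le> \<mu> / 2" "C * \<delta> < \<epsilon>"
  proof -
    show "0 < \<delta>" "\<delta> \<le> \<mu> / 2" unfolding \<delta>_def using mean_pos \<epsilon> C by auto
    have "C * \<delta> \<le> C * (\<epsilon> / (2 * C))" unfolding \<delta>_def using C by (intro mult_left_mono) auto
    also have "\<dots> < \<epsilon>" using C \<epsilon> by simp
    finally show "C * \<delta> < \<epsilon>" .
  qed
  show "\<exists>\<delta>>0. \<forall>n\<ge>1. \<forall>\<omega>\<in>space (M n).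
      \<bar>(\<Sum>i=1..n. v n \<omega> i * exp (- (u * v n \<omega> i))) / real n - mom 1 u\<bar> < \<delta> \<longrightarrow> \<bar>avg n \<omega> - \<mu>\<bar> < \<delta> \<longrightarrow>
      \<bar>(\<Sum>i=1..n. pop n \<omega> i * exp (- (pop n \<omega> i * (real n * \<mu> * u)))) - mom 1 u / \<mu>\<bar> < \<epsilon>"
    unfolding \<psi>_def[symmetric]
  proof (intro exI[of _ \<delta>] conjI allI ballI impI \<delta>(1))
    fix n \<omega> assume n: "1 \<le> n" and \<omega>: "\<omega> \<in> space (M n)"
      and 1: "\<bar>(\<Sum>i=1..n. v n \<omega> i * exp (- (u * v n \<omega> i))) / real n - \<psi>\<bar> < \<delta>"
      and 2: "\<bar>avg n \<omega> - \<mu>\<bar> < \<delta>"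
    define m where "m = avg n \<omega>"
    have m: "\<mu> / 2 < m" "m < 2 * \<mu>" "0 < m" "\<bar>m - \<mu>\<bar> < \<delta>"
      using 2 \<delta>(1,2) mean_pos unfolding m_def[symmetric] by linarith+
    define a where "a = u * \<mu> / m"
    have a: "u / 2 \<le> a" using m u by (simp add: a_def field_simps)
    define num where "num = (\<Sum>i=1..n. v n \<omega> i * exp (- (a * v n \<omega> i))) / real n"
    have eq: "(\<Sum>i=1..n. pop n \<omega> i * exp (- (pop n \<omega> i * (real n * \<mu> * u)))) = num / m"
    proof -
      have "pop n \<omega> i = v n \<omega> i / (real n * m)" for i
        using n by (simp add: popularity_eq[OF \<omega>] m_def)
      then have "(\<Sum>i=1..n. pop n \<omega> i * exp (- (pop n \<omega> i * (real n * \<mu> * u))))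
          = (\<Sum>i=1..n. v n \<omega> i / (real n * m) * exp (- (a * v n \<omega> i)))"
        unfolding rate_eq[OF n \<omega>] a_def m_def by simp
      also have "\<dots> = num / m"
        by (simp add: num_def sum_divide_distrib)
      finally show ?thesis .
    qed
    have "\<bar>num - (\<Sum>i=1..n. v n \<omega> i * exp (- (u * v n \<omega> i))) / real n\<bar>
        = \<bar>\<Sum>i=1..n. v n \<omega> i * (exp (- (a * v n \<omega> i)) - exp (- (u * v n \<omega> i)))\<bar> / real n"
      by (simp add: num_def sum_subtractf diff_divide_distrib[symmetric] abs_divide right_diff_distrib)
    also have "\<dots> \<le> (\<Sum>i=1..n. \<bar>a - u\<bar> * (2 / u) * v n \<omega> i) / real n"
    proof (intro divide_right_mono order_trans[OF sum_abs] sum_mono)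
      fix i assume i: "i \<in> {1..n}"
      note vi = v_nonneg[OF i \<omega>]
      have "\<bar>v n \<omega> i * (exp (- (a * v n \<omega> i)) - exp (- (u * v n \<omega> i)))\<bar>
          = v n \<omega> i * \<bar>exp (- (a * v n \<omega> i)) - exp (- (u * v n \<omega> i))\<bar>"
        by (simp only: abs_mult[of "v n \<omega> i"] abs_of_nonneg[OF vi])
      also have "\<dots> \<le> v n \<omega> i * (\<bar>a - u\<bar> * v n \<omega> i * exp (- (u / 2 * v n \<omega> i)))"
        using exp_minus_diff_le[OF vi a, of u] u vi by (intro mult_left_mono) auto
      also have "\<dots> = \<bar>a - u\<bar> * v n \<omega> i * (v n \<omega> i ^ 1 * exp (- (u / 2 * v n \<omega> i)))"
        by (simp add: mult_ac)
      also have "\<dots> \<le> \<bar>a - u\<bar> * v n \<omega> i * (fact 1 / (u / 2) ^ 1)"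
        by (rule mult_left_mono[OF power_times_exp_le]) (use u vi in auto)
      finally show "\<bar>v n \<omega> i * (exp (- (a * v n \<omega> i)) - exp (- (u * v n \<omega> i)))\<bar>
          \<le> \<bar>a - u\<bar> * (2 / u) * v n \<omega> i"
        by (simp add: mult_ac)
    qed simp
    also have "\<dots> = \<bar>a - u\<bar> * (2 / u) * m"
      unfolding m_def by (simp only: sum_distrib_left[symmetric] times_divide_eq_right)
    also have "\<dots> = 2 * \<bar>m - \<mu>\<bar>"
    proof -
      have "a - u = u * (\<mu> - m) / m" using m by (simp add: a_def field_simps)
      then show ?thesis using m u by (simp add: abs_mult abs_minus_commute)
    qed
    finally have num_le: "\<bar>num - (\<Sum>i=1..n. v n \<omega> i * exp (- (u * v n \<omega> i))) / real n\<bar> \<le> 2 * \<bar>m - \<mu>\<bar>" .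
    have "\<bar>num - S\<bar> \<le> 2 * e \<Longrightarrow> \<bar>S - \<psi>\<bar> < \<delta> \<Longrightarrow> e < \<delta> \<Longrightarrow> \<bar>num - \<psi>\<bar> < 3 * \<delta>" for S e
      by linarith
    from this[OF num_le 1 m(4)] have num: "\<bar>num - \<psi>\<bar> < 3 * \<delta>" .
    have "\<bar>num / m - \<psi> / \<mu>\<bar> \<le> \<bar>num - \<psi>\<bar> / m + \<psi> * \<bar>m - \<mu>\<bar> / (m * \<mu>)"
    proof -
      have "num / m - \<psi> / \<mu> = (num - \<psi>) / m + \<psi> * (\<mu> - m) / (m * \<mu>)"
        using m mean_pos by (simp add: field_simps)
      also have "\<bar>\<dots>\<bar> \<le> \<bar>(num - \<psi>) / m\<bar> + \<bar>\<psi> * (\<mu> - m) / (m * \<mu>)\<bar>"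
        by (rule abs_triangle_ineq)
      also have "\<dots> = \<bar>num - \<psi>\<bar> / m + \<psi> * \<bar>m - \<mu>\<bar> / (m * \<mu>)"
        using m mean_pos \<psi> by (simp add: abs_mult abs_divide abs_minus_commute)
      finally show ?thesis .
    qed
    also have "\<dots> \<le> 3 * \<delta> / (\<mu> / 2) + \<psi> * \<delta> / (\<mu> / 2 * \<mu>)"
      using m mean_pos \<psi> num \<delta>
      by (intro add_mono frac_le mult_left_mono mult_right_mono mult_nonneg_nonneg) auto
    also have "\<dots> = C * \<delta>"
      using mean_pos by (simp add: C_def field_simps power2_eq_square)
    finally show "\<bar>(\<Sum>i=1..n. pop n \<omega> i * exp (- (pop n \<omega> i * (real n * \<mu> * u)))) - \<psi> / \<mu>\<bar> < \<epsilon>"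
      using \<delta>(3) unfolding eq by linarith
  qed
qed

end

section \<open>The move-to-front list as a function of the request instants\<close>

text \<open>Requested objects form an initial segment, and the others keep their relative order behind
  it. The order inside that segment never matters here.\<close>

lemma fold_move_to_front:
  "\<exists>D. distinct D \<and> set D = set ls \<and> fold move_to_front ls L = D @ filter (\<lambda>x. x \<notin> set ls) L"
proof (induction ls rule: rev_induct)
  case (snoc l ls)
  then obtain D where D: "distinct D" "set D = set ls"
    "fold move_to_front ls L = D @ filter (\<lambda>x. x \<notin> set ls) L" by blast
  have "fold move_to_front (ls @ [l]) L = (l # removeAll l D) @ filter (\<lambda>x. x \<notin> set (ls @ [l])) L"
    by (auto simp: D(3) move_to_front_def removeAll_filter_not_eq intro!: filter_cong)
  moreover have "distinct (l # removeAll l D)" "set (l # removeAll l D) = set (ls @ [l])"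
    using D by (auto simp: distinct_removeAll)
  ultimately show ?case by blast
qed auto

lemma position_append_le_iff:
  "position i (D @ L) \<le> length D \<longleftrightarrow> i \<in> set D"
proof (cases "i \<in> set D")
  case True
  then obtain xs ys where "D = xs @ i # ys" "i \<notin> set xs"
    by (meson split_list_first)
  then have "takeWhile (\<lambda>j. j \<noteq> i) (D @ L) = xs"
    by (simp add: takeWhile_append)
  then show ?thesis using True \<open>D = xs @ i # ys\<close> by (simp add: position_def)
next
  case False
  then have "takeWhile (\<lambda>j. j \<noteq> i) (D @ L) = D @ takeWhile (\<lambda>j. j \<noteq> i) L"
    by (intro takeWhile_append2) auto
  then show ?thesis using False by (simp add: position_def)
qed

lemma position_append_filter_upt:
  assumes i: "i \<in> {1..n}" "i \<notin> set D" "Q i"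
  shows "position i (D @ filter Q [1..<Suc n]) = length D + card {j\<in>{1..n}. Q j \<and> j \<le> i}"
proof -
  have "[1..<Suc n] = [1..<i] @ i # [Suc i..<Suc n]"
    using i by (metis Suc_le_mono atLeastAtMost_iff le_Suc_eq le_add_diff_inverse less_Suc_eq_le upt_add_eq_append upt_conv_Cons)
  then have "filter Q [1..<Suc n] = filter Q [1..<i] @ i # filter Q [Suc i..<Suc n]"
    using i by simp
  then have "takeWhile (\<lambda>j. j \<noteq> i) (D @ filter Q [1..<Suc n]) = D @ filter Q [1..<i]"
    using i by (simp add: takeWhile_append takeWhile_eq_all_conv[THEN iffD2])
  moreover have "Suc (length (filter Q [1..<i])) = card {j\<in>{1..n}. Q j \<and> j \<le> i}"
  proof -
    have "{j\<in>{1..n}. Q j \<and> j \<le> i} = insert i (set (filter Q [1..<i]))"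
      using i by auto
    then show ?thesis
      using distinct_card[of "filter Q [1..<i]"] by simp
  qed
  ultimately show ?thesis by (simp add: position_def)
qed

lemma initial_list_id: "initial_list n id = [1..<Suc n]"
proof -
  have "map (inv_into {1..n} id) [1..<Suc n] = map id [1..<Suc n]"
    by (rule map_cong) (auto simp: inv_into_f_f[of id, simplified])
  then show ?thesis by (simp add: initial_list_def)
qed

locale request_sets =
  fixes n :: nat and B :: "nat \<Rightarrow> real set"
  assumes nonneg: "i \<in> {1..n} \<Longrightarrow> B i \<subseteq> {0..}"
    and locally_finite: "i \<in> {1..n} \<Longrightarrow> finite (B i \<inter> {..<b})"
begin

abbreviation "R \<equiv> request_instants n B"

lemma finite_before: "finite (R \<inter> {..<b})"
proof -
  have "R \<inter> {..<b} = (\<Union>i\<in>{1..n}. B i \<inter> {..<b})" unfolding request_instants_def by blast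
  also have "finite \<dots>" by (intro finite_UN_I locally_finite) auto
  finally show ?thesis .
qed

lemma finite_upto: "finite (R \<inter> {..b})"
  by (rule finite_subset[OF _ finite_before[of "b + 1"]]) auto

lemma finite_window: "finite (R \<inter> {a..<b})"
  by (rule finite_subset[OF _ finite_before[of b]]) auto

lemma finite_B_window: "i \<in> {1..n} \<Longrightarrow> finite (B i \<inter> {a..<b})"
  by (rule finite_subset[OF _ locally_finite[of i b]]) auto

lemma requested_at_props:
  assumes "s \<in> R"
  shows "requested_at n B s \<in> {1..n}" "s \<in> B (requested_at n B s)"
    and "l \<in> {1..n} \<Longrightarrow> s \<in> B l \<Longrightarrow> requested_at n B s \<le> l"
proof -
  obtain i where "i \<in> {1..n} \<and> s \<in> B i" using assms by (auto simp: request_instants_def)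
  then have "requested_at n B s \<in> {1..n} \<and> s \<in> B (requested_at n B s)"
    unfolding requested_at_def by (rule LeastI)
  then show "requested_at n B s \<in> {1..n}" "s \<in> B (requested_at n B s)" by auto
  show "l \<in> {1..n} \<Longrightarrow> s \<in> B l \<Longrightarrow> requested_at n B s \<le> l"
    unfolding requested_at_def by (rule Least_le) auto
qed

lemma requested_at_eqI:
  assumes "i \<in> {1..n}" "s \<in> B i" "\<And>l. l \<in> {1..n} \<Longrightarrow> l < i \<Longrightarrow> s \<notin> B l"
  shows "requested_at n B s = i"
proof -
  have "s \<in> R" using assms by (auto simp: request_instants_def)
  from requested_at_props[OF this] assms show ?thesis by (meson not_le_imp_less order_antisym)
qed

lemma first_request_exists:
  assumes "R \<inter> {t..} \<noteq> {}"
  obtains s where "s \<in> R" "t \<le> s" "R \<inter> {t..<s} = {}"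
proof -
  obtain r where r: "r \<in> R" "t \<le> r" using assms by auto
  let ?F = "R \<inter> {t..<r + 1}"
  have "finite ?F" "?F \<noteq> {}" using finite_window r by auto
  then have "Min ?F \<in> ?F" and min: "\<And>x. x \<in> ?F \<Longrightarrow> Min ?F \<le> x"
    using Min_in[of ?F] Min_le[of ?F] by blast+
  moreover have "R \<inter> {t..<Min ?F} = {}"
    using min \<open>Min ?F \<in> ?F\<close> by force
  ultimately show ?thesis using that[of "Min ?F"] by auto
qed

lemma next_requested_eq:
  assumes s: "s \<in> R" "t \<le> s" "R \<inter> {t..<s} = {}"
  shows "next_requested n B t = requested_at n B s"
proof -
  have eq: "R \<inter> {..s} = insert s (R \<inter> {..<t})"
  proof (intro equalityI subsetI)
    fix x assume x: "x \<in> R \<inter> {..s}"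
    show "x \<in> insert s (R \<inter> {..<t})"
    proof (rule ccontr)
      assume "x \<notin> insert s (R \<inter> {..<t})"
      with x have "x \<in> R \<inter> {t..<s}" by auto
      with s(3) show False by simp
    qed
  qed (use s in auto)
  then have card: "card (R \<inter> {..s}) = num_requests_before n B t + 1"
    unfolding eq num_requests_before_def using s by (subst card_insert_disjoint[OF finite_before]) auto
  have mono: "card (R \<inter> {..x}) < card (R \<inter> {..y})" if "y \<in> R" "x < y" for x y
  proof (rule psubset_card_mono[OF finite_upto])
    have "y \<in> R \<inter> {..y}" "y \<notin> R \<inter> {..x}" "R \<inter> {..x} \<subseteq> R \<inter> {..y}" using that by auto
    then show "R \<inter> {..x} \<subset> R \<inter> {..y}" by blast
  qed
  have uniq: "(THE s. s \<in> R \<and> card (R \<inter> {..s}) = num_requests_before n B t + 1) = s"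
  proof (rule the_equality)
    fix s' assume "s' \<in> R \<and> card (R \<inter> {..s'}) = num_requests_before n B t + 1"
    then show "s' = s" using mono[of s' s] mono[of s s'] s(1) card by (cases s s' rule: linorder_cases) auto
  qed (use s card in auto)
  show ?thesis
    unfolding next_requested_def request_label_def uniq using s(1) card by auto
qed

lemma next_requested_none:
  assumes "R \<inter> {t..} = {}"
  shows "next_requested n B t = 0"
proof -
  have "card (R \<inter> {..s}) \<noteq> num_requests_before n B t + 1" for s
  proof -
    have "R \<inter> {..s} \<subseteq> R \<inter> {..<t}" using assms by (auto simp: not_le[symmetric])
    then have "card (R \<inter> {..s}) \<le> card (R \<inter> {..<t})"
      by (rule card_mono[OF finite_before])
    then show ?thesis by (simp add: num_requests_before_def)
  qed
  then show ?thesis by (simp add: next_requested_def request_label_def)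
qed

lemma next_requested_le: "next_requested n B t \<le> n"
proof (cases "R \<inter> {t..} = {}")
  case False
  then obtain s where "s \<in> R" "t \<le> s" "R \<inter> {t..<s} = {}" by (rule first_request_exists)
  then show ?thesis using next_requested_eq[of s t] requested_at_props(1)[of s] by auto
qed (simp add: next_requested_none)

text \<open>In this form the next object is read off from the requests in finitely many windows.\<close>

lemma next_requested_cell:
  assumes i: "i \<in> {1..n}" and "t \<le> c"
    and none: "\<And>l. l \<in> {1..n} \<Longrightarrow> B l \<inter> {t..<c} = {}"
    and cell: "B i \<inter> {c..<d} \<noteq> {}" "\<And>l. l \<in> {1..n} \<Longrightarrow> l \<noteq> i \<Longrightarrow> B l \<inter> {c..<d} = {}"
  shows "next_requested n B t = i"
proof -
  have "R \<inter> {t..} \<noteq> {}" using i cell(1) \<open>t \<le> c\<close> by (fastforce simp: request_instants_def)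
  then obtain s where s: "s \<in> R" "t \<le> s" "R \<inter> {t..<s} = {}" by (rule first_request_exists)
  obtain r where r: "r \<in> B i" "c \<le> r" "r < d" using cell(1) by auto
  have "r \<in> R" using i r by (auto simp: request_instants_def)
  then have "s \<le> r" using s(3) r \<open>t \<le> c\<close> by (force simp: disjoint_iff)
  obtain l where l: "l \<in> {1..n}" "s \<in> B l" using s(1) by (auto simp: request_instants_def)
  have "c \<le> s" using none[OF l(1)] l(2) s(2) by (force simp: disjoint_iff)
  then have *: "l \<in> {1..n} \<Longrightarrow> s \<in> B l \<Longrightarrow> l = i" for l
    using cell(2)[of l] \<open>s \<le> r\<close> r by (force simp: disjoint_iff)
  have "requested_at n B s = i"
    using * requested_at_props(1,2)[OF s(1)] by blast
  then show ?thesis using next_requested_eq[OF s] by simp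
qed

text \<open>For measurability: the first request times after \<open>t\<close> are compared by means of countably many
  windows. A tie is won by the smallest label, hence the asymmetry between \<open>l < i\<close> and \<open>i < l\<close>.\<close>

lemma next_requested_eq_iff:
  assumes i: "i \<in> {1..n}"
  shows "next_requested n B t = i \<longleftrightarrow>
    (\<exists>q\<in>\<rat>. B i \<inter> {t..<q} \<noteq> {}) \<and>
    (\<forall>l\<in>{1..n}. l < i \<longrightarrow> (\<exists>q\<in>\<rat>. B i \<inter> {t..<q} \<noteq> {} \<and> B l \<inter> {t..<q} = {})) \<and>
    (\<forall>l\<in>{1..n}. i < l \<longrightarrow> (\<forall>q\<in>\<rat>. B l \<inter> {t..<q} \<noteq> {} \<longrightarrow> B i \<inter> {t..<q} \<noteq> {}))"
    (is "?lhs \<longleftrightarrow> ?rhs")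
proof
  assume ?lhs
  then have "R \<inter> {t..} \<noteq> {}" using i next_requested_none[of t] by auto
  then obtain s where s: "s \<in> R" "t \<le> s" "R \<inter> {t..<s} = {}" by (rule first_request_exists)
  have at: "requested_at n B s = i" using \<open>?lhs\<close> next_requested_eq[OF s] by simp
  have sB: "s \<in> B i" using requested_at_props(2)[OF s(1)] at by simp
  have before: "B l \<inter> {t..<s} = {}" if "l \<in> {1..n}" for l
    using s(3) that unfolding request_instants_def by blast
  show ?rhs
  proof (intro conjI ballI impI)
    obtain q where "q \<in> \<rat>" "s < q" "q < s + 1" using Rats_dense_in_real[of s "s + 1"] by auto
    then show "\<exists>q\<in>\<rat>. B i \<inter> {t..<q} \<noteq> {}" using sB s by (intro bexI[of _ q]) auto
  next
    fix l assume l: "l \<in> {1..n}" "l < i"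
    then have "s \<notin> B l" using requested_at_props(3)[OF s(1), of l] at by auto
    have fin: "finite (B l \<inter> {s..<s + 1})" by (rule finite_B_window[OF l(1)])
    obtain d where d: "s < d" "\<And>x. x \<in> B l \<inter> {s..<s + 1} \<Longrightarrow> d \<le> x"
    proof (cases "B l \<inter> {s..<s + 1} = {}")
      case True
      then show ?thesis using that[of "s + 1"] by auto
    next
      case False
      then have "Min (B l \<inter> {s..<s + 1}) \<in> B l \<inter> {s..<s + 1}" using fin by (rule Min_in[rotated])
      then have "s < Min (B l \<inter> {s..<s + 1})" using \<open>s \<notin> B l\<close> by (metis IntE atLeastLessThan_iff order_le_less)
      then show ?thesis using that fin by auto
    qed
    obtain q where q: "q \<in> \<rat>" "s < q" "q < min d (s + 1)"
      using Rats_dense_in_real[of s "min d (s + 1)"] d by auto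
    have "B l \<inter> {t..<q} = {}"
    proof (rule ccontr)
      assume "B l \<inter> {t..<q} \<noteq> {}"
      then obtain x where x: "x \<in> B l" "t \<le> x" "x < q" by auto
      have "\<not> x < s" using before[OF l(1)] x by (auto simp: disjoint_iff)
      then have "d \<le> x" using d(2)[of x] x q by auto
      then show False using x q by auto
    qed
    then show "\<exists>q\<in>\<rat>. B i \<inter> {t..<q} \<noteq> {} \<and> B l \<inter> {t..<q} = {}"
      using q sB s by (intro bexI[of _ q]) auto
  next
    fix l q assume l: "l \<in> {1..n}" and "B l \<inter> {t..<q} \<noteq> {}"
    then obtain x where "x \<in> B l" "t \<le> x" "x < q" by auto
    moreover have "\<not> x < s" using before[OF l] calculation by (auto simp: disjoint_iff)
    ultimately show "B i \<inter> {t..<q} \<noteq> {}" using sB s by auto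
  qed
next
  assume rhs: ?rhs
  then obtain q0 where q0: "B i \<inter> {t..<q0} \<noteq> {}" by blast
  define s where "s = Min (B i \<inter> {t..<q0})"
  have fin: "finite (B i \<inter> {t..<q0})" by (rule finite_B_window[OF i])
  have s: "s \<in> B i" "t \<le> s" "s < q0" using Min_in[OF fin q0] by (auto simp: s_def)
  have first: "B i \<inter> {t..<s} = {}"
  proof (rule ccontr)
    assume "B i \<inter> {t..<s} \<noteq> {}"
    then obtain x where x: "x \<in> B i" "t \<le> x" "x < s" by auto
    then have "x \<in> B i \<inter> {t..<q0}" using s(3) by simp
    then have "s \<le> x" unfolding s_def by (rule Min_le[OF fin])
    then show False using x by simp
  qed
  have sR: "s \<in> R" using s i by (auto simp: request_instants_def)
  have less: "B l \<inter> {t..s} = {}" if l: "l \<in> {1..n}" "l < i" for l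
  proof -
    obtain q where "B i \<inter> {t..<q} \<noteq> {}" "B l \<inter> {t..<q} = {}" using rhs l by blast
    then have "s < q" using first by (force simp: disjoint_iff)
    then show ?thesis using \<open>B l \<inter> {t..<q} = {}\<close> by (auto simp: disjoint_iff)
  qed
  have greater: "B l \<inter> {t..<s} = {}" if l: "l \<in> {1..n}" "i < l" for l
  proof (rule ccontr)
    assume "B l \<inter> {t..<s} \<noteq> {}"
    then obtain x where x: "x \<in> B l" "t \<le> x" "x < s" by auto
    obtain q where q: "q \<in> \<rat>" "x < q" "q < s" using Rats_dense_in_real[OF x(3)] by auto
    then have "B i \<inter> {t..<q} \<noteq> {}" using rhs l x by (metis (no_types, lifting) IntI atLeastLessThan_iff empty_iff)
    then show False using first q by (force simp: disjoint_iff)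
  qed
  have "R \<inter> {t..<s} = {}"
  proof (rule ccontr)
    assume "R \<inter> {t..<s} \<noteq> {}"
    then obtain x where x: "x \<in> R" "t \<le> x" "x < s" by auto
    then obtain l where "l \<in> {1..n}" "x \<in> B l" unfolding request_instants_def by blast
    with x(2,3) show False using less[of l] greater[of l] first
      by (cases l i rule: linorder_cases) (auto simp: disjoint_iff)
  qed
  moreover have "requested_at n B s = i"
    by (rule requested_at_eqI[OF i s(1)]) (use less s in \<open>auto simp: disjoint_iff\<close>)
  ultimately show ?lhs using next_requested_eq[OF sR s(2)] by simp
qed

lemma sorted_list_of_set_split:
  assumes "a \<le> b"
  shows "sorted_list_of_set (R \<inter> {..<b}) = sorted_list_of_set (R \<inter> {..<a}) @ sorted_list_of_set (R \<inter> {a..<b})"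
proof (rule sorted_distinct_set_unique)
  have "R \<inter> {..<b} = (R \<inter> {..<a}) \<union> (R \<inter> {a..<b})" using assms by auto
  then show "set (sorted_list_of_set (R \<inter> {..<b})) =
      set (sorted_list_of_set (R \<inter> {..<a}) @ sorted_list_of_set (R \<inter> {a..<b}))"
    using finite_before finite_window by simp
  show "sorted (sorted_list_of_set (R \<inter> {..<a}) @ sorted_list_of_set (R \<inter> {a..<b}))"
    using finite_before finite_window by (auto simp: sorted_append)
  show "distinct (sorted_list_of_set (R \<inter> {..<a}) @ sorted_list_of_set (R \<inter> {a..<b}))"
    using finite_before finite_window by auto
qed auto

lemma list_at_split:
  assumes "a \<le> b"
  shows "list_at n \<pi> B b = fold (\<lambda>s. move_to_front (requested_at n B s))
     (sorted_list_of_set (R \<inter> {a..<b})) (list_at n \<pi> B a)"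
  unfolding list_at_def sorted_list_of_set_split[OF assms] by simp

definition unrequested :: "real \<Rightarrow> real \<Rightarrow> nat set" where
  "unrequested a b = {i\<in>{1..n}. B i \<inter> {a..<b} = {}}"

text \<open>When several objects are requested at the same instant, only the one with the smallest label is
  moved, and the others do not count as requested for the list. Such instants are excluded.\<close>

definition no_ties :: "real \<Rightarrow> bool" where
  "no_ties b \<longleftrightarrow> (\<forall>i\<in>{1..n}. \<forall>l\<in>{1..n}. i \<noteq> l \<longrightarrow> B i \<inter> B l \<inter> {0..<b} = {})"

lemma finite_unrequested: "finite (unrequested a b)" "card (unrequested a b) \<le> n"
proof -
  have sub: "unrequested a b \<subseteq> {1..n}" by (auto simp: unrequested_def)
  then show "finite (unrequested a b)" by (rule finite_subset) simp
  show "card (unrequested a b) \<le> n" using card_mono[OF _ sub] by simp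
qed

text \<open>The objects requested in a window form the initial segment \<open>D\<close>, whatever the list at its beginning.\<close>

lemma list_at_window:
  assumes "no_ties b" "0 \<le> a" "a \<le> b"
  obtains D where "distinct D" "set D = {1..n} - unrequested a b" "length D = n - card (unrequested a b)"
    "list_at n \<pi> B b = D @ filter (\<lambda>x. x \<notin> {1..n} - unrequested a b) (list_at n \<pi> B a)"
proof -
  let ?ls = "map (requested_at n B) (sorted_list_of_set (R \<inter> {a..<b}))"
  have ls: "set ?ls = {1..n} - unrequested a b"
  proof (intro equalityI subsetI)
    fix x assume "x \<in> set ?ls"
    then obtain s where s: "x = requested_at n B s" "s \<in> R" "s \<in> {a..<b}"
      using finite_window by auto
    then show "x \<in> {1..n} - unrequested a b"
      using requested_at_props(1,2)[OF s(2)] by (auto simp: unrequested_def)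
  next
    fix x assume "x \<in> {1..n} - unrequested a b"
    then have "x \<in> {1..n}" "B x \<inter> {a..<b} \<noteq> {}" by (auto simp: unrequested_def)
    then obtain s where s: "x \<in> {1..n}" "s \<in> B x" "s \<in> {a..<b}" by blast
    have "requested_at n B s = x"
    proof (rule requested_at_eqI[OF s(1,2)])
      fix l assume "l \<in> {1..n}" "l < x"
      then have "B x \<inter> B l \<inter> {0..<b} = {}" using assms(1) s(1) unfolding no_ties_def by auto
      then show "s \<notin> B l" using s assms(2) by (auto simp: disjoint_iff)
    qed
    moreover have "s \<in> R" using s by (auto simp: request_instants_def)
    ultimately show "x \<in> set ?ls" using s finite_window by auto
  qed
  obtain D where D: "distinct D" "set D = set ?ls"
    "fold move_to_front ?ls (list_at n \<pi> B a) = D @ filter (\<lambda>x. x \<notin> set ?ls) (list_at n \<pi> B a)"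
    using fold_move_to_front by blast
  have "list_at n \<pi> B b = fold move_to_front ?ls (list_at n \<pi> B a)"
    unfolding list_at_split[OF assms(3)] fold_map comp_def ..
  moreover have "length D = n - card (unrequested a b)"
  proof -
    have "length D = card ({1..n} - unrequested a b)"
      using distinct_card[OF D(1)] D(2) ls by simp
    also have "\<dots> = n - card (unrequested a b)"
      by (subst card_Diff_subset) (use finite_unrequested in \<open>auto simp: unrequested_def\<close>)
    finally show ?thesis .
  qed
  ultimately show ?thesis using that[of D] D ls by simp
qed

lemma position_le_iff:
  assumes "no_ties b" "0 \<le> a" "a \<le> b" "i \<in> {1..n}"
  shows "position i (list_at n \<pi> B b) \<le> n - card (unrequested a b) \<longleftrightarrow> i \<notin> unrequested a b"
proof -
  obtain D where D: "set D = {1..n} - unrequested a b" "length D = n - card (unrequested a b)"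
    "list_at n \<pi> B b = D @ filter (\<lambda>x. x \<notin> {1..n} - unrequested a b) (list_at n \<pi> B a)"
    by (rule list_at_window[OF assms(1-3)])
  show ?thesis
    unfolding D(3) D(2)[symmetric] position_append_le_iff using assms(4) D(1) by simp
qed

lemma list_at_0: "list_at n \<pi> B 0 = initial_list n \<pi>"
proof -
  have "R \<inter> {..<0} = {}" using nonneg by (fastforce simp: request_instants_def)
  then show ?thesis by (simp add: list_at_def)
qed

text \<open>The list at time \<open>0\<close> is in the order of the labels, and the unrequested objects keep this order.\<close>

lemma position_unrequested:
  assumes "no_ties b" "0 \<le> b" "i \<in> unrequested 0 b"
  shows "position i (list_at n id B b) =
    n - card (unrequested 0 b) + card {j\<in>unrequested 0 b. j \<le> i}"
proof -
  obtain D where D: "set D = {1..n} - unrequested 0 b" "length D = n - card (unrequested 0 b)"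
    "list_at n id B b = D @ filter (\<lambda>x. x \<notin> {1..n} - unrequested 0 b) (list_at n id B 0)"
    by (rule list_at_window[OF assms(1) _ assms(2)]) auto
  have i: "i \<in> {1..n}" using assms(3) by (simp add: unrequested_def)
  have "position i (list_at n id B b) =
      length D + card {j\<in>{1..n}. j \<notin> {1..n} - unrequested 0 b \<and> j \<le> i}"
    unfolding D(3) list_at_0 initial_list_id
    by (rule position_append_filter_upt) (use i assms(3) D(1) in auto)
  moreover have "{j\<in>{1..n}. j \<notin> {1..n} - unrequested 0 b \<and> j \<le> i} = {j\<in>unrequested 0 b. j \<le> i}"
    by (auto simp: unrequested_def)
  ultimately show ?thesis using D(2) by simp
qed

lemma search_cost_eq:
  "search_cost n \<pi> B b = (if next_requested n B b = 0 then 0 else position (next_requested n B b) (list_at n \<pi> B b))"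
proof -
  have "search_cost n \<pi> B b = (\<Sum>i\<in>{1..n}. if i = next_requested n B b then position i (list_at n \<pi> B b) else 0)"
    unfolding search_cost_def by (intro sum.cong) auto
  also have "\<dots> = (if next_requested n B b \<in> {1..n} then position (next_requested n B b) (list_at n \<pi> B b) else 0)"
    by (subst sum.delta) auto
  finally show ?thesis using next_requested_le[of b] by auto
qed

lemma search_cost_le_iff:
  assumes "no_ties b" "0 \<le> a" "a \<le> b"
  shows "search_cost n \<pi> B b \<le> n - card (unrequested a b) \<longleftrightarrow> next_requested n B b \<notin> unrequested a b"
proof (cases "next_requested n B b = 0")
  case True
  then show ?thesis by (simp add: search_cost_eq unrequested_def)
next
  case False
  then have "next_requested n B b \<in> {1..n}" using next_requested_le[of b] by simp
  from position_le_iff[OF assms this] show ?thesis using False by (simp add: search_cost_eq)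
qed

lemma search_cost_le_rank_iff:
  assumes "no_ties b" "0 \<le> b" "k \<le> card (unrequested 0 b)"
  shows "search_cost n id B b \<le> n - card (unrequested 0 b) + k \<longleftrightarrow>
     (next_requested n B b \<in> unrequested 0 b \<longrightarrow>
        card {j\<in>unrequested 0 b. j \<le> next_requested n B b} \<le> k)"
proof (cases "next_requested n B b \<in> unrequested 0 b")
  case True
  then have "next_requested n B b \<noteq> 0" by (auto simp: unrequested_def)
  then show ?thesis
    using True position_unrequested[OF assms(1,2) True] by (simp add: search_cost_eq)
next
  case False
  then have "search_cost n id B b \<le> n - card (unrequested 0 b)"
    using search_cost_le_iff[OF assms(1) order_refl assms(2)] by simp
  then show ?thesis using False by simp
qed

lemma search_cost_le:
  assumes "no_ties b" "0 \<le> b" shows "search_cost n id B b \<le> n"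
proof -
  have "card {j\<in>unrequested 0 b. j \<le> next_requested n B b} \<le> card (unrequested 0 b)"
    using finite_unrequested by (intro card_mono) auto
  then show ?thesis
    using search_cost_le_rank_iff[OF assms order_refl] finite_unrequested(2)[of 0 b] by simp
qed

lemma requested_set_eq: "requested_set n B b = {1..n} - unrequested 0 b"
  by (auto simp: requested_set_def unrequested_def)

lemma search_cost_out_pos_iff:
  "0 < search_cost_out n \<pi> B b \<longleftrightarrow> next_requested n B b \<in> unrequested 0 b"
proof -
  have "0 < position i L" for i L by (simp add: position_def)
  then show ?thesis
    using next_requested_le[of b]
    by (auto simp: search_cost_out_def search_cost_eq requested_set_eq unrequested_def)
qed

end

section \<open>The conditional law of the request counts\<close>

text \<open>A Poisson law of rate \<open>0\<close> is the point mass at \<open>0\<close>; it belongs to an object of weight \<open>0\<close>.\<close>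

definition poi :: "real \<Rightarrow> nat pmf" where
  "poi r = (if r = 0 then return_pmf 0 else poisson_pmf r)"

lemma pmf_poi: "0 \<le> r \<Longrightarrow> pmf (poi r) k = poisson_prob r k"
  by (cases "r = 0") (auto simp: poi_def poisson_prob_def pmf_poisson indicator_def power_0_left)

lemma prob_poi_zero: "0 \<le> r \<Longrightarrow> measure_pmf.prob (poi r) {0} = exp (- r)"
  by (simp add: measure_pmf_single pmf_poi poisson_prob_def)

lemma prob_poi_nonzero: "0 \<le> r \<Longrightarrow> measure_pmf.prob (poi r) (- {0}) = 1 - exp (- r)"
  using measure_pmf.prob_compl[of "{0}" "poi r"] by (simp add: prob_poi_zero Compl_eq_Diff_UNIV)

locale request_model = random_weights +
  fixes A :: "'a \<Rightarrow> nat \<Rightarrow> real set"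
  assumes requests: "poisson_requests M n w A"
begin

abbreviation "hits \<omega> i a b \<equiv> card (A \<omega> i \<inter> {a..<b})"

lemma request_sets: "\<omega> \<in> space M \<Longrightarrow> request_sets n (A \<omega>)"
  using requests by (auto simp: request_sets_def poisson_requests_def)

lemma count_measurable: "i \<in> {1..n} \<Longrightarrow> (\<lambda>\<omega>. hits \<omega> i a b) \<in> measurable M (count_space UNIV)"
  using requests unfolding poisson_requests_def by blast

lemma count_eq_0_iff: "\<omega> \<in> space M \<Longrightarrow> i \<in> {1..n} \<Longrightarrow> hits \<omega> i a b = 0 \<longleftrightarrow> A \<omega> i \<inter> {a..<b} = {}"
  using request_sets.finite_B_window[OF request_sets] by simp

lemma sets_count [measurable]: "i \<in> {1..n} \<Longrightarrow> {\<omega>\<in>space M. hits \<omega> i a b \<in> C} \<in> sets M"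
  using measurable_sets[OF count_measurable, of i C a b] by (simp add: vimage_def Int_def conj_commute)

lemma sets_no_request [measurable]: "i \<in> {1..n} \<Longrightarrow> {\<omega>\<in>space M. A \<omega> i \<inter> {a..<b} = {}} \<in> sets M"
proof -
  assume i: "i \<in> {1..n}"
  have "{\<omega>\<in>space M. A \<omega> i \<inter> {a..<b} = {}} = {\<omega>\<in>space M. hits \<omega> i a b \<in> {0}}"
    using count_eq_0_iff[OF _ i] by auto
  then show ?thesis using sets_count[OF i, of a b "{0}"] by (simp only:)
qed

lemma sets_counts:
  "{\<omega>\<in>space M. \<forall>i\<in>{1..n}. \<forall>j<(m::nat). hits \<omega> i (a j) (b j) \<in> C i j} \<in> sets M"
proof -
  have "{\<omega>\<in>space M. \<forall>i\<in>{1..n}. \<forall>j\<in>{..<m}. hits \<omega> i (a j) (b j) \<in> C i j} \<in> sets M"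
    by (intro sets.sets_Collect_finite_All finite_atLeastAtMost finite_lessThan sets_count)
  then show ?thesis by (simp only: Ball_def lessThan_iff)
qed

lemma subalgebra_weight: "subalgebra M (weight_algebra M n w)"
proof -
  have f: "(\<lambda>\<omega>. \<lambda>i\<in>{1..n}. w \<omega> i) \<in> measurable M (\<Pi>\<^sub>M i\<in>{1..n}. borel)"
    using w_measurable by (intro measurable_restrict) auto
  show ?thesis
    unfolding subalgebra_def weight_algebra_def
    using measurable_sets[OF f] by (subst sets_vimage_algebra2[OF Pi_I[OF measurable_space[OF f]]]) auto
qed

lemma prob_counts_eq:
  assumes s: "0 \<le> s 0" "mono s"
  shows "prob {\<omega>\<in>space M. \<forall>i\<in>{1..n}. \<forall>j<m. hits \<omega> i (s j) (s (Suc j)) = k i j} =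
    (LINT \<omega>|M. (\<Prod>i\<in>{1..n}. \<Prod>j<m. poisson_prob (pop \<omega> i * (s (Suc j) - s j)) (k i j)))"
proof -
  define E where "E = {\<omega>\<in>space M. \<forall>i\<in>{1..n}. \<forall>j<m. hits \<omega> i (s j) (s (Suc j)) = k i j}"
  interpret W: finite_measure_subalgebra M "weight_algebra M n w"
    by unfold_locales (rule subalgebra_weight)
  have E: "E \<in> sets M"
    using sets_counts[of m s "\<lambda>j. s (Suc j)" "\<lambda>i j. {k i j}"] by (simp only: singleton_iff E_def)
  have "prob E = (LINT \<omega>|M. indicator E \<omega>)"
    using E by (simp add: sets.Int_space_eq2)
  also have "\<dots> = (LINT \<omega>|M. real_cond_exp M (weight_algebra M n w) (indicator E) \<omega>)"
    using E by (intro W.real_cond_exp_int(2)[symmetric]) (simp add: emeasure_eq_measure)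
  also have "\<dots> = (LINT \<omega>|M. (\<Prod>i\<in>{1..n}. \<Prod>j<m. poisson_prob (pop \<omega> i * (s (Suc j) - s j)) (k i j)))"
  proof (rule integral_cong_AE)
    show "AE \<omega> in M. real_cond_exp M (weight_algebra M n w) (indicator E) \<omega> =
       (\<Prod>i\<in>{1..n}. \<Prod>j<m. poisson_prob (pop \<omega> i * (s (Suc j) - s j)) (k i j))"
      using requests s unfolding poisson_requests_def E_def by blast
    show "(\<lambda>\<omega>. \<Prod>i\<in>{1..n}. \<Prod>j<m. poisson_prob (pop \<omega> i * (s (Suc j) - s j)) (k i j)) \<in> borel_measurable M"
      unfolding poisson_prob_def using pop_measurable
      by (intro borel_measurable_prod borel_measurable_times borel_measurable_divide
          borel_measurable_power borel_measurable_exp borel_measurable_uminus) auto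
  qed auto
  finally show ?thesis unfolding E_def .
qed

text \<open>The previous lemma gives the joint law of the counts, which is a mixture of products of Poisson
  laws; hence the probability of a product set is the mixture of the products.\<close>

lemma emeasure_counts:
  assumes s: "0 \<le> s 0" "mono s"
  shows "emeasure M {\<omega>\<in>space M. \<forall>i\<in>{1..n}. \<forall>j<m. hits \<omega> i (s j) (s (Suc j)) \<in> C i j} =
    (\<integral>\<^sup>+\<omega>. ennreal (\<Prod>i\<in>{1..n}. \<Prod>j<m. measure_pmf.prob (poi (pop \<omega> i * (s (Suc j) - s j))) (C i j)) \<partial>M)"
proof -
  let ?J = "{1..n} \<times> {..<m}"
  \<comment> \<open>The joint law of all counts, given the weights.\<close>
  define Q where "Q = (\<lambda>\<omega>. Pi_pmf ?J 0 (\<lambda>(i, j). poi (pop \<omega> i * (s (Suc j) - s j))))"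
  define \<Sigma> where "\<Sigma> = PiE_dflt ?J 0 (\<lambda>(i, j). C i j)"
  define E where "E = (\<lambda>k :: nat \<times> nat \<Rightarrow> nat.
    {\<omega>\<in>space M. \<forall>i\<in>{1..n}. \<forall>j<m. hits \<omega> i (s j) (s (Suc j)) = k (i, j)})"
  have len: "0 \<le> s (Suc j) - s j" for j using monoD[OF s(2), of j "Suc j"] by simp
  have "\<Sigma> \<subseteq> set_pmf (Pi_pmf ?J 0 (\<lambda>_. poisson_pmf 1))"
  proof
    fix k assume "k \<in> \<Sigma>"
    then have "\<forall>x. x \<notin> ?J \<longrightarrow> k x = 0" unfolding \<Sigma>_def PiE_dflt_def by blast
    then show "k \<in> set_pmf (Pi_pmf ?J 0 (\<lambda>_. poisson_pmf 1))"
      by (subst set_Pi_pmf) (simp_all add: PiE_dflt_def)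
  qed
  then have count: "countable \<Sigma>" by (rule countable_subset) simp
  have zero: "k x = 0" if "k \<in> \<Sigma>" "x \<notin> ?J" for k x
    using that unfolding \<Sigma>_def PiE_dflt_def by blast
  have E_sets: "E k \<in> sets M" for k
    using sets_counts[of m s "\<lambda>j. s (Suc j)" "\<lambda>i j. {k (i, j)}"] by (simp only: singleton_iff E_def)
  have pmfQ: "pmf (Q \<omega>) k = (\<Prod>i\<in>{1..n}. \<Prod>j<m. poisson_prob (pop \<omega> i * (s (Suc j) - s j)) (k (i, j)))"
    if "\<omega> \<in> space M" "k \<in> \<Sigma>" for \<omega> k
  proof -
    have "pmf (Q \<omega>) k = (\<Prod>x\<in>?J. pmf (case x of (i, j) \<Rightarrow> poi (pop \<omega> i * (s (Suc j) - s j))) (k x))"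
      unfolding Q_def by (intro pmf_Pi' zero[OF that(2)]) auto
    also have "\<dots> = (\<Prod>(i, j)\<in>?J. poisson_prob (pop \<omega> i * (s (Suc j) - s j)) (k (i, j)))"
      using pop_nonneg[OF _ that(1)] len by (intro prod.cong) (auto simp: pmf_poi)
    finally show ?thesis by (simp add: prod.cartesian_product)
  qed
  have poisson_meas: "(\<lambda>\<omega>. \<Prod>i\<in>{1..n}. \<Prod>j<m. poisson_prob (pop \<omega> i * (s (Suc j) - s j)) (k (i, j))) \<in> borel_measurable M"
    for k
    unfolding poisson_prob_def using pop_measurable
    by (intro borel_measurable_prod borel_measurable_times borel_measurable_divide
        borel_measurable_power borel_measurable_exp borel_measurable_uminus) auto
  have poisson_bounds: "0 \<le> poisson_prob r x \<and> poisson_prob r x \<le> 1" if "0 \<le> r" for r x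
    using pmf_nonneg[of "poi r" x] pmf_le_1[of "poi r" x] pmf_poi[OF that] by simp
  have emE: "emeasure M (E k) = (\<integral>\<^sup>+\<omega>. ennreal (pmf (Q \<omega>) k) \<partial>M)" if k: "k \<in> \<Sigma>" for k
  proof -
    let ?p = "\<lambda>\<omega>. \<Prod>i\<in>{1..n}. \<Prod>j<m. poisson_prob (pop \<omega> i * (s (Suc j) - s j)) (k (i, j))"
    have p01: "0 \<le> ?p \<omega> \<and> ?p \<omega> \<le> 1" if "\<omega> \<in> space M" for \<omega>
      using pmfQ[OF that k] pmf_nonneg[of "Q \<omega>" k] pmf_le_1[of "Q \<omega>" k] by simp
    have "prob (E k) = (LINT \<omega>|M. ?p \<omega>)"
      unfolding E_def by (rule prob_counts_eq[OF s, of m "\<lambda>i j. k (i, j)"])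
    then have "emeasure M (E k) = ennreal (LINT \<omega>|M. ?p \<omega>)"
      by (simp add: emeasure_eq_measure)
    also have "\<dots> = (\<integral>\<^sup>+\<omega>. ennreal (?p \<omega>) \<partial>M)"
    proof (rule nn_integral_eq_integral[symmetric])
      show "integrable M ?p"
        by (rule integrable_const_bound[where B = 1]) (use p01 poisson_meas in auto)
    qed (use p01 in auto)
    also have "\<dots> = (\<integral>\<^sup>+\<omega>. ennreal (pmf (Q \<omega>) k) \<partial>M)"
      by (intro nn_integral_cong) (simp add: pmfQ k)
    finally show ?thesis .
  qed
  have pmf_meas: "(\<lambda>\<omega>. ennreal (pmf (Q \<omega>) k)) \<in> borel_measurable M" if "k \<in> \<Sigma>" for k
    using measurable_compose[OF poisson_meas[of k] measurable_ennreal]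
    by (rule measurable_cong[THEN iffD1, rotated]) (simp add: pmfQ that)
  have "{\<omega>\<in>space M. \<forall>i\<in>{1..n}. \<forall>j<m. hits \<omega> i (s j) (s (Suc j)) \<in> C i j} = (\<Union>k\<in>\<Sigma>. E k)"
  proof (intro equalityI subsetI)
    fix \<omega> assume \<omega>: "\<omega> \<in> {\<omega>\<in>space M. \<forall>i\<in>{1..n}. \<forall>j<m. hits \<omega> i (s j) (s (Suc j)) \<in> C i j}"
    let ?k = "\<lambda>(i, j). if (i, j) \<in> ?J then hits \<omega> i (s j) (s (Suc j)) else 0"
    have "?k \<in> \<Sigma>" using \<omega> by (auto simp: \<Sigma>_def PiE_dflt_def)
    moreover have "\<omega> \<in> E ?k" using \<omega> by (auto simp: E_def)
    ultimately show "\<omega> \<in> (\<Union>k\<in>\<Sigma>. E k)" by blast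
  next
    fix \<omega> assume "\<omega> \<in> (\<Union>k\<in>\<Sigma>. E k)"
    then obtain k where k: "k \<in> \<Sigma>" "\<omega> \<in> E k" by blast
    then have "k (i, j) \<in> C i j" if "i \<in> {1..n}" "j < m" for i j
      using that unfolding \<Sigma>_def PiE_dflt_def by auto
    with k(2) show "\<omega> \<in> {\<omega>\<in>space M. \<forall>i\<in>{1..n}. \<forall>j<m. hits \<omega> i (s j) (s (Suc j)) \<in> C i j}"
      unfolding E_def by auto
  qed
  then have "emeasure M {\<omega>\<in>space M. \<forall>i\<in>{1..n}. \<forall>j<m. hits \<omega> i (s j) (s (Suc j)) \<in> C i j} =
      (\<integral>\<^sup>+k. emeasure M (E k) \<partial>count_space \<Sigma>)"
  proof (simp only:, intro emeasure_UN_countable count E_sets)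
    show "disjoint_family_on E \<Sigma>"
      unfolding disjoint_family_on_def
    proof (intro ballI impI, rule ccontr)
      fix k l assume "k \<in> \<Sigma>" "l \<in> \<Sigma>" "k \<noteq> l" "E k \<inter> E l \<noteq> {}"
      then obtain \<omega> where "\<omega> \<in> E k" "\<omega> \<in> E l" by auto
      have "k x = l x" for x
      proof (cases "x \<in> ?J")
        case True
        then obtain i j where "x = (i, j)" "i \<in> {1..n}" "j < m" by auto
        then show ?thesis using \<open>\<omega> \<in> E k\<close> \<open>\<omega> \<in> E l\<close> unfolding E_def by force
      next
        case False
        then show ?thesis using zero[OF \<open>k \<in> \<Sigma>\<close> False] zero[OF \<open>l \<in> \<Sigma>\<close> False] by simp
      qed
      then show False using \<open>k \<noteq> l\<close> by auto
    qed
  qed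
  also have "\<dots> = (\<integral>\<^sup>+k. \<integral>\<^sup>+\<omega>. ennreal (pmf (Q \<omega>) k) \<partial>M \<partial>count_space \<Sigma>)"
    by (intro nn_integral_cong) (simp add: emE)
  also have "\<dots> = (\<integral>\<^sup>+\<omega>. \<integral>\<^sup>+k. ennreal (pmf (Q \<omega>) k) \<partial>count_space \<Sigma> \<partial>M)"
    by (rule nn_integral_count_space_nn_integral[OF count pmf_meas, symmetric])
  also have "\<dots> = (\<integral>\<^sup>+\<omega>. ennreal (\<Prod>i\<in>{1..n}. \<Prod>j<m. measure_pmf.prob (poi (pop \<omega> i * (s (Suc j) - s j))) (C i j)) \<partial>M)"
  proof (intro nn_integral_cong)
    fix \<omega> assume "\<omega> \<in> space M"
    have "(\<integral>\<^sup>+k. ennreal (pmf (Q \<omega>) k) \<partial>count_space \<Sigma>) = emeasure (measure_pmf (Q \<omega>)) \<Sigma>"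
      by (rule nn_integral_pmf)
    also have "\<dots> = ennreal (\<Prod>x\<in>?J. measure_pmf.prob (case x of (i, j) \<Rightarrow> poi (pop \<omega> i * (s (Suc j) - s j))) (case x of (i, j) \<Rightarrow> C i j))"
      unfolding Q_def \<Sigma>_def by (simp add: measure_pmf.emeasure_eq_measure measure_Pi_pmf_PiE_dflt)
    also have "(\<Prod>x\<in>?J. measure_pmf.prob (case x of (i, j) \<Rightarrow> poi (pop \<omega> i * (s (Suc j) - s j))) (case x of (i, j) \<Rightarrow> C i j))
      = (\<Prod>i\<in>{1..n}. \<Prod>j<m. measure_pmf.prob (poi (pop \<omega> i * (s (Suc j) - s j))) (C i j))"
      by (subst prod.cartesian_product) (auto intro!: prod.cong)
    finally show "(\<integral>\<^sup>+k. ennreal (pmf (Q \<omega>) k) \<partial>count_space \<Sigma>) =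
        ennreal (\<Prod>i\<in>{1..n}. \<Prod>j<m. measure_pmf.prob (poi (pop \<omega> i * (s (Suc j) - s j))) (C i j))" .
  qed
  finally show ?thesis .
qed

lemma emeasure_counts_window:
  assumes ab: "0 \<le> a" "a \<le> b"
  shows "emeasure M {\<omega>\<in>space M. \<forall>i\<in>{1..n}. hits \<omega> i a b \<in> C i} =
    (\<integral>\<^sup>+\<omega>. ennreal (\<Prod>i\<in>{1..n}. measure_pmf.prob (poi (pop \<omega> i * (b - a))) (C i)) \<partial>M)"
proof -
  define s where "s j = (if j = 0 then a else b)" for j :: nat
  have "mono s" using ab by (auto simp: s_def mono_def)
  from emeasure_counts[OF _ this, of 1 "\<lambda>i j. C i"] show ?thesis
    using ab by (simp add: s_def)
qed

abbreviation "q \<tau> \<omega> i \<equiv> exp (- (pop \<omega> i * \<tau>))"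

lemma q_measurable: "i \<in> {1..n} \<Longrightarrow> (\<lambda>\<omega>. q \<tau> \<omega> i) \<in> borel_measurable M"
  using pop_measurable[of i] by simp

lemma q_bounds: "0 \<le> \<tau> \<Longrightarrow> i \<in> {1..n} \<Longrightarrow> \<omega> \<in> space M \<Longrightarrow> q \<tau> \<omega> i \<le> 1"
  using pop_nonneg[of i \<omega>] by simp

lemma prod_q_bounds:
  assumes "0 \<le> \<tau>" "H \<subseteq> {1..n}" "\<omega> \<in> space M"
  shows "0 \<le> (\<Prod>i\<in>H. q \<tau> \<omega> i)" "(\<Prod>i\<in>H. q \<tau> \<omega> i) \<le> 1"
proof -
  show "0 \<le> (\<Prod>i\<in>H. q \<tau> \<omega> i)" by (intro prod_nonneg) auto
  show "(\<Prod>i\<in>H. q \<tau> \<omega> i) \<le> 1" by (intro prod_le_1) (use assms q_bounds in auto)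
qed

lemma prob_no_requests:
  assumes ab: "0 \<le> a" "a \<le> b" and H: "H \<subseteq> {1..n}"
  shows "prob {\<omega>\<in>space M. \<forall>i\<in>H. A \<omega> i \<inter> {a..<b} = {}} = (LINT \<omega>|M. (\<Prod>i\<in>H. q (b - a) \<omega> i))"
proof -
  let ?C = "\<lambda>i. if i \<in> H then {0} else UNIV"
  have "hits \<omega> i a b \<in> ?C i \<longleftrightarrow> (i \<in> H \<longrightarrow> A \<omega> i \<inter> {a..<b} = {})"
    if "\<omega> \<in> space M" "i \<in> {1..n}" for \<omega> i
    using count_eq_0_iff[OF that, of a b] by (simp only: split: if_splits) simp
  then have "{\<omega>\<in>space M. \<forall>i\<in>H. A \<omega> i \<inter> {a..<b} = {}} = {\<omega>\<in>space M. \<forall>i\<in>{1..n}. hits \<omega> i a b \<in> ?C i}"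
    using H by blast
  then have "ennreal (prob {\<omega>\<in>space M. \<forall>i\<in>H. A \<omega> i \<inter> {a..<b} = {}}) =
      (\<integral>\<^sup>+\<omega>. ennreal (\<Prod>i\<in>{1..n}. measure_pmf.prob (poi (pop \<omega> i * (b - a))) (?C i)) \<partial>M)"
    by (simp only: emeasure_eq_measure[symmetric] emeasure_counts_window[OF ab])
  also have "\<dots> = (\<integral>\<^sup>+\<omega>. ennreal (\<Prod>i\<in>H. q (b - a) \<omega> i) \<partial>M)"
  proof (intro nn_integral_cong arg_cong[where f = ennreal])
    fix \<omega> assume \<omega>: "\<omega> \<in> space M"
    have "(\<Prod>i\<in>{1..n}. measure_pmf.prob (poi (pop \<omega> i * (b - a))) (?C i))
        = (\<Prod>i\<in>{1..n}. if i \<in> H then q (b - a) \<omega> i else 1)"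
      using pop_nonneg[OF _ \<omega>] ab by (intro prod.cong) (auto simp: prob_poi_zero)
    also have "\<dots> = (\<Prod>i\<in>H. q (b - a) \<omega> i)"
      using H by (simp add: prod.inter_restrict[symmetric] Int_absorb1)
    finally show "(\<Prod>i\<in>{1..n}. measure_pmf.prob (poi (pop \<omega> i * (b - a))) (?C i)) = (\<Prod>i\<in>H. q (b - a) \<omega> i)" .
  qed
  also have "\<dots> = ennreal (LINT \<omega>|M. (\<Prod>i\<in>H. q (b - a) \<omega> i))"
  proof (rule nn_integral_eq_integral)
    show "integrable M (\<lambda>\<omega>. \<Prod>i\<in>H. q (b - a) \<omega> i)"
      by (rule integrable_const_bound[where B = 1])
         (use prod_q_bounds[OF _ H] ab H q_measurable in \<open>auto intro!: borel_measurable_prod AE_I2\<close>)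
  qed (use prod_q_bounds[OF _ H] ab in auto)
  finally show ?thesis
    by (subst (asm) ennreal_inj) (use prod_q_bounds(1)[OF _ H] ab in \<open>auto intro!: integral_nonneg_AE\<close>)
qed

text \<open>A popularity is at most \<open>1\<close>, so each of the two objects is requested with conditional probability at
  most \<open>b - a\<close>.\<close>

lemma prob_two_in_window_le:
  assumes ab: "0 \<le> a" "a \<le> b" and il: "i \<in> {1..n}" "l \<in> {1..n}" "i \<noteq> l"
  shows "prob {\<omega>\<in>space M. A \<omega> i \<inter> {a..<b} \<noteq> {} \<and> A \<omega> l \<inter> {a..<b} \<noteq> {}} \<le> (b - a)\<^sup>2"
proof -
  let ?C = "\<lambda>j. if j = i \<or> j = l then - {0} else UNIV"
  have "hits \<omega> j a b \<in> ?C j \<longleftrightarrow> (j = i \<or> j = l \<longrightarrow> A \<omega> j \<inter> {a..<b} \<noteq> {})"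
    if "\<omega> \<in> space M" "j \<in> {1..n}" for \<omega> j
    using count_eq_0_iff[OF that, of a b] by (simp only: split: if_splits) simp
  then have "{\<omega>\<in>space M. A \<omega> i \<inter> {a..<b} \<noteq> {} \<and> A \<omega> l \<inter> {a..<b} \<noteq> {}} = {\<omega>\<in>space M. \<forall>j\<in>{1..n}. hits \<omega> j a b \<in> ?C j}"
    using il by blast
  then have "ennreal (prob {\<omega>\<in>space M. A \<omega> i \<inter> {a..<b} \<noteq> {} \<and> A \<omega> l \<inter> {a..<b} \<noteq> {}}) =
      (\<integral>\<^sup>+\<omega>. ennreal (\<Prod>j\<in>{1..n}. measure_pmf.prob (poi (pop \<omega> j * (b - a))) (?C j)) \<partial>M)"
    by (simp only: emeasure_eq_measure[symmetric] emeasure_counts_window[OF ab])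
  also have "\<dots> \<le> (\<integral>\<^sup>+\<omega>. ennreal ((b - a)\<^sup>2) \<partial>M)"
  proof (intro nn_integral_mono ennreal_leI)
    fix \<omega> assume \<omega>: "\<omega> \<in> space M"
    have le: "measure_pmf.prob (poi (pop \<omega> j * (b - a))) (- {0}) \<le> b - a" if j: "j \<in> {1..n}" for j
    proof -
      have r: "0 \<le> pop \<omega> j * (b - a)" using pop_nonneg[OF j \<omega>] ab by simp
      have "1 - exp (- (pop \<omega> j * (b - a))) \<le> pop \<omega> j * (b - a)"
        using exp_ge_add_one_self[of "- (pop \<omega> j * (b - a))"] by simp
      also have "\<dots> \<le> 1 * (b - a)" using pop_le_1[OF j \<omega>] ab by (intro mult_right_mono) auto
      finally show ?thesis using prob_poi_nonzero[OF r] by simp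
    qed
    have "(\<Prod>j\<in>{1..n}. measure_pmf.prob (poi (pop \<omega> j * (b - a))) (?C j))
        = (\<Prod>j\<in>{i, l}. measure_pmf.prob (poi (pop \<omega> j * (b - a))) (- {0}))"
      by (rule prod.mono_neutral_cong_right) (use il in auto)
    also have "\<dots> \<le> (b - a) * (b - a)"
      using il le ab by (auto intro!: mult_mono)
    finally show "(\<Prod>j\<in>{1..n}. measure_pmf.prob (poi (pop \<omega> j * (b - a))) (?C j)) \<le> (b - a)\<^sup>2"
      by (simp add: power2_eq_square)
  qed
  also have "\<dots> = ennreal ((b - a)\<^sup>2)" by (simp add: emeasure_space_1)
  finally show ?thesis by (simp add: ennreal_le_iff)
qed

end

lemma prod_add_Pow_if:
  fixes f g :: "'b \<Rightarrow> 'c :: comm_semiring_1"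
  assumes "finite A"
  shows "(\<Sum>X\<in>Pow A. \<Prod>l\<in>A. if l \<in> X then f l else g l) = (\<Prod>l\<in>A. f l + g l)"
proof -
  have "(\<Prod>l\<in>A. if l \<in> X then f l else g l) = prod f X * prod g (A - X)" if "X \<in> Pow A" for X
    using that assms by (simp add: prod.If_cases Int_absorb1 Diff_eq)
  then show ?thesis using prod_add[OF assms, of f g] by simp
qed

text \<open>Replacing \<open>g i\<close> by \<open>0\<close> kills the terms with \<open>i \<notin> X\<close>.\<close>

lemma sum_Pow_if_containing:
  fixes f g :: "'b \<Rightarrow> 'c :: comm_semiring_1"
  assumes "finite A" "i \<in> A"
  shows "(\<Sum>X | X \<subseteq> A \<and> i \<in> X. \<Prod>l\<in>A. if l \<in> X then f l else g l) = f i * (\<Prod>l\<in>A - {i}. f l + g l)"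
proof -
  let ?g = "g(i := 0)"
  have "(\<Sum>X | X \<subseteq> A \<and> i \<in> X. \<Prod>l\<in>A. if l \<in> X then f l else g l)
      = (\<Sum>X\<in>Pow A. \<Prod>l\<in>A. if l \<in> X then f l else ?g l)"
  proof (rule sum.mono_neutral_cong_left)
    show "\<forall>X\<in>Pow A - {X. X \<subseteq> A \<and> i \<in> X}. (\<Prod>l\<in>A. if l \<in> X then f l else ?g l) = 0"
      using assms by (auto intro!: prod_zero)
  qed (use assms in \<open>auto intro!: prod.cong\<close>)
  also have "\<dots> = (\<Prod>l\<in>A. f l + ?g l)" by (rule prod_add_Pow_if[OF assms(1)])
  also have "\<dots> = f i * (\<Prod>l\<in>A - {i}. f l + g l)"
    using assms by (simp add: prod.remove[of A i])
  finally show ?thesis .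
qed

context request_model
begin

section \<open>Measurability of the search cost\<close>

lemma sets_next_requested: "{\<omega>\<in>space M. next_requested n (A \<omega>) t = i} \<in> sets M"
proof -
  have pos: "{\<omega>\<in>space M. next_requested n (A \<omega>) t = i} \<in> sets M" if i: "i \<in> {1..n}" for i
  proof -
    have ne: "{\<omega>\<in>space M. A \<omega> l \<inter> {t..<q} \<noteq> {}} \<in> sets M" if "l \<in> {1..n}" for l q
      by (rule sets.sets_Collect_neg[OF sets_no_request[OF that]])
    have "{\<omega>\<in>space M. next_requested n (A \<omega>) t = i} = {\<omega>\<in>space M.
        (\<exists>q\<in>\<rat>. A \<omega> i \<inter> {t..<q} \<noteq> {}) \<and>
        (\<forall>l\<in>{1..n}. l < i \<longrightarrow> (\<exists>q\<in>\<rat>. A \<omega> i \<inter> {t..<q} \<noteq> {} \<and> A \<omega> l \<inter> {t..<q} = {})) \<and>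
        (\<forall>l\<in>{1..n}. i < l \<longrightarrow> (\<forall>q\<in>\<rat>. A \<omega> l \<inter> {t..<q} \<noteq> {} \<longrightarrow> A \<omega> i \<inter> {t..<q} \<noteq> {}))}"
      by (intro Collect_cong conj_cong refl request_sets.next_requested_eq_iff[OF request_sets i])
    also have "\<dots> \<in> sets M"
      by (intro sets.sets_Collect_conj sets.sets_Collect_imp sets.sets_Collect_const
          sets.sets_Collect_finite_All sets.sets_Collect_countable_Ex' sets.sets_Collect_countable_All'
          ne sets_no_request countable_rat finite_atLeastAtMost i) auto
    finally show ?thesis .
  qed
  consider "i \<in> {1..n}" | "n < i" | "i = 0" by fastforce
  then show ?thesis
  proof cases
    case 2
    then have "{\<omega>\<in>space M. next_requested n (A \<omega>) t = i} = {}"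
      using request_sets.next_requested_le[OF request_sets] by (auto simp: not_le[symmetric])
    then show ?thesis by (simp only: sets.empty_sets)
  next
    case 3
    have "{\<omega>\<in>space M. next_requested n (A \<omega>) t = i} = space M - (\<Union>i\<in>{1..n}. {\<omega>\<in>space M. next_requested n (A \<omega>) t = i})"
    proof (intro equalityI subsetI)
      fix \<omega> assume \<omega>: "\<omega> \<in> space M - (\<Union>i\<in>{1..n}. {\<omega>\<in>space M. next_requested n (A \<omega>) t = i})"
      then have "next_requested n (A \<omega>) t \<notin> {1..n}" by blast
      then show "\<omega> \<in> {\<omega>\<in>space M. next_requested n (A \<omega>) t = i}"
        using request_sets.next_requested_le[OF request_sets, of \<omega> t] \<omega> 3 by auto
    qed (use 3 in auto)
    then show ?thesis using pos by (simp only:) (intro sets.Diff sets.top sets.finite_UN, auto)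
  qed (rule pos)
qed

lemma next_requested_measurable: "(\<lambda>\<omega>. next_requested n (A \<omega>) t) \<in> measurable M (count_space UNIV)"
  by (rule measurable_count_space_eq2_countable[THEN iffD2])
     (use sets_next_requested in \<open>auto simp: vimage_def Int_def conj_commute\<close>)

text \<open>When the cells of a grid are so short that each contains at most one request instant, the list
  is determined by the labels of the objects that are requested in each of the cells.\<close>

definition cell_label :: "'a \<Rightarrow> real \<Rightarrow> real \<Rightarrow> nat" where
  "cell_label \<omega> a b = (if \<exists>i\<in>{1..n}. A \<omega> i \<inter> {a..<b} \<noteq> {} then LEAST i. i \<in> {1..n} \<and> A \<omega> i \<inter> {a..<b} \<noteq> {} else 0)"

definition grid_list :: "(nat \<Rightarrow> nat) \<Rightarrow> real \<Rightarrow> nat \<Rightarrow> 'a \<Rightarrow> nat list" where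
  "grid_list \<pi> h k \<omega> = fold (\<lambda>j L. if cell_label \<omega> (real j * h) (real (Suc j) * h) = 0 then L
     else move_to_front (cell_label \<omega> (real j * h) (real (Suc j) * h)) L) [0..<k] (initial_list n \<pi>)"

lemma sets_cell_label: "{\<omega>\<in>space M. cell_label \<omega> a b = i} \<in> sets M"
proof -
  have ne: "{\<omega>\<in>space M. A \<omega> l \<inter> {a..<b} \<noteq> {}} \<in> sets M" if "l \<in> {1..n}" for l
    by (rule sets.sets_Collect_neg[OF sets_no_request[OF that]])
  have char: "cell_label \<omega> a b = i \<longleftrightarrow>
     (if i \<in> {1..n} then A \<omega> i \<inter> {a..<b} \<noteq> {} \<and> (\<forall>l\<in>{1..n}. l < i \<longrightarrow> A \<omega> l \<inter> {a..<b} = {})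
      else i = 0 \<and> (\<forall>l\<in>{1..n}. A \<omega> l \<inter> {a..<b} = {}))" for \<omega>
  proof (cases "\<exists>i\<in>{1..n}. A \<omega> i \<inter> {a..<b} \<noteq> {}")
    case True
    let ?P = "\<lambda>i. i \<in> {1..n} \<and> A \<omega> i \<inter> {a..<b} \<noteq> {}"
    have c: "cell_label \<omega> a b = Least ?P" unfolding cell_label_def using True by (simp only: if_True)
    obtain j where "?P j" using True by blast
    then have P: "?P (Least ?P)" by (rule LeastI)
    have eq: "Least ?P = i \<longleftrightarrow> ?P i \<and> (\<forall>l. l < i \<longrightarrow> \<not> ?P l)"
    proof
      assume "Least ?P = i" then show "?P i \<and> (\<forall>l. l < i \<longrightarrow> \<not> ?P l)" using P not_less_Least by blast
    next
      assume *: "?P i \<and> (\<forall>l. l < i \<longrightarrow> \<not> ?P l)"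
      show "Least ?P = i"
        by (rule Least_equality) (use * in \<open>auto simp: not_le[symmetric]\<close>)
    qed
    show ?thesis
    proof (cases "i \<in> {1..n}")
      case i: True
      show ?thesis unfolding c eq if_P[OF i] using i by blast
    next
      case i: False
      show ?thesis unfolding c eq if_not_P[OF i] using i True by blast
    qed
  next
    case False
    then show ?thesis by (auto simp: cell_label_def)
  qed
  show ?thesis
  proof (cases "i \<in> {1..n}")
    case True
    have "{\<omega>\<in>space M. cell_label \<omega> a b = i} =
      {\<omega>\<in>space M. A \<omega> i \<inter> {a..<b} \<noteq> {} \<and> (\<forall>l\<in>{1..n}. l < i \<longrightarrow> A \<omega> l \<inter> {a..<b} = {})}"
      using True by (simp only: char if_True)
    also have "\<dots> \<in> sets M"
      by (intro sets.sets_Collect_conj sets.sets_Collect_imp sets.sets_Collect_const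
          sets.sets_Collect_finite_All ne sets_no_request finite_atLeastAtMost True)
    finally show ?thesis .
  next
    case False
    have "{\<omega>\<in>space M. cell_label \<omega> a b = i} =
      {\<omega>\<in>space M. i = 0 \<and> (\<forall>l\<in>{1..n}. A \<omega> l \<inter> {a..<b} = {})}"
      using False by (simp only: char if_False)
    also have "\<dots> \<in> sets M"
      by (intro sets.sets_Collect_conj sets.sets_Collect_const
          sets.sets_Collect_finite_All sets_no_request finite_atLeastAtMost)
    finally show ?thesis .
  qed
qed

lemma cell_label_measurable: "(\<lambda>\<omega>. cell_label \<omega> a b) \<in> measurable M (count_space UNIV)"
  by (rule measurable_count_space_eq2_countable[THEN iffD2])
     (use sets_cell_label in \<open>auto simp: vimage_def Int_def conj_commute\<close>)

lemma grid_list_measurable: "grid_list \<pi> h k \<in> measurable M (count_space UNIV)"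
proof (induction k)
  case 0
  then show ?case by (simp add: grid_list_def)
next
  case (Suc k)
  have eq: "grid_list \<pi> h (Suc k) = (\<lambda>\<omega>. (\<lambda>(l, L). if l = 0 then L else move_to_front l L)
     (cell_label \<omega> (real k * h) (real (Suc k) * h), grid_list \<pi> h k \<omega>))"
    by (auto simp: grid_list_def)
  have "(\<lambda>\<omega>. (cell_label \<omega> (real k * h) (real (Suc k) * h), grid_list \<pi> h k \<omega>))
      \<in> measurable M (count_space UNIV \<Otimes>\<^sub>M count_space UNIV)"
    using Suc cell_label_measurable by (intro measurable_Pair) auto
  then have "(\<lambda>\<omega>. (cell_label \<omega> (real k * h) (real (Suc k) * h), grid_list \<pi> h k \<omega>)) \<in> measurable M (count_space UNIV)"
    by (simp add: pair_measure_countable)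
  then show ?case unfolding eq by (rule measurable_compose) simp
qed

text \<open>Induction over the cells: an empty cell changes nothing, and a cell with a single request instant
  moves the object with its label.\<close>

lemma grid_list_eq_list_at:
  assumes \<omega>: "\<omega> \<in> space M" and h: "0 < h"
    and sep: "\<And>x y. x \<in> request_instants n (A \<omega>) \<Longrightarrow> y \<in> request_instants n (A \<omega>) \<Longrightarrow>
      x < real m * h \<Longrightarrow> y < real m * h \<Longrightarrow> x \<noteq> y \<Longrightarrow> h \<le> \<bar>x - y\<bar>"
  shows "k \<le> m \<Longrightarrow> grid_list \<pi> h k \<omega> = list_at n \<pi> (A \<omega>) (real k * h)"
proof (induction k)
  case 0
  then show ?case using request_sets.list_at_0[OF request_sets[OF \<omega>]] by (simp add: grid_list_def)
next
  case (Suc k)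
  interpret request_sets n "A \<omega>" by (rule request_sets[OF \<omega>])
  let ?a = "real k * h" and ?b = "real (Suc k) * h"
  have ab: "?a \<le> ?b" using h by (simp add: mult_right_mono)
  have bm: "?b \<le> real m * h" using Suc.prems h by (intro mult_right_mono) auto
  have step: "list_at n \<pi> (A \<omega>) ?b = (if cell_label \<omega> ?a ?b = 0 then list_at n \<pi> (A \<omega>) ?a
     else move_to_front (cell_label \<omega> ?a ?b) (list_at n \<pi> (A \<omega>) ?a))"
  proof (cases "R \<inter> {?a..<?b} = {}")
    case True
    then have "A \<omega> i \<inter> {?a..<?b} = {}" if "i \<in> {1..n}" for i
      using that unfolding request_instants_def by blast
    then have "cell_label \<omega> ?a ?b = 0" by (simp add: cell_label_def)
    then show ?thesis unfolding list_at_split[OF ab] True by simp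
  next
    case False
    then obtain s where s: "s \<in> R" "s \<in> {?a..<?b}" by blast
    have single: "R \<inter> {?a..<?b} = {s}"
    proof (rule ccontr)
      assume "R \<inter> {?a..<?b} \<noteq> {s}"
      then obtain y where y: "y \<in> R" "y \<in> {?a..<?b}" "y \<noteq> s" using s by blast
      then have "h \<le> \<bar>y - s\<bar>" using sep[of y s] s bm by auto
      moreover have "?b - ?a = h" by (simp add: algebra_simps)
      ultimately show False using y(2) s(2) by (auto simp: abs_if split: if_splits)
    qed
    have iff: "A \<omega> i \<inter> {?a..<?b} \<noteq> {} \<longleftrightarrow> s \<in> A \<omega> i" if "i \<in> {1..n}" for i
    proof
      assume "A \<omega> i \<inter> {?a..<?b} \<noteq> {}"
      then obtain y where y: "y \<in> A \<omega> i" "y \<in> {?a..<?b}" by blast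
      then have "y \<in> R \<inter> {?a..<?b}" using that unfolding request_instants_def by blast
      then show "s \<in> A \<omega> i" using single y by auto
    qed (use s in blast)
    have "(\<lambda>i. i \<in> {1..n} \<and> A \<omega> i \<inter> {?a..<?b} \<noteq> {}) = (\<lambda>i. i \<in> {1..n} \<and> s \<in> A \<omega> i)"
      by (intro ext conj_cong refl iff)
    moreover have "\<exists>i\<in>{1..n}. A \<omega> i \<inter> {?a..<?b} \<noteq> {}"
      using iff[OF requested_at_props(1)[OF s(1)]] requested_at_props(1,2)[OF s(1)] by (intro bexI) simp_all
    ultimately have "cell_label \<omega> ?a ?b = requested_at n (A \<omega>) s"
      unfolding cell_label_def requested_at_def by (simp only: if_True)
    moreover have "requested_at n (A \<omega>) s \<noteq> 0" using requested_at_props(1)[OF s(1)] by auto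
    ultimately show ?thesis unfolding list_at_split[OF ab] single by simp
  qed
  have "grid_list \<pi> h (Suc k) \<omega> = (if cell_label \<omega> ?a ?b = 0 then grid_list \<pi> h k \<omega>
     else move_to_front (cell_label \<omega> ?a ?b) (grid_list \<pi> h k \<omega>))"
    by (simp add: grid_list_def)
  then show ?case using Suc step by simp
qed

lemma grid_list_eventually:
  assumes \<omega>: "\<omega> \<in> space M" and t: "0 < t"
  shows "\<forall>\<^sub>F m in sequentially. grid_list \<pi> (t / real m) m \<omega> = list_at n \<pi> (A \<omega>) t"
proof -
  interpret request_sets n "A \<omega>" by (rule request_sets[OF \<omega>])
  let ?F = "R \<inter> {..<t}"
  let ?D = "insert 1 ((\<lambda>(x, y). \<bar>x - y\<bar>) ` (?F \<times> ?F) - {0})"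
  have fin: "finite ?D" using finite_before[of t] by auto
  \<comment> \<open>The smallest distance of two request instants before \<open>t\<close>; the element \<open>1\<close> is there in case that there
    are fewer than two.\<close>
  define d where "d = Min ?D"
  have d: "0 < d" unfolding d_def using fin by (subst Min_gr_iff) auto
  have le: "d \<le> \<bar>x - y\<bar>" if "x \<in> ?F" "y \<in> ?F" "x \<noteq> y" for x y
    unfolding d_def using that by (intro Min_le[OF fin]) (auto intro!: image_eqI[of _ _ "(x, y)"])
  have "\<forall>\<^sub>F m in sequentially. t / d < real m"
    using filterlim_real_sequentially by (simp add: filterlim_at_top_dense)
  then show ?thesis
  proof eventually_elim
    case (elim m)
    have "0 < t / d" using t d by simp
    then have m: "0 < real m" using elim by linarith
    have h: "t / real m < d" using elim d m by (simp add: field_simps)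
    have mt: "real m * (t / real m) = t" using m by simp
    have "grid_list \<pi> (t / real m) m \<omega> = list_at n \<pi> (A \<omega>) (real m * (t / real m))"
    proof (rule grid_list_eq_list_at[OF \<omega>])
      show "0 < t / real m" using t m by simp
      fix x y assume "x \<in> R" "y \<in> R" "x < real m * (t / real m)" "y < real m * (t / real m)" "x \<noteq> y"
      then show "t / real m \<le> \<bar>x - y\<bar>" using le[of x y] h unfolding mt by auto
    qed simp
    then show ?case unfolding mt .
  qed
qed

lemma list_at_measurable:
  assumes t: "0 < t"
  shows "(\<lambda>\<omega>. list_at n \<pi> (A \<omega>) t) \<in> measurable M (count_space UNIV)"
proof (rule measurable_count_space_eq2_countable[THEN iffD2], intro conjI ballI)
  fix L
  have "(\<lambda>\<omega>. list_at n \<pi> (A \<omega>) t) -` {L} \<inter> space M =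
      {\<omega>\<in>space M. \<exists>m0. \<forall>m\<in>{m0..}. grid_list \<pi> (t / real m) m \<omega> = L}"
  proof (intro equalityI subsetI)
    fix \<omega> assume "\<omega> \<in> (\<lambda>\<omega>. list_at n \<pi> (A \<omega>) t) -` {L} \<inter> space M"
    then show "\<omega> \<in> {\<omega>\<in>space M. \<exists>m0. \<forall>m\<in>{m0..}. grid_list \<pi> (t / real m) m \<omega> = L}"
      using grid_list_eventually[of \<omega> t \<pi>] t by (auto simp: eventually_sequentially)
  next
    fix \<omega> assume \<omega>: "\<omega> \<in> {\<omega>\<in>space M. \<exists>m0. \<forall>m\<in>{m0..}. grid_list \<pi> (t / real m) m \<omega> = L}"
    then obtain m0 where "\<forall>m\<ge>m0. grid_list \<pi> (t / real m) m \<omega> = L" by auto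
    then have "\<forall>\<^sub>F m in sequentially. grid_list \<pi> (t / real m) m \<omega> = L"
      unfolding eventually_sequentially by blast
    moreover have "\<forall>\<^sub>F m in sequentially. grid_list \<pi> (t / real m) m \<omega> = list_at n \<pi> (A \<omega>) t"
      using \<omega> t by (intro grid_list_eventually) auto
    ultimately have "\<forall>\<^sub>F m in sequentially. list_at n \<pi> (A \<omega>) t = L"
      by eventually_elim simp
    then show "\<omega> \<in> (\<lambda>\<omega>. list_at n \<pi> (A \<omega>) t) -` {L} \<inter> space M" using \<omega> by simp
  qed
  also have "\<dots> \<in> sets M"
  proof (intro sets.sets_Collect_countable_Ex sets.sets_Collect_countable_All')
    show "{\<omega>\<in>space M. grid_list \<pi> (t / real m) m \<omega> = L} \<in> sets M" for m
      using measurable_sets[OF grid_list_measurable, of "{L}" \<pi> "t / real m" m]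
      by (simp add: vimage_def Int_def conj_commute)
  qed auto
  finally show "(\<lambda>\<omega>. list_at n \<pi> (A \<omega>) t) -` {L} \<inter> space M \<in> sets M" .
qed auto

lemma search_cost_measurable:
  assumes t: "0 < t"
  shows "(\<lambda>\<omega>. real (search_cost n \<pi> (A \<omega>) t)) \<in> borel_measurable M"
proof -
  have 1: "(\<lambda>\<omega>. real (position i (list_at n \<pi> (A \<omega>) t))) \<in> borel_measurable M" for i
    by (rule measurable_compose[OF list_at_measurable[OF t]]) simp
  have 2: "(\<lambda>\<omega>. of_bool (next_requested n (A \<omega>) t = i) :: real) \<in> borel_measurable M" for i
    by (rule measurable_compose[OF next_requested_measurable]) simp
  have "(\<lambda>\<omega>. \<Sum>i=1..n. real (position i (list_at n \<pi> (A \<omega>) t)) * of_bool (next_requested n (A \<omega>) t = i)) \<in> borel_measurable M"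
    by (intro borel_measurable_sum borel_measurable_times 1 2)
  moreover have "real (search_cost n \<pi> (A \<omega>) t) =
      (\<Sum>i=1..n. real (position i (list_at n \<pi> (A \<omega>) t)) * of_bool (next_requested n (A \<omega>) t = i))" for \<omega>
    by (simp add: search_cost_def)
  ultimately show ?thesis by (simp only:)
qed

section \<open>Simultaneous requests\<close>

text \<open>Cut \<open>{0..<t}\<close> into \<open>m\<close> cells. A tie puts two objects into the same cell, which happens in a given
  cell with probability at most \<open>(t / m)\<^sup>2\<close>, hence in some cell with probability at most \<open>t\<^sup>2 / m\<close>.\<close>

lemma AE_no_ties:
  assumes t: "0 < t"
  shows "AE \<omega> in M. request_sets.no_ties n (A \<omega>) t"
proof -
  have pair: "AE \<omega> in M. A \<omega> i \<inter> A \<omega> l \<inter> {0..<t} = {}" if il: "i \<in> {1..n}" "l \<in> {1..n}" "i \<noteq> l" for i l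
  proof -
    let ?c = "\<lambda>m k. {real k * (t / real m)..<real (Suc k) * (t / real m)}"
    let ?E = "\<lambda>m k. {\<omega>\<in>space M. A \<omega> i \<inter> ?c m k \<noteq> {} \<and> A \<omega> l \<inter> ?c m k \<noteq> {}}"
    \<comment> \<open>A measurable set that contains the ties: for every grid, some cell contains requests of both objects.\<close>
    let ?N = "\<Inter>m. \<Union>k<Suc m. ?E (Suc m) k"
    have E: "?E m k \<in> sets M" for m k
      by (intro sets.sets_Collect_conj sets.sets_Collect_neg[OF sets_no_request] il)
    then have Un: "(\<Union>k<Suc m. ?E (Suc m) k) \<in> sets M" for m by blast
    then have N: "?N \<in> sets M" by blast
    have le: "prob ?N \<le> t\<^sup>2 / real (Suc m)" for m
    proof -
      have "prob ?N \<le> prob (\<Union>k<Suc m. ?E (Suc m) k)"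
        by (rule finite_measure_mono[OF _ Un]) blast
      also have "\<dots> \<le> (\<Sum>k<Suc m. prob (?E (Suc m) k))"
        by (rule finite_measure_subadditive_finite[OF finite_lessThan]) (use E in blast)
      also have "\<dots> \<le> (\<Sum>k<Suc m. (t / real (Suc m))\<^sup>2)"
      proof (rule sum_mono)
        fix k
        have "prob (?E (Suc m) k) \<le> (real (Suc k) * (t / real (Suc m)) - real k * (t / real (Suc m)))\<^sup>2"
          by (rule prob_two_in_window_le[OF _ _ il]) (use t in \<open>auto intro!: mult_right_mono divide_right_mono\<close>)
        also have "real (Suc k) * (t / real (Suc m)) - real k * (t / real (Suc m)) = t / real (Suc m)"
          by (simp only: left_diff_distrib[symmetric]) simp
        finally show "prob (?E (Suc m) k) \<le> (t / real (Suc m))\<^sup>2" .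
      qed
      also have "\<dots> = t\<^sup>2 / real (Suc m)"
        by (simp add: power2_eq_square del: of_nat_Suc)
      finally show ?thesis .
    qed
    have "(\<lambda>m. t\<^sup>2 / real (Suc m)) \<longlonglongrightarrow> 0"
      using LIMSEQ_Suc[OF lim_const_over_n[of "t\<^sup>2"]] by simp
    then have "prob ?N \<le> 0"
      by (rule LIMSEQ_le_const) (use le in blast)
    then have "emeasure M ?N = 0" by (simp add: emeasure_eq_measure measure_le_0_iff)
    moreover have "{\<omega>\<in>space M. \<not> (A \<omega> i \<inter> A \<omega> l \<inter> {0..<t} = {})} \<subseteq> ?N"
    proof (intro subsetI INT_I)
      fix \<omega> m assume "\<omega> \<in> {\<omega>\<in>space M. \<not> (A \<omega> i \<inter> A \<omega> l \<inter> {0..<t} = {})}"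
      then obtain x where x: "\<omega> \<in> space M" "x \<in> A \<omega> i" "x \<in> A \<omega> l" "0 \<le> x" "x < t" by auto
      define h where "h = t / real (Suc m)"
      have h: "0 < h" "real (Suc m) * h = t" using t by (auto simp: h_def)
      define k where "k = nat \<lfloor>x / h\<rfloor>"
      have "real k \<le> x / h" "x / h < real k + 1" using x h by (auto simp: k_def)
      then have k: "real k * h \<le> x" "x < real (Suc k) * h" using h by (auto simp: field_simps)
      have "real k * h < real (Suc m) * h" using k x h by simp
      then have "k < Suc m" using h(1) by (simp only: mult_less_cancel_right_pos of_nat_less_iff)
      moreover have "\<omega> \<in> ?E (Suc m) k" using x k by (auto simp: h_def[symmetric] simp del: of_nat_Suc)
      ultimately show "\<omega> \<in> (\<Union>k<Suc m. ?E (Suc m) k)" by blast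
    qed
    ultimately show ?thesis using N by (intro AE_I) auto
  qed
  have "AE \<omega> in M. \<forall>i\<in>{1..n}. \<forall>l\<in>{1..n}. i \<noteq> l \<longrightarrow> A \<omega> i \<inter> A \<omega> l \<inter> {0..<t} = {}"
    using pair by (intro AE_finite_allI) (auto intro: AE_impI)
  then show ?thesis
    by (rule AE_mp, intro AE_I2) (auto simp: request_sets.no_ties_def[OF request_sets])
qed

end

context request_model
begin

section \<open>Joint law of the unrequested set and the next request\<close>

abbreviation "unreq \<omega> a b \<equiv> request_sets.unrequested n (A \<omega>) a b"
abbreviation "next_obj \<omega> t \<equiv> next_requested n (A \<omega>) t"

text \<open>The conditional probability, given the weights, that \<open>g\<close> is the set of objects that are not requested
  in a window of length \<open>\<tau>\<close>.\<close>

definition set_weight :: "real \<Rightarrow> nat set \<Rightarrow> 'a \<Rightarrow> real" where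
  "set_weight \<tau> g \<omega> = (\<Prod>l\<in>{1..n}. if l \<in> g then q \<tau> \<omega> l else 1 - q \<tau> \<omega> l)"

text \<open>The probability that \<open>g\<close> is the set of unrequested objects in the window and \<open>i\<close> is the next object
  after it, if the next object is chosen according to the popularities and independently of the window.\<close>

definition joint_weight :: "real \<Rightarrow> nat set \<Rightarrow> nat \<Rightarrow> real" where
  "joint_weight \<tau> g i = (LINT \<omega>|M. pop \<omega> i * set_weight \<tau> g \<omega>)"

lemma set_weight_measurable: "set_weight \<tau> g \<in> borel_measurable M"
proof -
  have "(\<lambda>\<omega>. if l \<in> g then q \<tau> \<omega> l else 1 - q \<tau> \<omega> l) \<in> borel_measurable M" if "l \<in> {1..n}" for l
    using q_measurable[OF that, of \<tau>] by (cases "l \<in> g") auto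
  then show ?thesis unfolding set_weight_def[abs_def] by (rule borel_measurable_prod)
qed

lemma set_weight_bounds:
  assumes "0 \<le> \<tau>" "\<omega> \<in> space M"
  shows "0 \<le> set_weight \<tau> g \<omega>" "set_weight \<tau> g \<omega> \<le> 1"
proof -
  have "0 \<le> (if l \<in> g then q \<tau> \<omega> l else 1 - q \<tau> \<omega> l) \<and> (if l \<in> g then q \<tau> \<omega> l else 1 - q \<tau> \<omega> l) \<le> 1"
    if "l \<in> {1..n}" for l
    using q_bounds[OF assms(1) that assms(2)] by simp
  then show "0 \<le> set_weight \<tau> g \<omega>" "set_weight \<tau> g \<omega> \<le> 1"
    unfolding set_weight_def by (auto intro!: prod_nonneg prod_le_1)
qed

lemma sum_set_weight: "(\<Sum>g\<in>Pow {1..n}. set_weight \<tau> g \<omega>) = 1"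
  unfolding set_weight_def by (subst prod_add_Pow_if) auto

text \<open>Expand the product of the sums \<open>q l + (1 - q l)\<close> over \<open>l \<noteq> i\<close>.\<close>

lemma sum_set_weight_containing:
  assumes "i \<in> {1..n}"
  shows "(\<Sum>g | g \<subseteq> {1..n} \<and> i \<in> g. set_weight \<tau> g \<omega>) = q \<tau> \<omega> i"
  unfolding set_weight_def by (subst sum_Pow_if_containing) (use assms in auto)

lemma joint_integrable:
  assumes "0 \<le> \<tau>" "i \<in> {1..n}"
  shows "integrable M (\<lambda>\<omega>. pop \<omega> i * set_weight \<tau> g \<omega>)"
proof (rule integrable_const_bound[where B = 1])
  show "AE \<omega> in M. norm (pop \<omega> i * set_weight \<tau> g \<omega>) \<le> 1"
    using set_weight_bounds[OF assms(1)] pop_nonneg[OF assms(2)] pop_le_1[OF assms(2)]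
    by (intro AE_I2) (auto simp: abs_mult intro!: mult_le_one)
  show "(\<lambda>\<omega>. pop \<omega> i * set_weight \<tau> g \<omega>) \<in> borel_measurable M"
    by (intro borel_measurable_times pop_measurable set_weight_measurable assms)
qed

lemma joint_weight_nonneg: "0 \<le> \<tau> \<Longrightarrow> i \<in> {1..n} \<Longrightarrow> 0 \<le> joint_weight \<tau> g i"
  unfolding joint_weight_def
  by (intro integral_nonneg_AE AE_I2 mult_nonneg_nonneg pop_nonneg set_weight_bounds)

lemma sets_unreq: "{\<omega>\<in>space M. unreq \<omega> a b = g} \<in> sets M"
proof (cases "g \<subseteq> {1..n}")
  case True
  have "unreq \<omega> a b = g \<longleftrightarrow> (\<forall>l\<in>{1..n}. (if l \<in> g then A \<omega> l \<inter> {a..<b} = {} else \<not> A \<omega> l \<inter> {a..<b} = {}))"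
    if "\<omega> \<in> space M" for \<omega>
    unfolding request_sets.unrequested_def[OF request_sets[OF that]] using True by (auto split: if_splits)
  then have "{\<omega>\<in>space M. unreq \<omega> a b = g} =
    {\<omega>\<in>space M. \<forall>l\<in>{1..n}. (if l \<in> g then A \<omega> l \<inter> {a..<b} = {} else \<not> A \<omega> l \<inter> {a..<b} = {})}" by blast
  also have "\<dots> \<in> sets M"
  proof (intro sets.sets_Collect_finite_All finite_atLeastAtMost)
    fix l assume l: "l \<in> {1..n}"
    show "{\<omega>\<in>space M. if l \<in> g then A \<omega> l \<inter> {a..<b} = {} else \<not> A \<omega> l \<inter> {a..<b} = {}} \<in> sets M"
      using sets_no_request[OF l] sets.sets_Collect_neg[OF sets_no_request[OF l]] by (cases "l \<in> g") simp_all
  qed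
  finally show ?thesis .
next
  case False
  have "{\<omega>\<in>space M. unreq \<omega> a b = g} = {}"
    using False request_sets.unrequested_def[OF request_sets] by auto
  then show ?thesis by (simp only: sets.empty_sets)
qed

lemma unreq_subset: "\<omega> \<in> space M \<Longrightarrow> unreq \<omega> a b \<subseteq> {1..n}"
  by (auto simp: request_sets.unrequested_def[OF request_sets])

lemma next_obj_le: "\<omega> \<in> space M \<Longrightarrow> next_obj \<omega> t \<le> n"
  by (rule request_sets.next_requested_le[OF request_sets])

lemma pair_measurable: "(\<lambda>\<omega>. (unreq \<omega> a t, next_obj \<omega> t)) \<in> measurable M (count_space (Pow {1..n} \<times> {..n}))"
proof (rule measurable_count_space_eq2[THEN iffD2], simp, intro conjI ballI)
  show "(\<lambda>\<omega>. (unreq \<omega> a t, next_obj \<omega> t)) \<in> space M \<rightarrow> Pow {1..n} \<times> {..n}"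
    using unreq_subset next_obj_le by auto
  fix gi assume "gi \<in> Pow {1..n} \<times> {..n}"
  have "(\<lambda>\<omega>. (unreq \<omega> a t, next_obj \<omega> t)) -` {gi} \<inter> space M =
      {\<omega>\<in>space M. unreq \<omega> a t = fst gi \<and> next_obj \<omega> t = snd gi}" by auto
  also have "\<dots> \<in> sets M"
    by (intro sets.sets_Collect_conj sets_unreq sets_next_requested)
  finally show "(\<lambda>\<omega>. (unreq \<omega> a t, next_obj \<omega> t)) -` {gi} \<inter> space M \<in> sets M" .
qed

lemma sets_pair: "{\<omega>\<in>space M. (unreq \<omega> a t, next_obj \<omega> t) \<in> Q} \<in> sets M"
proof -
  have "{\<omega>\<in>space M. (unreq \<omega> a t, next_obj \<omega> t) \<in> Q} =
      (\<lambda>\<omega>. (unreq \<omega> a t, next_obj \<omega> t)) -` (Q \<inter> (Pow {1..n} \<times> {..n})) \<inter> space M"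
    using measurable_space[OF pair_measurable, of _ a t] by auto
  then show ?thesis using measurable_sets[OF pair_measurable, of "Q \<inter> (Pow {1..n} \<times> {..n})" a t] by simp
qed

text \<open>Cut the time after \<open>t\<close> into cells of length \<open>h\<close>. Object \<open>i\<close> is the next one if it is the only one
  requested in the first cell with a request. As the total rate is at most \<open>1\<close>, this happens in
  the \<open>j\<close>-th cell with conditional probability at least \<open>pop i * h * exp (- h) * exp (- j * h)\<close>. First
  cells with two requested objects are lost, but their probability tends to \<open>0\<close> with \<open>h\<close>.\<close>

lemma prob_next_in_cell_ge:
  fixes j :: nat
  assumes a: "0 \<le> a" "a \<le> t" and h: "0 < h" and g: "g \<subseteq> {1..n}" and i: "i \<in> {1..n}"
  defines "s \<equiv> (\<lambda>k::nat. if k = 0 then a else if k = 1 then t else if k = 2 then t + real j * h else t + real (Suc j) * h)"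
    and "C \<equiv> (\<lambda>l (k::nat). if k = 0 then (if l \<in> g then {0} else - {0}) else if k = 1 then {0}
      else if l = i then - {0} else {0 :: nat})"
  shows "h * exp (- h) * exp (- h) ^ j * joint_weight (t - a) g i \<le>
   \<P>(\<omega> in M. \<forall>l\<in>{1..n}. \<forall>k<3. hits \<omega> l (s k) (s (Suc k)) \<in> C l k)"
proof -
  let ?E = "{\<omega>\<in>space M. \<forall>l\<in>{1..n}. \<forall>k<3. hits \<omega> l (s k) (s (Suc k)) \<in> C l k}"
  define c where "c = h * exp (- h) * exp (- h) ^ j"
  have c: "0 \<le> c" using h by (simp add: c_def)
  have s: "0 \<le> s 0" "mono s"
  proof -
    show "0 \<le> s 0" using a by (simp add: s_def)
    have "real j * h \<le> real (Suc j) * h" using h by (intro mult_right_mono) auto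
    moreover have "0 \<le> real j * h" "0 \<le> real (Suc j) * h" using h by auto
    ultimately show "mono s" using a unfolding mono_def s_def by auto
  qed
  have tau: "0 \<le> t - a" using a by simp
  have "ennreal (c * joint_weight (t - a) g i) = ennreal (LINT \<omega>|M. c * (pop \<omega> i * set_weight (t - a) g \<omega>))"
    by (simp add: joint_weight_def)
  also have "\<dots> = (\<integral>\<^sup>+\<omega>. ennreal (c * (pop \<omega> i * set_weight (t - a) g \<omega>)) \<partial>M)"
    using joint_integrable[OF tau i, of g] set_weight_bounds[OF tau] pop_nonneg[OF i] c
    by (intro nn_integral_eq_integral[symmetric] integrable_mult_right AE_I2) auto
  also have "\<dots> \<le> (\<integral>\<^sup>+\<omega>. ennreal (\<Prod>l\<in>{1..n}. \<Prod>k<3. measure_pmf.prob (poi (pop \<omega> l * (s (Suc k) - s k))) (C l k)) \<partial>M)"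
  proof (intro nn_integral_mono ennreal_leI)
    fix \<omega> assume \<omega>: "\<omega> \<in> space M"
    let ?p = "pop \<omega>"
    have pn: "0 \<le> ?p l" if "l \<in> {1..n}" for l by (rule pop_nonneg[OF that \<omega>])
    have len: "s 1 - s 0 = t - a" "s 2 - s 1 = real j * h" "s 3 - s 2 = h"
      by (simp_all add: s_def algebra_simps)
    have "(\<Prod>k<3. measure_pmf.prob (poi (?p l * (s (Suc k) - s k))) (C l k)) =
      (if l \<in> g then q (t - a) \<omega> l else 1 - q (t - a) \<omega> l) * exp (- (?p l * (real j * h))) *
      (if l = i then 1 - exp (- (?p l * h)) else exp (- (?p l * h)))" if l: "l \<in> {1..n}" for l
    proof -
      have "(\<Prod>k<3. measure_pmf.prob (poi (?p l * (s (Suc k) - s k))) (C l k)) =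
        measure_pmf.prob (poi (?p l * (s 1 - s 0))) (C l 0) *
        measure_pmf.prob (poi (?p l * (s 2 - s 1))) (C l 1) *
        measure_pmf.prob (poi (?p l * (s 3 - s 2))) (C l 2)"
        by (simp add: numeral_3_eq_3 numeral_2_eq_2)
      moreover have "0 \<le> ?p l * (t - a)" "0 \<le> ?p l * (real j * h)" "0 \<le> ?p l * h"
        using pn[OF l] tau h by auto
      ultimately show ?thesis
        unfolding len by (cases "l = i") (simp_all add: C_def prob_poi_zero prob_poi_nonzero)
    qed
    then have "(\<Prod>l\<in>{1..n}. \<Prod>k<3. measure_pmf.prob (poi (?p l * (s (Suc k) - s k))) (C l k)) =
      set_weight (t - a) g \<omega> * (\<Prod>l\<in>{1..n}. exp (- (?p l * (real j * h)))) *
      (\<Prod>l\<in>{1..n}. if l = i then 1 - exp (- (?p l * h)) else exp (- (?p l * h)))"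
      unfolding set_weight_def prod.distrib[symmetric] by (intro prod.cong) auto
    moreover have all_exp: "exp (- r) \<le> (\<Prod>l\<in>{1..n}. exp (- (?p l * r)))" if "0 \<le> r" for r
    proof -
      have "(\<Sum>l\<in>{1..n}. ?p l) * r \<le> 1 * r"
        using sum_pop_le_1[OF \<omega>] that by (intro mult_right_mono) auto
      then show ?thesis by (simp add: exp_sum[symmetric] sum_negf sum_distrib_right)
    qed
    moreover have "?p i * h * exp (- h) \<le> (\<Prod>l\<in>{1..n}. if l = i then 1 - exp (- (?p l * h)) else exp (- (?p l * h)))"
    proof -
      have "?p i * h * exp (- h) \<le> (exp (?p i * h) - 1) * (\<Prod>l\<in>{1..n}. exp (- (?p l * h)))"
      proof (rule mult_mono)
        show "?p i * h \<le> exp (?p i * h) - 1" using exp_ge_add_one_self[of "?p i * h"] by linarith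
        show "exp (- h) \<le> (\<Prod>l\<in>{1..n}. exp (- (?p l * h)))" by (rule all_exp) (use h in simp)
      qed (use pn[OF i] h in auto)
      also have "\<dots> = (exp (?p i * h) - 1) * (exp (- (?p i * h)) * (\<Prod>l\<in>{1..n} - {i}. exp (- (?p l * h))))"
        using i by (subst prod.remove[of _ i]) auto
      also have "\<dots> = (1 - exp (- (?p i * h))) * (\<Prod>l\<in>{1..n} - {i}. exp (- (?p l * h)))"
        by (simp add: exp_minus field_simps)
      also have "\<dots> = (\<Prod>l\<in>{1..n}. if l = i then 1 - exp (- (?p l * h)) else exp (- (?p l * h)))"
        using i by (subst (2) prod.remove[of _ i]) (auto intro!: prod.cong)
      finally show ?thesis .
    qed
    moreover have "exp (- h) ^ j \<le> (\<Prod>l\<in>{1..n}. exp (- (?p l * (real j * h))))"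
      using all_exp[of "real j * h"] h by (simp add: exp_of_nat_mult[symmetric])
    ultimately have "set_weight (t - a) g \<omega> * exp (- h) ^ j * (?p i * h * exp (- h)) \<le>
        (\<Prod>l\<in>{1..n}. \<Prod>k<3. measure_pmf.prob (poi (?p l * (s (Suc k) - s k))) (C l k))"
      using set_weight_bounds[OF tau \<omega>, of g] pn[OF i] h
      by (simp only:) (intro mult_mono mult_left_mono mult_nonneg_nonneg prod_nonneg, auto)
    then show "c * (?p i * set_weight (t - a) g \<omega>) \<le>
        (\<Prod>l\<in>{1..n}. \<Prod>k<3. measure_pmf.prob (poi (?p l * (s (Suc k) - s k))) (C l k))"
      by (simp add: c_def mult_ac)
  qed
  also have "\<dots> = emeasure M ?E"
    by (rule emeasure_counts[OF s, symmetric])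
  also have "\<dots> = ennreal (prob ?E)" by (rule emeasure_eq_measure)
  finally show ?thesis
    unfolding c_def by (simp add: ennreal_le_iff)
qed

text \<open>Summing the bound of the previous lemma over the cells \<open>j < N\<close> gives a geometric series; \<open>h\<close> tends to
  \<open>0\<close> and \<open>N * h\<close> to infinity.\<close>

lemma joint_weight_le:
  assumes a: "0 \<le> a" "a \<le> t" and g: "g \<subseteq> {1..n}" and i: "i \<in> {1..n}"
  shows "joint_weight (t - a) g i \<le> \<P>(\<omega> in M. unreq \<omega> a t = g \<and> next_obj \<omega> t = i)"
proof -
  let ?G = "{\<omega>\<in>space M. unreq \<omega> a t = g \<and> next_obj \<omega> t = i}"
  have G: "?G \<in> sets M" by (intro sets.sets_Collect_conj sets_unreq sets_next_requested)
  have key: "exp (- h) * (1 - exp (- h) ^ N) * joint_weight (t - a) g i \<le> prob ?G" if h: "0 < h" for h :: real and N :: nat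
  proof -
    \<comment> \<open>For each \<open>j\<close> three windows: \<open>{a..<t}\<close>, the first \<open>j\<close> cells after \<open>t\<close>, and the next cell. The
      event \<open>F j\<close> requires that exactly \<open>g\<close> avoids the first window, that the second one is empty, and that only
      \<open>i\<close> is requested in the third one.\<close>
    define s where "s j k = (if k = 0 then a else if k = 1 then t else if k = 2 then t + real j * h else t + real (Suc j) * h)" for j k :: nat
    define C where "C l k = (if k = 0 then (if l \<in> g then {0} else - {0}) else if k = 1 then {0}
      else if l = i then - {0} else {0 :: nat})" for l k :: nat
    define F where "F j = {\<omega>\<in>space M. \<forall>l\<in>{1..n}. \<forall>k<3. hits \<omega> l (s j k) (s j (Suc k)) \<in> C l k}" for j
    have F: "F j \<in> sets M" for j
      unfolding F_def by (rule sets_counts)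
    have props: "\<omega> \<in> space M" "unreq \<omega> a t = g" "A \<omega> l \<inter> {t..<t + real j * h} = {}"
      "A \<omega> l \<inter> {t + real j * h..<t + real (Suc j) * h} = {} \<longleftrightarrow> l \<noteq> i"
      if "\<omega> \<in> F j" "l \<in> {1..n}" for \<omega> j l
    proof -
      show \<omega>: "\<omega> \<in> space M" using that by (simp add: F_def)
      have C: "hits \<omega> l (s j k) (s j (Suc k)) \<in> C l k" if "l \<in> {1..n}" "k < 3" for l k
        using \<open>\<omega> \<in> F j\<close> that by (simp add: F_def)
      have iff: "A \<omega> l \<inter> {a..<t} = {} \<longleftrightarrow> l \<in> g" if "l \<in> {1..n}" for l
        using C[OF that, of 0] count_eq_0_iff[OF \<omega> that, of a t] by (auto simp: C_def s_def split: if_splits)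
      have "{l\<in>{1..n}. A \<omega> l \<inter> {a..<t} = {}} = {l\<in>{1..n}. l \<in> g}"
        by (intro Collect_cong conj_cong refl iff)
      then show "unreq \<omega> a t = g"
        unfolding request_sets.unrequested_def[OF request_sets[OF \<omega>]] using g by blast
      show "A \<omega> l \<inter> {t..<t + real j * h} = {}"
        using C[OF that(2), of 1] count_eq_0_iff[OF \<omega> that(2), of t "t + real j * h"] by (simp add: C_def s_def)
      show "A \<omega> l \<inter> {t + real j * h..<t + real (Suc j) * h} = {} \<longleftrightarrow> l \<noteq> i"
        using C[OF that(2), of 2] count_eq_0_iff[OF \<omega> that(2), of "t + real j * h" "t + real (Suc j) * h"]
        by (cases "l = i") (simp_all add: C_def s_def)
    qed
    have sub: "F j \<subseteq> ?G" for j
    proof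
      fix \<omega> assume \<omega>: "\<omega> \<in> F j"
      have "next_obj \<omega> t = i"
      proof (rule request_sets.next_requested_cell[OF request_sets[OF props(1)[OF \<omega> i]] i])
        show "t \<le> t + real j * h" using h by simp
        show "A \<omega> i \<inter> {t + real j * h..<t + real (Suc j) * h} \<noteq> {}" using props(4)[OF \<omega> i] by blast
      qed (use props(3,4)[OF \<omega>] in blast)+
      then show "\<omega> \<in> ?G" using props(1,2)[OF \<omega> i] by blast
    qed
    have disj: "F j \<inter> F j' = {}" if "j < j'" for j j'
    proof (rule ccontr)
      assume "F j \<inter> F j' \<noteq> {}"
      then obtain \<omega> where \<omega>: "\<omega> \<in> F j" "\<omega> \<in> F j'" by blast
      have "real (Suc j) * h \<le> real j' * h" "0 \<le> real j * h" using that h by (auto intro!: mult_right_mono simp del: of_nat_Suc)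
      then have "{t + real j * h..<t + real (Suc j) * h} \<subseteq> {t..<t + real j' * h}" by auto
      then have "A \<omega> i \<inter> {t + real j * h..<t + real (Suc j) * h} = {}" using props(3)[OF \<omega>(2) i] by blast
      then show False using props(4)[OF \<omega>(1) i] by blast
    qed
    have "exp (- h) * (1 - exp (- h) ^ N) \<le> (\<Sum>j<N. h * exp (- h) * exp (- h) ^ j)"
    proof -
      have e: "exp (- h) < 1" "1 - exp (- h) \<le> h" using h exp_ge_add_one_self[of "- h"] by auto
      have "1 - exp (- h) ^ N = (1 - exp (- h)) * (\<Sum>j<N. exp (- h) ^ j)"
        by (rule one_diff_power_eq)
      also have "\<dots> \<le> h * (\<Sum>j<N. exp (- h) ^ j)"
        using e by (intro mult_right_mono sum_nonneg) auto
      finally have "exp (- h) * (1 - exp (- h) ^ N) \<le> exp (- h) * (h * (\<Sum>j<N. exp (- h) ^ j))"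
        by (rule mult_left_mono) simp
      then show ?thesis by (simp add: sum_distrib_left mult_ac)
    qed
    then have "exp (- h) * (1 - exp (- h) ^ N) * joint_weight (t - a) g i
        \<le> (\<Sum>j<N. h * exp (- h) * exp (- h) ^ j) * joint_weight (t - a) g i"
      using joint_weight_nonneg[of "t - a" i g] a i by (intro mult_right_mono) auto
    also have "\<dots> = (\<Sum>j<N. h * exp (- h) * exp (- h) ^ j * joint_weight (t - a) g i)"
      by (rule sum_distrib_right)
    also have "\<dots> \<le> (\<Sum>j<N. prob (F j))"
      unfolding F_def s_def C_def by (intro sum_mono prob_next_in_cell_ge[OF a h g i])
    also have "\<dots> = prob (\<Union>j<N. F j)"
    proof (rule finite_measure_finite_Union[symmetric])
      show "disjoint_family_on F {..<N}"
        unfolding disjoint_family_on_def using disj by (metis Int_commute linorder_neqE_nat)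
    qed (use F in auto)
    also have "\<dots> \<le> prob ?G"
      by (rule finite_measure_mono[OF _ G]) (use sub in blast)
    finally show ?thesis .
  qed
  \<comment> \<open>The choice \<open>h = 1 / Suc r\<close> and \<open>N = Suc r * Suc r\<close>, with \<open>N * h = Suc r\<close>.\<close>
  have "(\<lambda>r. exp (- (1 / real (Suc r))) * (1 - exp (- (1 / real (Suc r))) ^ (Suc r * Suc r)) * joint_weight (t - a) g i)
      \<longlonglongrightarrow> exp (- 0) * (1 - 0) * joint_weight (t - a) g i"
  proof (intro tendsto_mult tendsto_diff tendsto_exp tendsto_minus tendsto_const)
    show "(\<lambda>r. 1 / real (Suc r)) \<longlonglongrightarrow> 0"
      using LIMSEQ_Suc[OF lim_const_over_n[of "1::real"]] by simp
    have "exp (- (1 / real (Suc r))) ^ (Suc r * Suc r) = exp (-1) ^ Suc r" for r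
    proof -
      have "exp (- (1 / real (Suc r))) ^ Suc r = exp (-1)"
        by (subst exp_of_nat_mult[symmetric]) (simp del: of_nat_Suc)
      then show ?thesis by (simp only: power_mult)
    qed
    moreover have "(\<lambda>r. exp (-1 :: real) ^ Suc r) \<longlonglongrightarrow> 0"
      by (rule LIMSEQ_Suc[OF LIMSEQ_realpow_zero]) auto
    ultimately show "(\<lambda>r. exp (- (1 / real (Suc r))) ^ (Suc r * Suc r)) \<longlonglongrightarrow> 0"
      by (simp only:)
  qed
  then have "exp (- 0) * (1 - 0) * joint_weight (t - a) g i \<le> prob ?G"
    by (rule LIMSEQ_le_const2) (intro exI allI impI key, simp)
  then show ?thesis by simp
qed

lemma sum_joint_weight_le:
  assumes a: "0 \<le> a" "a \<le> t"
  shows "(\<Sum>(g, i)\<in>(Pow {1..n} \<times> {1..n}) \<inter> Q. joint_weight (t - a) g i)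
    \<le> \<P>(\<omega> in M. (unreq \<omega> a t, next_obj \<omega> t) \<in> Q)"
proof -
  let ?V = "Pow {1..n} \<times> {1..n}"
  have "(\<Sum>(g, i)\<in>?V \<inter> Q. joint_weight (t - a) g i)
      \<le> (\<Sum>(g, i)\<in>?V \<inter> Q. \<P>(\<omega> in M. unreq \<omega> a t = g \<and> next_obj \<omega> t = i))"
    by (rule sum_mono) (use joint_weight_le[OF a] in auto)
  also have "\<dots> = (\<Sum>gi\<in>?V \<inter> Q. \<P>(\<omega> in M. unreq \<omega> a t = fst gi \<and> next_obj \<omega> t = snd gi))"
    by (simp add: case_prod_beta)
  also have "\<dots> = prob (\<Union>gi\<in>?V \<inter> Q. {\<omega>\<in>space M. unreq \<omega> a t = fst gi \<and> next_obj \<omega> t = snd gi})"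
  proof (rule finite_measure_finite_Union[symmetric])
    show "finite (?V \<inter> Q)" by simp
    show "disjoint_family_on (\<lambda>gi. {\<omega>\<in>space M. unreq \<omega> a t = fst gi \<and> next_obj \<omega> t = snd gi}) (?V \<inter> Q)"
      unfolding disjoint_family_on_def by (auto simp: prod_eq_iff)
    show "(\<lambda>gi. {\<omega>\<in>space M. unreq \<omega> a t = fst gi \<and> next_obj \<omega> t = snd gi}) ` (?V \<inter> Q) \<subseteq> sets M"
      by (auto intro!: sets.sets_Collect_conj sets_unreq sets_next_requested)
  qed
  also have "\<dots> \<le> \<P>(\<omega> in M. (unreq \<omega> a t, next_obj \<omega> t) \<in> Q)"
    by (rule finite_measure_mono[OF _ sets_pair]) auto
  finally show ?thesis .
qed

text \<open>The lower bounds for the probabilities of single values add up to almost \<open>1\<close>, hence they are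
  almost equalities.\<close>

lemma prob_pair_approx:
  assumes a: "0 \<le> a" "a \<le> t"
  shows "\<bar>prob {\<omega>\<in>space M. (unreq \<omega> a t, next_obj \<omega> t) \<in> Q} -
      (\<Sum>(g, i)\<in>(Pow {1..n} \<times> {1..n}) \<inter> Q. joint_weight (t - a) g i)\<bar>
    \<le> \<P>(\<omega> in M. (\<Sum>i=1..n. w \<omega> i) = 0)"
proof -
  let ?V = "Pow {1..n} \<times> {1..n}"
  let ?p = "\<lambda>Q. \<P>(\<omega> in M. (unreq \<omega> a t, next_obj \<omega> t) \<in> Q)"
  let ?S = "\<lambda>Q. \<Sum>(g, i)\<in>?V \<inter> Q. joint_weight (t - a) g i"
  have tau: "0 \<le> t - a" using a by simp
  have lower: "?S Q \<le> ?p Q" for Q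
    by (rule sum_joint_weight_le[OF a])
  have total: "?S UNIV = 1 - \<P>(\<omega> in M. (\<Sum>i=1..n. w \<omega> i) = 0)"
  proof -
    have meas: "{\<omega>\<in>space M. (\<Sum>i=1..n. w \<omega> i) = 0} \<in> sets M"
    proof -
      have "(\<lambda>\<omega>. \<Sum>i=1..n. w \<omega> i) \<in> borel_measurable M"
        by (intro borel_measurable_sum w_measurable)
      from measurable_sets[OF this, of "{0}"] show ?thesis by (simp add: vimage_def Int_def conj_commute)
    qed
    have "?S UNIV = (\<Sum>i\<in>{1..n}. \<Sum>g\<in>Pow {1..n}. joint_weight (t - a) g i)"
      by (simp add: sum.cartesian_product[symmetric]) (rule sum.swap)
    also have "\<dots> = (\<Sum>i\<in>{1..n}. LINT \<omega>|M. (\<Sum>g\<in>Pow {1..n}. pop \<omega> i * set_weight (t - a) g \<omega>))"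
      unfolding joint_weight_def
      by (intro sum.cong refl Bochner_Integration.integral_sum[symmetric] joint_integrable tau)
    also have "\<dots> = (\<Sum>i\<in>{1..n}. LINT \<omega>|M. pop \<omega> i)"
      by (simp add: sum_distrib_left[symmetric] sum_set_weight[simplified])
    also have "\<dots> = (LINT \<omega>|M. (\<Sum>i\<in>{1..n}. pop \<omega> i))"
    proof (rule Bochner_Integration.integral_sum[symmetric])
      fix i assume i: "i \<in> {1..n}"
      show "integrable M (\<lambda>\<omega>. pop \<omega> i)"
        by (rule integrable_const_bound[where B = 1])
           (use pop_nonneg[OF i] pop_le_1[OF i] pop_measurable[OF i] in auto)
    qed
    also have "\<dots> = (LINT \<omega>|M. 1 - indicator {\<omega>\<in>space M. (\<Sum>i=1..n. w \<omega> i) = 0} \<omega>)"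
      by (rule Bochner_Integration.integral_cong[OF refl]) (subst sum_pop, auto simp: indicator_def)
    also have "\<dots> = 1 - \<P>(\<omega> in M. (\<Sum>i=1..n. w \<omega> i) = 0)"
      using meas prob_space by (subst Bochner_Integration.integral_diff) (simp_all add: emeasure_eq_measure sets.Int_space_eq2)
    finally show ?thesis .
  qed
  have split: "?S UNIV = ?S Q + ?S (- Q)"
  proof -
    have "?V \<inter> UNIV = (?V \<inter> Q) \<union> (?V \<inter> - Q)" by auto
    then show ?thesis by (simp only:) (rule sum.union_disjoint, auto)
  qed
  have compl: "?p Q + ?p (- Q) = 1"
  proof -
    have "?p (- Q) = prob (space M - {\<omega>\<in>space M. (unreq \<omega> a t, next_obj \<omega> t) \<in> Q})"
      by (rule arg_cong[where f = prob]) auto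
    also have "\<dots> = 1 - ?p Q" by (rule prob_compl[OF sets_pair])
    finally show ?thesis by simp
  qed
  show ?thesis
    using lower[of Q] lower[of "- Q"] total split compl by linarith
qed

text \<open>The weights of the other objects sum up to \<open>1\<close>, only the factor \<open>q i\<close> remains.\<close>

lemma sum_joint_weight_containing:
  assumes "0 \<le> \<tau>"
  shows "(\<Sum>(g, i)\<in>(Pow {1..n} \<times> {1..n}) \<inter> {(g, i). i \<in> g}. joint_weight \<tau> g i)
    = (LINT \<omega>|M. (\<Sum>i=1..n. pop \<omega> i * q \<tau> \<omega> i))"
proof -
  have eq: "(Pow {1..n} \<times> {1..n}) \<inter> {(g, i). i \<in> g} = (\<lambda>(i, g). (g, i)) ` (SIGMA i:{1..n}. {g. g \<subseteq> {1..n} \<and> i \<in> g})"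
    by auto
  have "(\<Sum>(g, i)\<in>(Pow {1..n} \<times> {1..n}) \<inter> {(g, i). i \<in> g}. joint_weight \<tau> g i)
    = (\<Sum>(i, g)\<in>(SIGMA i:{1..n}. {g. g \<subseteq> {1..n} \<and> i \<in> g}). joint_weight \<tau> g i)"
    unfolding eq by (subst sum.reindex) (auto simp: inj_on_def intro!: sum.cong)
  also have "\<dots> = (\<Sum>i\<in>{1..n}. \<Sum>g | g \<subseteq> {1..n} \<and> i \<in> g. joint_weight \<tau> g i)"
    by (subst sum.Sigma) auto
  also have "\<dots> = (\<Sum>i\<in>{1..n}. LINT \<omega>|M. (\<Sum>g | g \<subseteq> {1..n} \<and> i \<in> g. pop \<omega> i * set_weight \<tau> g \<omega>))"
    unfolding joint_weight_def
    by (intro sum.cong refl Bochner_Integration.integral_sum[symmetric] joint_integrable assms)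
  also have "\<dots> = (\<Sum>i\<in>{1..n}. LINT \<omega>|M. pop \<omega> i * q \<tau> \<omega> i)"
    by (intro sum.cong refl Bochner_Integration.integral_cong)
       (simp only: sum_distrib_left[symmetric] sum_set_weight_containing)
  also have "\<dots> = (LINT \<omega>|M. (\<Sum>i=1..n. pop \<omega> i * q \<tau> \<omega> i))"
  proof (rule Bochner_Integration.integral_sum[symmetric])
    fix i assume i: "i \<in> {1..n}"
    show "integrable M (\<lambda>\<omega>. pop \<omega> i * q \<tau> \<omega> i)"
    proof (rule integrable_const_bound[where B = 1])
      show "AE \<omega> in M. norm (pop \<omega> i * q \<tau> \<omega> i) \<le> 1"
        using pop_nonneg[OF i] pop_le_1[OF i] q_bounds[OF assms i]
        by (intro AE_I2) (auto simp: abs_mult intro!: mult_le_one)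
    qed (intro borel_measurable_times pop_measurable q_measurable i)
  qed
  finally show ?thesis .
qed

text \<open>The transposition of two objects in \<open>g\<close> maps \<open>g\<close> to itself.\<close>

lemma joint_weight_exchange:
  assumes exch: "exchangeable M n w" and g: "g \<subseteq> {1..n}" and i: "i \<in> g" "i' \<in> g"
  shows "joint_weight \<tau> g i = joint_weight \<tau> g i'"
proof -
  let ?\<sigma> = "Transposition.transpose i i'"
  have \<sigma>: "?\<sigma> permutes {1..n}" using g i by (intro permutes_swap_id) auto
  define \<Phi> where "\<Phi> k v = popularity n v k * (\<Prod>l\<in>{1..n}. if l \<in> g then exp (- (popularity n v l * \<tau>)) else 1 - exp (- (popularity n v l * \<tau>)))"
    for k and v :: "nat \<Rightarrow> real"
  have pop_restrict: "popularity n (restrict v {1..n}) l = popularity n v l" if "l \<in> {1..n}" for v l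
    using that by (simp add: popularity_def)
  have \<Phi>_restrict: "\<Phi> k (restrict v {1..n}) = \<Phi> k v" if "k \<in> {1..n}" for k v
    unfolding \<Phi>_def pop_restrict[OF that] by (intro arg_cong2[where f = "(*)"] refl prod.cong) (simp_all only: pop_restrict)
  have pop_perm: "popularity n (\<lambda>j. v (?\<sigma> j)) l = popularity n v (?\<sigma> l)" for v l
    unfolding popularity_def using sum.permute[OF \<sigma>, of v] by (simp add: comp_def)
  have \<Phi>_perm: "\<Phi> k (\<lambda>j. v (?\<sigma> j)) = \<Phi> (?\<sigma> k) v" for k v
  proof -
    have "?\<sigma> l \<in> g \<longleftrightarrow> l \<in> g" for l using i by (auto simp: Transposition.transpose_def)
    then have "(\<Prod>l\<in>{1..n}. if l \<in> g then exp (- (popularity n v (?\<sigma> l) * \<tau>)) else 1 - exp (- (popularity n v (?\<sigma> l) * \<tau>))) =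
      (\<Prod>l\<in>{1..n}. if l \<in> g then exp (- (popularity n v l * \<tau>)) else 1 - exp (- (popularity n v l * \<tau>)))"
      using prod.permute[OF \<sigma>, of "\<lambda>l. if l \<in> g then exp (- (popularity n v l * \<tau>)) else 1 - exp (- (popularity n v l * \<tau>))"]
      by (simp add: comp_def)
    then show ?thesis unfolding \<Phi>_def pop_perm by simp
  qed
  have \<Phi>_meas: "\<Phi> k \<in> borel_measurable (\<Pi>\<^sub>M i\<in>{1..n}. borel)" if k: "k \<in> {1..n}" for k
  proof -
    have pm: "(\<lambda>v. popularity n v l) \<in> borel_measurable (\<Pi>\<^sub>M i\<in>{1..n}. borel)" if "l \<in> {1..n}" for l
      unfolding popularity_def using that
      by (intro borel_measurable_divide borel_measurable_sum measurable_component_singleton) auto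
    have "(\<lambda>v. if l \<in> g then exp (- (popularity n v l * \<tau>)) else 1 - exp (- (popularity n v l * \<tau>))) \<in> borel_measurable (\<Pi>\<^sub>M i\<in>{1..n}. borel)"
      if "l \<in> {1..n}" for l
      using pm[OF that] by (cases "l \<in> g") auto
    then show ?thesis unfolding \<Phi>_def[abs_def] by (intro borel_measurable_times borel_measurable_prod pm k)
  qed
  have \<Phi>_int: "joint_weight \<tau> g k = (LINT v|distr M (\<Pi>\<^sub>M i\<in>{1..n}. borel) (\<lambda>\<omega>. \<lambda>i\<in>{1..n}. w \<omega> i). \<Phi> k v)"
    if k: "k \<in> {1..n}" for k
  proof -
    have meas: "(\<lambda>\<omega>. \<lambda>i\<in>{1..n}. w \<omega> i) \<in> measurable M (\<Pi>\<^sub>M i\<in>{1..n}. borel)"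
      using w_measurable by (intro measurable_restrict) auto
    have "joint_weight \<tau> g k = (LINT \<omega>|M. \<Phi> k (w \<omega>))"
      by (simp add: joint_weight_def set_weight_def \<Phi>_def)
    also have "\<dots> = (LINT v|distr M (\<Pi>\<^sub>M i\<in>{1..n}. borel) (\<lambda>\<omega>. \<lambda>i\<in>{1..n}. w \<omega> i). \<Phi> k v)"
      by (simp only: integral_distr[OF meas \<Phi>_meas[OF k]] \<Phi>_restrict[OF k])
    finally show ?thesis .
  qed
  have i': "i' \<in> {1..n}" "i \<in> {1..n}" using g i by auto
  have "joint_weight \<tau> g i' = (LINT v|distr M (\<Pi>\<^sub>M i\<in>{1..n}. borel) (\<lambda>\<omega>. \<lambda>i\<in>{1..n}. w \<omega> (?\<sigma> i)). \<Phi> i' v)"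
    using exch \<sigma> unfolding exchangeable_def \<Phi>_int[OF i'(1)] by simp
  also have "\<dots> = (LINT \<omega>|M. \<Phi> i' (\<lambda>j. w \<omega> (?\<sigma> j)))"
  proof -
    have "(\<lambda>\<omega>. \<lambda>i\<in>{1..n}. w \<omega> (?\<sigma> i)) \<in> measurable M (\<Pi>\<^sub>M i\<in>{1..n}. borel)"
    proof (rule measurable_restrict)
      fix k assume "k \<in> {1..n}"
      then have "?\<sigma> k \<in> {1..n}" using permutes_in_image[OF \<sigma>] by simp
      then show "(\<lambda>\<omega>. w \<omega> (?\<sigma> k)) \<in> borel_measurable M" by (rule w_measurable)
    qed
    from integral_distr[OF this \<Phi>_meas[OF i'(1)]] show ?thesis
      by (simp only: \<Phi>_restrict[OF i'(1)])
  qed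
  also have "\<dots> = (LINT \<omega>|M. \<Phi> i (w \<omega>))"
    by (simp add: \<Phi>_perm)
  also have "\<dots> = joint_weight \<tau> g i"
    by (simp add: joint_weight_def set_weight_def \<Phi>_def)
  finally show ?thesis ..
qed

section \<open>The number of unrequested objects\<close>

lemma card_unreq_eq: "\<omega> \<in> space M \<Longrightarrow>
  real (card (unreq \<omega> a t)) = (\<Sum>i=1..n. indicator {\<omega>\<in>space M. A \<omega> i \<inter> {a..<t} = {}} \<omega>)"
proof -
  assume \<omega>: "\<omega> \<in> space M"
  have "(\<Sum>i\<in>{1..n}. indicator {\<omega>\<in>space M. A \<omega> i \<inter> {a..<t} = {}} \<omega> :: real) = (\<Sum>i\<in>{1..n}. of_bool (i \<in> unreq \<omega> a t))"
    using \<omega> by (intro sum.cong) (auto simp: request_sets.unrequested_def[OF request_sets[OF \<omega>]] indicator_def)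
  also have "\<dots> = real (card ({1..n} \<inter> unreq \<omega> a t))"
    by (simp add: sum.inter_filter[symmetric] of_bool_def sum.If_cases Int_def)
  also have "{1..n} \<inter> unreq \<omega> a t = unreq \<omega> a t" using unreq_subset[OF \<omega>] by blast
  finally show ?thesis by simp
qed

lemma card_unreq_measurable: "(\<lambda>\<omega>. real (card (unreq \<omega> a t))) \<in> borel_measurable M"
proof -
  have "(\<lambda>\<omega>. \<Sum>i=1..n. indicator {\<omega>\<in>space M. A \<omega> i \<inter> {a..<t} = {}} \<omega> :: real) \<in> borel_measurable M"
    by (intro borel_measurable_sum borel_measurable_indicator sets_no_request)
  then show ?thesis
    by (rule measurable_cong[THEN iffD1, rotated]) (simp only: card_unreq_eq)
qed

text \<open>Given the weights, the indicators of \<open>A i \<inter> {a..<t} = {}\<close> are independent, so that the second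
  moments of their sum and of the sum of the conditional expectations differ by at most \<open>n\<close>.\<close>

lemma second_moment_unreq:
  assumes a: "0 \<le> a" "a \<le> t"
  shows "(LINT \<omega>|M. (real (card (unreq \<omega> a t)) - c)\<^sup>2) \<le> (LINT \<omega>|M. ((\<Sum>i=1..n. q (t - a) \<omega> i) - c)\<^sup>2) + real n"
proof -
  let ?I = "\<lambda>i \<omega>. indicator {\<omega>\<in>space M. A \<omega> i \<inter> {a..<t} = {}} \<omega> :: real"
  let ?q = "\<lambda>i \<omega>. q (t - a) \<omega> i"
  have tau: "0 \<le> t - a" using a by simp
  have expand: "(LINT \<omega>|M. ((\<Sum>i\<in>{1..n}. X i \<omega>) - c)\<^sup>2) =
      (\<Sum>i\<in>{1..n}. \<Sum>l\<in>{1..n}. LINT \<omega>|M. X i \<omega> * X l \<omega>) - 2 * c * (\<Sum>i\<in>{1..n}. LINT \<omega>|M. X i \<omega>) + c\<^sup>2"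
    if Xm: "\<And>i. i \<in> {1..n} \<Longrightarrow> X i \<in> borel_measurable M"
      and Xb: "\<And>i \<omega>. i \<in> {1..n} \<Longrightarrow> \<omega> \<in> space M \<Longrightarrow> 0 \<le> X i \<omega> \<and> X i \<omega> \<le> 1" for X :: "nat \<Rightarrow> 'a \<Rightarrow> real"
  proof -
    have i1: "integrable M (X i)" if "i \<in> {1..n}" for i
      by (rule integrable_const_bound[where B = 1]) (use Xm[OF that] Xb[OF that] in auto)
    have i2: "integrable M (\<lambda>\<omega>. X i \<omega> * X l \<omega>)" if "i \<in> {1..n}" "l \<in> {1..n}" for i l
    proof (rule integrable_const_bound[where B = 1])
      show "AE \<omega> in M. norm (X i \<omega> * X l \<omega>) \<le> 1"
        using Xb[OF that(1)] Xb[OF that(2)] by (intro AE_I2) (auto simp: abs_mult intro!: mult_le_one)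
    qed (intro borel_measurable_times Xm that)
    have "(LINT \<omega>|M. ((\<Sum>i\<in>{1..n}. X i \<omega>) - c)\<^sup>2) =
      (LINT \<omega>|M. (\<Sum>i\<in>{1..n}. \<Sum>l\<in>{1..n}. X i \<omega> * X l \<omega>) - 2 * c * (\<Sum>i\<in>{1..n}. X i \<omega>) + c\<^sup>2)"
    proof (rule Bochner_Integration.integral_cong[OF refl])
      have square: "(S - c)\<^sup>2 = S * S - 2 * c * S + c\<^sup>2" for S :: real
        by (simp add: power2_eq_square algebra_simps)
      show "((\<Sum>i\<in>{1..n}. X i \<omega>) - c)\<^sup>2 =
          (\<Sum>i\<in>{1..n}. \<Sum>l\<in>{1..n}. X i \<omega> * X l \<omega>) - 2 * c * (\<Sum>i\<in>{1..n}. X i \<omega>) + c\<^sup>2" for \<omega>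
        unfolding square sum_product ..
    qed
    also have "\<dots> = (LINT \<omega>|M. (\<Sum>i\<in>{1..n}. \<Sum>l\<in>{1..n}. X i \<omega> * X l \<omega>)) - 2 * c * (LINT \<omega>|M. (\<Sum>i\<in>{1..n}. X i \<omega>)) + c\<^sup>2"
    proof -
      have 1: "integrable M (\<lambda>\<omega>. \<Sum>i\<in>{1..n}. \<Sum>l\<in>{1..n}. X i \<omega> * X l \<omega>)"
        by (intro Bochner_Integration.integrable_sum i2)
      have 2: "integrable M (\<lambda>\<omega>. 2 * c * (\<Sum>i\<in>{1..n}. X i \<omega>))"
        by (intro integrable_mult_right Bochner_Integration.integrable_sum i1)
      show ?thesis
        using Bochner_Integration.integral_add[OF Bochner_Integration.integrable_diff[OF 1 2], of "\<lambda>_. c\<^sup>2"]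
          Bochner_Integration.integral_diff[OF 1 2] prob_space by simp
    qed
    also have "(LINT \<omega>|M. (\<Sum>i\<in>{1..n}. \<Sum>l\<in>{1..n}. X i \<omega> * X l \<omega>)) = (\<Sum>i\<in>{1..n}. \<Sum>l\<in>{1..n}. LINT \<omega>|M. X i \<omega> * X l \<omega>)"
    proof -
      have "(LINT \<omega>|M. (\<Sum>i\<in>{1..n}. \<Sum>l\<in>{1..n}. X i \<omega> * X l \<omega>)) = (\<Sum>i\<in>{1..n}. LINT \<omega>|M. (\<Sum>l\<in>{1..n}. X i \<omega> * X l \<omega>))"
        by (intro Bochner_Integration.integral_sum Bochner_Integration.integrable_sum i2)
      also have "\<dots> = (\<Sum>i\<in>{1..n}. \<Sum>l\<in>{1..n}. LINT \<omega>|M. X i \<omega> * X l \<omega>)"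
        by (intro sum.cong refl Bochner_Integration.integral_sum i2)
      finally show ?thesis .
    qed
    also have "(LINT \<omega>|M. (\<Sum>i\<in>{1..n}. X i \<omega>)) = (\<Sum>i\<in>{1..n}. LINT \<omega>|M. X i \<omega>)"
      by (intro Bochner_Integration.integral_sum i1)
    finally show ?thesis .
  qed
  have E1: "(LINT \<omega>|M. ?I i \<omega>) = (LINT \<omega>|M. ?q i \<omega>)" if "i \<in> {1..n}" for i
    using prob_no_requests[OF a, of "{i}"] that sets_no_request[OF that, of a t]
    by (simp add: sets.Int_space_eq2)
  have E2: "(LINT \<omega>|M. ?I i \<omega> * ?I l \<omega>) \<le> (LINT \<omega>|M. ?q i \<omega> * ?q l \<omega>) + of_bool (i = l)"
    if il: "i \<in> {1..n}" "l \<in> {1..n}" for i l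
  proof -
    let ?E = "{\<omega>\<in>space M. \<forall>j\<in>{i, l}. A \<omega> j \<inter> {a..<t} = {}}"
    have "?E \<in> sets M"
      by (intro sets.sets_Collect_finite_All sets_no_request) (use il in auto)
    then have "(LINT \<omega>|M. ?I i \<omega> * ?I l \<omega>) = prob ?E"
      by (subst Bochner_Integration.integral_cong[of M M _ "indicator ?E"])
         (auto simp: indicator_def sets.Int_space_eq2 intro!: arg_cong[where f = prob])
    also have "\<dots> = (LINT \<omega>|M. (\<Prod>j\<in>{i, l}. ?q j \<omega>))"
      by (rule prob_no_requests[OF a]) (use il in auto)
    also have "\<dots> \<le> (LINT \<omega>|M. ?q i \<omega> * ?q l \<omega>) + of_bool (i = l)"
    proof (cases "i = l")
      case True
      have "(LINT \<omega>|M. ?q i \<omega>) \<le> 1"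
        using prob_no_requests[OF a, of "{i}"] il prob_le_1[of "{\<omega>\<in>space M. \<forall>j\<in>{i}. A \<omega> j \<inter> {a..<t} = {}}"] by simp
      moreover have "0 \<le> (LINT \<omega>|M. ?q i \<omega> * ?q l \<omega>)" by (intro integral_nonneg_AE AE_I2) auto
      moreover have "(LINT \<omega>|M. (\<Prod>j\<in>{i, l}. ?q j \<omega>)) = (LINT \<omega>|M. ?q i \<omega>)" "of_bool (i = l) = (1::real)"
        using True by simp_all
      ultimately show ?thesis by linarith
    qed simp
    finally show ?thesis .
  qed
  have "(LINT \<omega>|M. (real (card (unreq \<omega> a t)) - c)\<^sup>2) = (LINT \<omega>|M. ((\<Sum>i\<in>{1..n}. ?I i \<omega>) - c)\<^sup>2)"
    by (rule Bochner_Integration.integral_cong) (simp_all only: card_unreq_eq)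
  also have "\<dots> = (\<Sum>i\<in>{1..n}. \<Sum>l\<in>{1..n}. LINT \<omega>|M. ?I i \<omega> * ?I l \<omega>) - 2 * c * (\<Sum>i\<in>{1..n}. LINT \<omega>|M. ?I i \<omega>) + c\<^sup>2"
    by (rule expand) (auto intro!: borel_measurable_indicator sets_no_request)
  also have "\<dots> \<le> ((\<Sum>i\<in>{1..n}. \<Sum>l\<in>{1..n}. LINT \<omega>|M. ?q i \<omega> * ?q l \<omega>) + real n) - 2 * c * (\<Sum>i\<in>{1..n}. LINT \<omega>|M. ?q i \<omega>) + c\<^sup>2"
  proof -
    have "(\<Sum>i\<in>{1..n}. \<Sum>l\<in>{1..n}. LINT \<omega>|M. ?I i \<omega> * ?I l \<omega>) \<le>
        (\<Sum>i\<in>{1..n}. \<Sum>l\<in>{1..n}. (LINT \<omega>|M. ?q i \<omega> * ?q l \<omega>) + of_bool (i = l))"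
      by (intro sum_mono E2)
    also have "\<dots> = (\<Sum>i\<in>{1..n}. \<Sum>l\<in>{1..n}. LINT \<omega>|M. ?q i \<omega> * ?q l \<omega>) + (\<Sum>i\<in>{1..n}. \<Sum>l\<in>{1..n}. of_bool (i = l))"
      by (simp only: sum.distrib)
    also have "(\<Sum>i\<in>{1..n}. \<Sum>l\<in>{1..n}. of_bool (i = l) :: real) = (\<Sum>i\<in>{1..n}. 1)"
      by (intro sum.cong refl) (simp add: of_bool_def)
    finally have "(\<Sum>i\<in>{1..n}. \<Sum>l\<in>{1..n}. LINT \<omega>|M. ?I i \<omega> * ?I l \<omega>) \<le>
        (\<Sum>i\<in>{1..n}. \<Sum>l\<in>{1..n}. LINT \<omega>|M. ?q i \<omega> * ?q l \<omega>) + real n" by simp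
    moreover have first: "(\<Sum>i\<in>{1..n}. LINT \<omega>|M. ?I i \<omega>) = (\<Sum>i\<in>{1..n}. LINT \<omega>|M. ?q i \<omega>)"
      by (rule sum.cong[OF refl E1])
    ultimately show ?thesis unfolding first by linarith
  qed
  also have "\<dots> = (LINT \<omega>|M. ((\<Sum>i\<in>{1..n}. ?q i \<omega>) - c)\<^sup>2) + real n"
    by (subst expand) (use q_measurable q_bounds[OF tau] in auto)
  finally show ?thesis .
qed

end

section \<open>Exchangeability and ranks\<close>

text \<open>The rank is a bijection from \<open>g\<close> to \<open>{1..card g}\<close>.\<close>

lemma card_rank_le:
  fixes g :: "nat set"
  assumes g: "finite g" and k: "k \<le> card g"
  shows "card {i\<in>g. card {j\<in>g. j \<le> i} \<le> k} = k"
proof -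
  let ?r = "\<lambda>i. card {j\<in>g. j \<le> i}"
  have mono: "?r i < ?r i'" if "i < i'" "i' \<in> g" for i i'
  proof (rule psubset_card_mono)
    have "i' \<in> {j\<in>g. j \<le> i'}" "i' \<notin> {j\<in>g. j \<le> i}" "{j\<in>g. j \<le> i} \<subseteq> {j\<in>g. j \<le> i'}"
      using that by auto
    then show "{j\<in>g. j \<le> i} \<subset> {j\<in>g. j \<le> i'}" by blast
  qed (use g in simp)
  have inj: "inj_on ?r g"
    by (rule linorder_inj_onI) (use mono in force)+
  have "?r ` g \<subseteq> {1..card g}"
  proof
    fix x assume "x \<in> ?r ` g"
    then obtain i where i: "i \<in> g" "x = ?r i" by auto
    have "0 < ?r i" using i(1) g by (auto simp: card_gt_0_iff)
    moreover have "?r i \<le> card g" using g by (intro card_mono) auto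
    ultimately show "x \<in> {1..card g}" using i by auto
  qed
  then have img: "?r ` g = {1..card g}"
    using card_image[OF inj] by (intro card_subset_eq) auto
  have "?r ` {i\<in>g. ?r i \<le> k} = ?r ` g \<inter> {..k}" by auto
  also have "\<dots> = {1..k}" unfolding img using k by auto
  finally have "card (?r ` {i\<in>g. ?r i \<le> k}) = k" by simp
  moreover have "inj_on ?r {i\<in>g. ?r i \<le> k}" by (rule inj_on_subset[OF inj]) auto
  ultimately show ?thesis by (simp add: card_image)
qed

context request_model
begin

text \<open>By exchangeability the rank of the next object among the unrequested ones is uniform, given the
  set of unrequested objects; the remaining error comes from rounding \<open>c * card g\<close>, and is
  small when there are many unrequested objects.\<close>

lemma joint_weight_large_ranks:
  assumes a: "0 \<le> a" "a \<le> t" and exch: "exchangeable M n w"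
    and c: "0 \<le> c" "c \<le> 1" and d: "0 < d"
  shows "\<bar>(\<Sum>(g, i)\<in>(Pow {1..n} \<times> {1..n}) \<inter> {(g, i). i \<in> g \<and> nat \<lfloor>c * real (card g)\<rfloor> < card {j\<in>g. j \<le> i}}.
        joint_weight (t - a) g i)
      - (1 - c) * (\<Sum>(g, i)\<in>(Pow {1..n} \<times> {1..n}) \<inter> {(g, i). i \<in> g}. joint_weight (t - a) g i)\<bar>
    \<le> \<P>(\<omega> in M. real (card (unreq \<omega> a t)) < d) + 1 / d"
proof -
  let ?V = "Pow {1..n} \<times> {1..n}"
  let ?k = "\<lambda>g :: nat set. nat \<lfloor>c * real (card g)\<rfloor>"
  let ?L = "\<lambda>g. {i\<in>g. ?k g < card {j\<in>g. j \<le> i}}"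
  let ?b = "joint_weight (t - a)"
  have tau: "0 \<le> t - a" using a by simp
  have nested: "(\<Sum>(g, i)\<in>?V \<inter> {(g, i). Q g i}. ?b g i) = (\<Sum>g\<in>Pow {1..n}. \<Sum>i | i \<in> g \<and> Q g i. ?b g i)"
    if Q: "\<And>g i. Q g i \<Longrightarrow> i \<in> g" for Q
  proof -
    have "?V \<inter> {(g, i). Q g i} = (SIGMA g:Pow {1..n}. {i. i \<in> g \<and> Q g i})" using Q by auto
    then show ?thesis by (simp only:) (rule sum.Sigma[symmetric], auto intro: finite_subset)
  qed
  have bound: "\<bar>(\<Sum>i\<in>?L g. ?b g i) - (1 - c) * (\<Sum>i\<in>g. ?b g i)\<bar>
      \<le> (if real (card g) < d then (\<Sum>i\<in>g. ?b g i) else (\<Sum>i\<in>g. ?b g i) / d)"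
    if g: "g \<subseteq> {1..n}" for g
  proof (cases "g = {}")
    case False
    then obtain i0 where i0: "i0 \<in> g" by blast
    have fin: "finite g" using g by (rule finite_subset) simp
    have b: "?b g i = ?b g i0" if "i \<in> g" for i
      by (rule joint_weight_exchange[OF exch g that i0])
    have b0: "0 \<le> ?b g i0" using joint_weight_nonneg[OF tau] g i0 by blast
    have "c * real (card g) \<le> real (card g)" using c by (simp add: mult_left_le_one_le)
    then have k: "?k g \<le> card g" "real (?k g) \<le> c * real (card g)" "c * real (card g) < real (?k g) + 1"
      using c by (auto simp: nat_le_iff floor_le_iff)
    have "card (?L g) = card (g - {i\<in>g. card {j\<in>g. j \<le> i} \<le> ?k g})"
      by (rule arg_cong[where f = card]) auto
    also have "\<dots> = card g - ?k g"
      using fin by (subst card_Diff_subset) (auto simp: card_rank_le[OF fin k(1)])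
    finally have card_L: "real (card (?L g)) = real (card g) - real (?k g)"
      using k(1) by simp
    have sum_g: "(\<Sum>i\<in>g. ?b g i) = real (card g) * ?b g i0"
      using b by simp
    have "(\<Sum>i\<in>?L g. ?b g i) = real (card (?L g)) * ?b g i0"
      using b by simp
    then have "(\<Sum>i\<in>?L g. ?b g i) - (1 - c) * (\<Sum>i\<in>g. ?b g i) = (c * real (card g) - real (?k g)) * ?b g i0"
      unfolding sum_g card_L by (simp add: algebra_simps)
    then have le: "\<bar>(\<Sum>i\<in>?L g. ?b g i) - (1 - c) * (\<Sum>i\<in>g. ?b g i)\<bar> \<le> ?b g i0"
    proof -
      have "\<bar>c * real (card g) - real (?k g)\<bar> \<le> 1" using k(2,3) by linarith
      from mult_right_mono[OF this b0] b0 show ?thesis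
        unfolding \<open>_ = (c * real (card g) - real (?k g)) * ?b g i0\<close> by (simp only: abs_mult abs_of_nonneg mult_1_left)
    qed
    show ?thesis
    proof (cases "real (card g) < d")
      case True
      have "1 \<le> real (card g)" using False fin by (simp add: Suc_le_eq card_gt_0_iff)
      then have "?b g i0 \<le> (\<Sum>i\<in>g. ?b g i)" unfolding sum_g using b0 by (simp add: mult_le_cancel_right1)
      then show ?thesis using le True by simp
    next
      case False
      then have "d * ?b g i0 \<le> (\<Sum>i\<in>g. ?b g i)" unfolding sum_g using b0 by (intro mult_right_mono) auto
      then have "?b g i0 \<le> (\<Sum>i\<in>g. ?b g i) / d" using d by (simp add: pos_le_divide_eq mult.commute)
      then show ?thesis using order_trans[OF le] False by simp
    qed
  qed (use d in simp)
  let ?D = "(\<Sum>(g, i)\<in>?V \<inter> {(g, i). i \<in> g \<and> ?k g < card {j\<in>g. j \<le> i}}. ?b g i)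
      - (1 - c) * (\<Sum>(g, i)\<in>?V \<inter> {(g, i). i \<in> g}. ?b g i)"
  have "?D = (\<Sum>g\<in>Pow {1..n}. (\<Sum>i\<in>?L g. ?b g i) - (1 - c) * (\<Sum>i\<in>g. ?b g i))"
    by (subst (1 2) nested) (auto simp: sum_subtractf sum_distrib_left)
  then have "\<bar>?D\<bar> \<le> (\<Sum>g\<in>Pow {1..n}. if real (card g) < d then (\<Sum>i\<in>g. ?b g i) else (\<Sum>i\<in>g. ?b g i) / d)"
    by (simp only:) (rule order_trans[OF sum_abs sum_mono], use bound in auto)
  also have "\<dots> \<le> (\<Sum>g\<in>Pow {1..n}. (\<Sum>i | i \<in> g \<and> (i \<in> g \<and> real (card g) < d). ?b g i) + (\<Sum>i | i \<in> g \<and> i \<in> g. ?b g i) / d)"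
  proof (rule sum_mono)
    fix g assume "g \<in> Pow {1..n}"
    then have "0 \<le> (\<Sum>i\<in>g. ?b g i)" using joint_weight_nonneg[OF tau] by (intro sum_nonneg) auto
    then show "(if real (card g) < d then (\<Sum>i\<in>g. ?b g i) else (\<Sum>i\<in>g. ?b g i) / d) \<le>
        (\<Sum>i | i \<in> g \<and> (i \<in> g \<and> real (card g) < d). ?b g i) + (\<Sum>i | i \<in> g \<and> i \<in> g. ?b g i) / d"
      using d by simp
  qed
  also have "\<dots> = (\<Sum>(g, i)\<in>?V \<inter> {(g, i). i \<in> g \<and> real (card g) < d}. ?b g i)
      + (\<Sum>(g, i)\<in>?V \<inter> {(g, i). i \<in> g}. ?b g i) / d"
    by (subst (1 2) nested) (auto simp: sum.distrib sum_divide_distrib)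
  also have "\<dots> \<le> \<P>(\<omega> in M. real (card (unreq \<omega> a t)) < d) + 1 / d"
  proof (rule add_mono)
    have "(\<Sum>(g, i)\<in>?V \<inter> {(g, i). i \<in> g \<and> real (card g) < d}. ?b g i)
        \<le> \<P>(\<omega> in M. (unreq \<omega> a t, next_obj \<omega> t) \<in> {(g, i). i \<in> g \<and> real (card g) < d})"
      by (rule sum_joint_weight_le[OF a])
    also have "\<dots> \<le> \<P>(\<omega> in M. real (card (unreq \<omega> a t)) < d)"
      by (rule finite_measure_mono) (use card_unreq_measurable[of a t] in auto)
    finally show "(\<Sum>(g, i)\<in>?V \<inter> {(g, i). i \<in> g \<and> real (card g) < d}. ?b g i)
        \<le> \<P>(\<omega> in M. real (card (unreq \<omega> a t)) < d)" .
    show "(\<Sum>(g, i)\<in>?V \<inter> {(g, i). i \<in> g}. ?b g i) / d \<le> 1 / d"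
      using order_trans[OF sum_joint_weight_le[OF a] prob_le_1] d by (intro divide_right_mono) auto
  qed
  finally show ?thesis .
qed

end

section \<open>Limits for the search cost\<close>

locale mtf_array = lln_array +
  fixes A :: "nat \<Rightarrow> 'a \<Rightarrow> nat \<Rightarrow> real set"
  assumes exchangeable_w: "exchangeable (M n) n (w n)"
    and requests: "poisson_requests (M n) n (w n) (A n)"
begin

lemma model: "request_model (M n) n (w n) (A n)"
  by (intro request_model.intro request_model_axioms.intro weights requests)

text \<open>Time is measured in units of \<open>n * \<mu>\<close>. The last argument of \<open>unreq\<close> is the length of a window that
  ends at the time given by the argument before it.\<close>

abbreviation "horizon n t \<equiv> real n * \<mu> * t"
abbreviation "unreq n \<omega> t u \<equiv> request_sets.unrequested n (A n \<omega>) (horizon n t - horizon n u) (horizon n t)"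
abbreviation "next_obj n \<omega> t \<equiv> next_requested n (A n \<omega>) (horizon n t)"

lemma window:
  assumes "0 < u" "u \<le> t"
  shows "0 \<le> horizon n t - horizon n u" "horizon n t - horizon n u \<le> horizon n t"
  using assms mean_pos by (auto intro!: mult_left_mono mult_nonneg_nonneg)

text \<open>Convergence in mean square: given the weights, the variance of the number of unrequested objects is
  at most \<open>n\<close>, and \<open>n / n\<^sup>2\<close> tends to \<open>0\<close>.\<close>

lemma card_unreq_tends:
  assumes u: "0 < u" "u \<le> t"
  shows "tends_in_prob M (\<lambda>n \<omega>. real (card (unreq n \<omega> t u)) / real n) (\<phi> u)"
proof -
  let ?X = "\<lambda>n \<omega>. real (card (unreq n \<omega> t u)) / real n"
  let ?Q = "\<lambda>n \<omega>. (\<Sum>i=1..n. exp (- (pop n \<omega> i * horizon n u))) / real n"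
  note Q = unrequested_fraction_tends[OF u(1)]
  have Xm: "?X n \<in> borel_measurable (M n)" for n
    by (intro borel_measurable_divide request_model.card_unreq_measurable[OF model] borel_measurable_const)
  have X01: "0 \<le> ?X n \<omega> \<and> ?X n \<omega> \<le> 1" if "\<omega> \<in> space (M n)" for n \<omega>
    using request_sets.finite_unrequested(2)[OF request_model.request_sets[OF model that]]
    by (cases "n = 0") (simp_all add: divide_le_eq_1)
  have Q01: "0 \<le> ?Q n \<omega> \<and> ?Q n \<omega> \<le> 1" if "\<omega> \<in> space (M n)" for n \<omega>
  proof -
    have "(\<Sum>i=1..n. exp (- (pop n \<omega> i * horizon n u))) \<le> (\<Sum>i=1..n. 1)"
      using pop_nonneg[OF _ that] u mean_pos by (intro sum_mono) auto
    then show ?thesis by (cases "n = 0") (simp_all add: divide_le_eq_1 sum_nonneg)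
  qed
  have sq_le: "\<bar>(x - \<phi> u)\<^sup>2\<bar> \<le> 1" if "0 \<le> x \<and> x \<le> 1" for x
  proof -
    have "\<bar>x - \<phi> u\<bar> \<le> 1" using that phi_pos[of u] phi_less_1[of u] u by auto
    then show ?thesis by (simp add: abs_square_le_1)
  qed
  have "tends_in_prob M (\<lambda>n \<omega>. (?Q n \<omega> - \<phi> u)\<^sup>2) 0"
  proof (rule tends_in_prob_transfer[OF prob_space_M Q Q])
    show "(\<lambda>\<omega>. (?Q n \<omega> - \<phi> u)\<^sup>2) \<in> borel_measurable (M n)" for n
      by (intro borel_measurable_power borel_measurable_diff tends_in_probD(1)[OF Q] borel_measurable_const)
    show "\<exists>\<delta>>0. \<forall>n\<ge>1. \<forall>\<omega>\<in>space (M n). \<bar>?Q n \<omega> - \<phi> u\<bar> < \<delta> \<longrightarrow> \<bar>?Q n \<omega> - \<phi> u\<bar> < \<delta> \<longrightarrow>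
        \<bar>(?Q n \<omega> - \<phi> u)\<^sup>2 - 0\<bar> < \<epsilon>" if \<epsilon>: "0 < \<epsilon>" for \<epsilon>
    proof (intro exI[of _ "sqrt \<epsilon>"] conjI allI ballI impI)
      show "0 < sqrt \<epsilon>" using \<epsilon> by simp
      fix n \<omega> assume "\<bar>?Q n \<omega> - \<phi> u\<bar> < sqrt \<epsilon>"
      then have "\<bar>?Q n \<omega> - \<phi> u\<bar>\<^sup>2 < (sqrt \<epsilon>)\<^sup>2" by (intro power_strict_mono) auto
      then show "\<bar>(?Q n \<omega> - \<phi> u)\<^sup>2 - 0\<bar> < \<epsilon>" using \<epsilon> by simp
    qed
  qed
  from tends_in_prob_expectation[OF prob_space_M this, of 1]
  have "(\<lambda>n. LINT \<omega>|M n. (?Q n \<omega> - \<phi> u)\<^sup>2) \<longlonglongrightarrow> 0"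
    using sq_le[OF Q01] by blast
  then have bound0: "(\<lambda>n. (LINT \<omega>|M n. (?Q n \<omega> - \<phi> u)\<^sup>2) + 1 / real n) \<longlonglongrightarrow> 0"
    using tendsto_add[OF _ lim_const_over_n[of "1::real"]] by fastforce
  have int: "integrable (M n) (\<lambda>\<omega>. (?X n \<omega> - \<phi> u)\<^sup>2)" for n
  proof -
    interpret Mn: prob_space "M n" by (rule prob_space_M)
    show ?thesis
    proof (rule Mn.integrable_const_bound[where B = 1])
      show "AE \<omega> in M n. norm ((?X n \<omega> - \<phi> u)\<^sup>2) \<le> 1"
        using sq_le[OF X01] by (intro AE_I2) (simp only: real_norm_def)
      show "(\<lambda>\<omega>. (?X n \<omega> - \<phi> u)\<^sup>2) \<in> borel_measurable (M n)"
        by (intro borel_measurable_power borel_measurable_diff Xm borel_measurable_const)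
    qed
  qed
  have "(\<lambda>n. LINT \<omega>|M n. (?X n \<omega> - \<phi> u)\<^sup>2) \<longlonglongrightarrow> 0"
  proof (rule Lim_null_comparison[OF _ bound0])
    show "\<forall>\<^sub>F n in sequentially. norm (LINT \<omega>|M n. (?X n \<omega> - \<phi> u)\<^sup>2)
        \<le> (LINT \<omega>|M n. (?Q n \<omega> - \<phi> u)\<^sup>2) + 1 / real n"
      using eventually_ge_at_top[of 1]
    proof eventually_elim
      case (elim n)
      have scale: "(LINT \<omega>|M n. (Y \<omega> / real n - \<phi> u)\<^sup>2) = (LINT \<omega>|M n. (Y \<omega> - real n * \<phi> u)\<^sup>2) / (real n)\<^sup>2"
        for Y :: "'a \<Rightarrow> real"
      proof -
        have "(y / real n - \<phi> u)\<^sup>2 = (y - real n * \<phi> u)\<^sup>2 / (real n)\<^sup>2" for y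
          using elim by (simp add: power_divide[symmetric] diff_divide_distrib)
        then show ?thesis by (simp only: integral_divide_zero)
      qed
      have "(LINT \<omega>|M n. (real (card (unreq n \<omega> t u)) - real n * \<phi> u)\<^sup>2)
          \<le> (LINT \<omega>|M n. ((\<Sum>i=1..n. exp (- (pop n \<omega> i * horizon n u))) - real n * \<phi> u)\<^sup>2) + real n"
        using request_model.second_moment_unreq[OF model[of n] window[OF u, of n], of "real n * \<phi> u"] by simp
      then have "(LINT \<omega>|M n. (?X n \<omega> - \<phi> u)\<^sup>2)
          \<le> ((LINT \<omega>|M n. ((\<Sum>i=1..n. exp (- (pop n \<omega> i * horizon n u))) - real n * \<phi> u)\<^sup>2) + real n) / (real n)\<^sup>2"
        unfolding scale by (rule divide_right_mono) simp
      also have "\<dots> = (LINT \<omega>|M n. (?Q n \<omega> - \<phi> u)\<^sup>2) + 1 / real n"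
        unfolding scale using elim by (simp add: add_divide_distrib power2_eq_square)
      finally show ?case by simp
    qed
  qed
  then show ?thesis
  proof (rule tends_in_probI_expectation[OF prob_space_M Xm int, rotated])
    show "\<exists>\<delta>>0. \<forall>n\<ge>1. \<forall>\<omega>\<in>space (M n). \<epsilon> \<le> \<bar>?X n \<omega> - \<phi> u\<bar> \<longrightarrow> \<delta> \<le> (?X n \<omega> - \<phi> u)\<^sup>2" if \<epsilon>: "0 < \<epsilon>" for \<epsilon>
    proof (intro exI[of _ "\<epsilon>\<^sup>2"] conjI allI ballI impI)
      fix n \<omega> assume "\<epsilon> \<le> \<bar>?X n \<omega> - \<phi> u\<bar>"
      then have "\<epsilon>\<^sup>2 \<le> \<bar>?X n \<omega> - \<phi> u\<bar>\<^sup>2" using \<epsilon> by (intro power_mono) auto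
      then show "\<epsilon>\<^sup>2 \<le> (?X n \<omega> - \<phi> u)\<^sup>2" by simp
    qed (use \<epsilon> in simp)
  qed simp
qed

lemma size_biased_expectation:
  assumes u: "0 < u"
  shows "(\<lambda>n. LINT \<omega>|M n. (\<Sum>i=1..n. pop n \<omega> i * exp (- (pop n \<omega> i * horizon n u)))) \<longlonglongrightarrow> mom 1 u / \<mu>"
proof (rule tends_in_prob_expectation[OF prob_space_M size_biased_tends[OF u], of 1])
  fix n \<omega> assume \<omega>: "\<omega> \<in> space (M n)"
  have "(\<Sum>i=1..n. pop n \<omega> i * exp (- (pop n \<omega> i * horizon n u))) \<le> (\<Sum>i=1..n. pop n \<omega> i)"
    using pop_nonneg[OF _ \<omega>] u mean_pos by (intro sum_mono mult_left_le) auto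
  moreover have "0 \<le> (\<Sum>i=1..n. pop n \<omega> i * exp (- (pop n \<omega> i * horizon n u)))"
    using pop_nonneg[OF _ \<omega>] by (intro sum_nonneg mult_nonneg_nonneg) auto
  ultimately show "\<bar>\<Sum>i=1..n. pop n \<omega> i * exp (- (pop n \<omega> i * horizon n u))\<bar> \<le> 1"
    using sum_pop_le_1[OF \<omega>] by linarith
qed

text \<open>By \<open>prob_pair_approx\<close>, up to the probability that all weights vanish this is the expectation of
  the sum of \<open>pop i * q i\<close>.\<close>

lemma prob_next_unrequested:
  assumes u: "0 < u" "u \<le> t"
  shows "(\<lambda>n. \<P>(\<omega> in M n. next_obj n \<omega> t \<in> unreq n \<omega> t u)) \<longlonglongrightarrow> mom 1 u / \<mu>"
proof -
  let ?p = "\<lambda>n. \<P>(\<omega> in M n. next_obj n \<omega> t \<in> unreq n \<omega> t u)"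
  let ?e = "\<lambda>n. LINT \<omega>|M n. (\<Sum>i=1..n. pop n \<omega> i * exp (- (pop n \<omega> i * horizon n u)))"
  have "\<bar>?p n - ?e n\<bar> \<le> \<P>(\<omega> in M n. (\<Sum>i=1..n. w n \<omega> i) = 0)" for n
    using request_model.prob_pair_approx[OF model[of n] window[OF u, of n], of "{(g, i). i \<in> g}"]
      request_model.sum_joint_weight_containing[OF model, of "horizon n u" n] u mean_pos
    by simp
  then have "(\<lambda>n. ?p n - ?e n) \<longlonglongrightarrow> 0"
    by (intro Lim_null_comparison[OF _ prob_all_zero_tends]) simp
  from tendsto_add[OF this size_biased_expectation[OF u(1)]] show ?thesis by simp
qed

lemma sets_next_unrequested: "{\<omega>\<in>space (M n). next_obj n \<omega> t \<in> unreq n \<omega> t u} \<in> sets (M n)"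
  using request_model.sets_pair[OF model, of n "horizon n t - horizon n u" "horizon n t" "{(g, i). i \<in> g}"] by simp

lemma prob_next_requested:
  assumes u: "0 < u" "u \<le> t"
  shows "(\<lambda>n. \<P>(\<omega> in M n. next_obj n \<omega> t \<notin> unreq n \<omega> t u)) \<longlonglongrightarrow> 1 - mom 1 u / \<mu>"
proof -
  have "\<P>(\<omega> in M n. next_obj n \<omega> t \<notin> unreq n \<omega> t u) =
      1 - \<P>(\<omega> in M n. next_obj n \<omega> t \<in> unreq n \<omega> t u)" for n
    by (rule prob_space.prob_neg[OF prob_space_M sets_next_unrequested])
  then show ?thesis
    using tendsto_diff[OF tendsto_const[of 1] prob_next_unrequested[OF u]] by (simp only:)
qed

lemma AE_no_ties:
  assumes "1 \<le> n" "0 < t"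
  shows "AE \<omega> in M n. request_sets.no_ties n (A n \<omega>) (horizon n t)"
  by (rule request_model.AE_no_ties[OF model]) (use assms mean_pos in simp)

abbreviation "cost n \<omega> t \<equiv> search_cost n id (A n \<omega>) (horizon n t)"

lemma cost_measurable:
  assumes "0 < t" shows "(\<lambda>\<omega>. real (cost n \<omega> t) / real n) \<in> borel_measurable (M n)"
proof (cases "n = 0")
  case False
  then show ?thesis
    using assms mean_pos by (intro borel_measurable_divide request_model.search_cost_measurable[OF model]) auto
qed simp

text \<open>Ties have probability \<open>0\<close>, so that events about the cost only have to be described without them.\<close>

lemma prob_cost_eq:
  assumes n: "1 \<le> n" and t: "0 < t" and Y: "Y \<in> borel_measurable (M n)"
    and Q: "{\<omega>\<in>space (M n). Q \<omega>} \<in> sets (M n)"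
    and eq: "\<And>\<omega>. \<omega> \<in> space (M n) \<Longrightarrow> request_sets.no_ties n (A n \<omega>) (horizon n t) \<Longrightarrow>
      real (cost n \<omega> t) \<le> real n * Y \<omega> \<longleftrightarrow> Q \<omega>"
  shows "\<P>(\<omega> in M n. real (cost n \<omega> t) / real n \<le> Y \<omega>) = \<P>(\<omega> in M n. Q \<omega>)"
proof (rule measure_eq_AE)
  show "AE \<omega> in M n. \<omega> \<in> {\<omega>\<in>space (M n). real (cost n \<omega> t) / real n \<le> Y \<omega>} \<longleftrightarrow> \<omega> \<in> {\<omega>\<in>space (M n). Q \<omega>}"
    using AE_no_ties[OF n t] AE_space
  proof eventually_elim
    case (elim \<omega>)
    have "real (cost n \<omega> t) / real n \<le> Y \<omega> \<longleftrightarrow> real (cost n \<omega> t) \<le> real n * Y \<omega>"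
      using n by (simp add: pos_divide_le_eq mult.commute)
    then show ?case using eq[OF elim(2,1)] elim(2) by simp
  qed
  show "{\<omega>\<in>space (M n). real (cost n \<omega> t) / real n \<le> Y \<omega>} \<in> sets (M n)"
    using cost_measurable[OF t, of n] Y by measurable
qed (rule Q)

text \<open>The random points are the fractions of objects that are requested in the window of length \<open>n * \<mu> * u\<close>.\<close>

lemma cost_cdf_requested:
  assumes u: "0 < u" "u \<le> t"
  shows "\<exists>Y. tends_in_prob M Y (1 - \<phi> u) \<and>
    (\<lambda>n. \<P>(\<omega> in M n. real (cost n \<omega> t) / real n \<le> Y n \<omega>)) \<longlonglongrightarrow> 1 - mom 1 u / \<mu>"
proof (intro exI conjI)
  let ?Y = "\<lambda>n \<omega>. 1 - real (card (unreq n \<omega> t u)) / real n"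
  have Ym: "?Y n \<in> borel_measurable (M n)" for n
    by (intro borel_measurable_diff borel_measurable_divide request_model.card_unreq_measurable[OF model] borel_measurable_const)
  show "tends_in_prob M ?Y (1 - \<phi> u)"
    by (rule tends_in_prob_transfer[OF prob_space_M card_unreq_tends[OF u] card_unreq_tends[OF u] Ym])
       (auto intro!: exI simp: abs_minus_commute)
  have eq: "\<P>(\<omega> in M n. real (cost n \<omega> t) / real n \<le> ?Y n \<omega>) =
      \<P>(\<omega> in M n. next_obj n \<omega> t \<notin> unreq n \<omega> t u)" if n: "1 \<le> n" for n
  proof (rule prob_cost_eq[OF n _ Ym])
    show "0 < t" using u by simp
    show "{\<omega>\<in>space (M n). next_obj n \<omega> t \<notin> unreq n \<omega> t u} \<in> sets (M n)"
      by (rule sets.sets_Collect_neg[OF sets_next_unrequested])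
    fix \<omega> assume \<omega>: "\<omega> \<in> space (M n)" and nt: "request_sets.no_ties n (A n \<omega>) (horizon n t)"
    note rs = request_model.request_sets[OF model \<omega>]
    have "real n * ?Y n \<omega> = real (n - card (unreq n \<omega> t u))"
      using n request_sets.finite_unrequested(2)[OF rs] by (simp add: right_diff_distrib of_nat_diff)
    then show "real (cost n \<omega> t) \<le> real n * ?Y n \<omega> \<longleftrightarrow> next_obj n \<omega> t \<notin> unreq n \<omega> t u"
      using request_sets.search_cost_le_iff[OF rs nt window[OF u]] by (simp only: of_nat_le_iff)
  qed
  show "(\<lambda>n. \<P>(\<omega> in M n. real (cost n \<omega> t) / real n \<le> ?Y n \<omega>)) \<longlonglongrightarrow> 1 - mom 1 u / \<mu>"
  proof (rule Lim_transform_eventually[OF prob_next_requested[OF u]])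
    show "\<forall>\<^sub>F n in sequentially. \<P>(\<omega> in M n. next_obj n \<omega> t \<notin> unreq n \<omega> t u) =
        \<P>(\<omega> in M n. real (cost n \<omega> t) / real n \<le> ?Y n \<omega>)"
      using eventually_ge_at_top[of 1] by eventually_elim (simp only: eq)
  qed
qed

text \<open>An unrequested next object is behind all requested ones, and its rank among the unrequested ones is
  uniform. The random points therefore count the requested objects and the fraction \<open>c\<close> of the others.\<close>

lemma cost_cdf_unrequested:
  assumes t: "0 < t" and c: "0 \<le> c" "c \<le> 1"
  shows "\<exists>Y. tends_in_prob M Y (1 - \<phi> t + c * \<phi> t) \<and>
    (\<lambda>n. \<P>(\<omega> in M n. real (cost n \<omega> t) / real n \<le> Y n \<omega>))
      \<longlonglongrightarrow> 1 - mom 1 t / \<mu> + c * (mom 1 t / \<mu>)"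
proof (intro exI conjI)
  note tt = t order_refl[of t]
  let ?C = "\<lambda>n \<omega>. real (card (unreq n \<omega> t t))"
  let ?Y = "\<lambda>n \<omega>. 1 - ?C n \<omega> / real n + real (nat \<lfloor>c * ?C n \<omega>\<rfloor>) / real n"
  have Cm: "?C n \<in> borel_measurable (M n)" for n
    by (rule request_model.card_unreq_measurable[OF model])
  have Ym: "?Y n \<in> borel_measurable (M n)" for n
  proof -
    have "(\<lambda>\<omega>. real (nat \<lfloor>c * ?C n \<omega>\<rfloor>)) \<in> borel_measurable (M n)"
      by (rule measurable_compose[OF Cm[of n], where g = "\<lambda>x. real (nat \<lfloor>c * x\<rfloor>)"]) measurable
    then show ?thesis
      by (intro borel_measurable_add borel_measurable_diff borel_measurable_divide Cm borel_measurable_const)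
  qed
  note lim = card_unreq_tends[OF tt]
  have inv_n: "(\<lambda>n. 1 / real n) \<longlonglongrightarrow> 0" by (rule lim_const_over_n)
  have floor: "real (nat \<lfloor>c * real m\<rfloor>) \<le> c * real m" "c * real m < real (nat \<lfloor>c * real m\<rfloor>) + 1"
    "nat \<lfloor>c * real m\<rfloor> \<le> m" for m :: nat
  proof -
    have "0 \<le> c * real m" "c * real m \<le> real m" using c by (auto simp: mult_left_le_one_le)
    then show "real (nat \<lfloor>c * real m\<rfloor>) \<le> c * real m" "c * real m < real (nat \<lfloor>c * real m\<rfloor>) + 1"
      "nat \<lfloor>c * real m\<rfloor> \<le> m" by (auto simp: nat_le_iff floor_le_iff)
  qed
  show "tends_in_prob M ?Y (1 - \<phi> t + c * \<phi> t)"
  proof (rule tends_in_prob_transfer[OF prob_space_M lim tends_in_prob_deterministic[OF inv_n] Ym])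
    fix \<epsilon> :: real assume \<epsilon>: "0 < \<epsilon>"
    show "\<exists>\<delta>>0. \<forall>n\<ge>1. \<forall>\<omega>\<in>space (M n). \<bar>?C n \<omega> / real n - \<phi> t\<bar> < \<delta> \<longrightarrow> \<bar>1 / real n - 0\<bar> < \<delta> \<longrightarrow>
        \<bar>?Y n \<omega> - (1 - \<phi> t + c * \<phi> t)\<bar> < \<epsilon>"
    proof (intro exI[of _ "\<epsilon> / 3"] conjI allI ballI impI)
      fix n :: nat and \<omega> assume n: "1 \<le> n" and 1: "\<bar>?C n \<omega> / real n - \<phi> t\<bar> < \<epsilon> / 3" and 2: "\<bar>1 / real n - 0\<bar> < \<epsilon> / 3"
      define x where "x = ?C n \<omega> / real n"
      define y where "y = real (nat \<lfloor>c * ?C n \<omega>\<rfloor>) / real n"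
      have x: "\<bar>x - \<phi> t\<bar> < \<epsilon> / 3" using 1 by (simp add: x_def)
      have cx: "c * x = c * ?C n \<omega> / real n" by (simp add: x_def)
      have "y \<le> c * x" unfolding cx y_def by (intro divide_right_mono floor) simp
      moreover have "c * x \<le> (real (nat \<lfloor>c * ?C n \<omega>\<rfloor>) + 1) / real n"
        unfolding cx using floor(2)[of "card (unreq n \<omega> t t)"] by (intro divide_right_mono) auto
      then have "c * x \<le> y + 1 / real n" by (simp add: y_def add_divide_distrib)
      ultimately have y: "\<bar>y - c * x\<bar> < \<epsilon> / 3" using 2 by simp
      have "\<bar>c * (x - \<phi> t)\<bar> \<le> \<bar>x - \<phi> t\<bar>" using c by (simp add: abs_mult mult_left_le_one_le)
      then have "\<bar>c * (x - \<phi> t)\<bar> < \<epsilon> / 3" using x by (rule le_less_trans)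
      then have "\<bar>c * x - c * \<phi> t\<bar> < \<epsilon> / 3" by (simp only: right_diff_distrib)
      then have "\<bar>(1 - x + y) - (1 - \<phi> t + c * \<phi> t)\<bar> < \<epsilon>" using x y by linarith
      then show "\<bar>?Y n \<omega> - (1 - \<phi> t + c * \<phi> t)\<bar> < \<epsilon>" by (simp only: x_def y_def)
    qed (use \<epsilon> in simp)
  qed
  let ?Q = "{(g, i). i \<in> g \<and> nat \<lfloor>c * real (card g)\<rfloor> < card {j\<in>g. j \<le> i}}"
  let ?q = "\<lambda>n. \<P>(\<omega> in M n. (unreq n \<omega> t t, next_obj n \<omega> t) \<in> ?Q)"
  let ?e = "\<lambda>n. LINT \<omega>|M n. (\<Sum>i=1..n. pop n \<omega> i * exp (- (pop n \<omega> i * horizon n t)))"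
  have eq: "\<P>(\<omega> in M n. real (cost n \<omega> t) / real n \<le> ?Y n \<omega>) = 1 - ?q n" if n: "1 \<le> n" for n
  proof -
    have "\<P>(\<omega> in M n. real (cost n \<omega> t) / real n \<le> ?Y n \<omega>) =
        \<P>(\<omega> in M n. (unreq n \<omega> t t, next_obj n \<omega> t) \<notin> ?Q)"
    proof (rule prob_cost_eq[OF n t Ym])
      show "{\<omega>\<in>space (M n). (unreq n \<omega> t t, next_obj n \<omega> t) \<notin> ?Q} \<in> sets (M n)"
        by (intro sets.sets_Collect_neg request_model.sets_pair[OF model])
      fix \<omega> assume \<omega>: "\<omega> \<in> space (M n)" and nt: "request_sets.no_ties n (A n \<omega>) (horizon n t)"
      note rs = request_model.request_sets[OF model \<omega>]
      let ?U = "unreq n \<omega> t t"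
      have U: "?U = request_sets.unrequested n (A n \<omega>) 0 (horizon n t)" by simp
      have "real n * (1 - real k / real n + real j / real n) = real (n - k + j)" if "k \<le> n" for k j
        using n that by (simp only: of_nat_add of_nat_diff) (simp add: field_simps)
      from this[OF request_sets.finite_unrequested(2)[OF rs]]
      have "real n * ?Y n \<omega> = real (n - card ?U + nat \<lfloor>c * ?C n \<omega>\<rfloor>)" .
      then have "real (cost n \<omega> t) \<le> real n * ?Y n \<omega> \<longleftrightarrow> cost n \<omega> t \<le> n - card ?U + nat \<lfloor>c * ?C n \<omega>\<rfloor>"
        by (simp only: of_nat_le_iff)
      also have "\<dots> \<longleftrightarrow> (next_obj n \<omega> t \<in> ?U \<longrightarrow> card {j\<in>?U. j \<le> next_obj n \<omega> t} \<le> nat \<lfloor>c * ?C n \<omega>\<rfloor>)"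
        unfolding U by (rule request_sets.search_cost_le_rank_iff[OF rs nt _ floor(3)]) (use t mean_pos in simp)
      finally show "real (cost n \<omega> t) \<le> real n * ?Y n \<omega> \<longleftrightarrow> (?U, next_obj n \<omega> t) \<notin> ?Q"
        by (auto simp: not_less)
    qed
    also have "\<dots> = 1 - ?q n"
      by (rule prob_space.prob_neg[OF prob_space_M request_model.sets_pair[OF model]])
    finally show ?thesis .
  qed
  let ?z = "\<lambda>n. \<P>(\<omega> in M n. (\<Sum>i=1..n. w n \<omega> i) = 0)"
  let ?d = "\<lambda>n. \<P>(\<omega> in M n. \<phi> t / 2 \<le> \<bar>?C n \<omega> / real n - \<phi> t\<bar>)"
  have pt: "0 < \<phi> t" using phi_pos[of t] t by simp
  have bound: "\<bar>?q n - (1 - c) * ?e n\<bar> \<le> ?z n + (?d n + 1 / real n * (2 / \<phi> t))" if n: "1 \<le> n" for n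
  proof -
    \<comment> \<open>About half of the expected number of unrequested objects: fewer are unlikely, and with more the rounding
      error is negligible.\<close>
    let ?r = "real n * (\<phi> t / 2)"
    let ?small = "\<P>(\<omega> in M n. ?C n \<omega> < ?r)"
    have r: "0 < ?r" using pt n by simp
    have "?small \<le> ?d n"
    proof (rule finite_measure.finite_measure_mono[OF prob_space.finite_measure[OF prob_space_M]])
      show "{\<omega>\<in>space (M n). ?C n \<omega> < ?r} \<subseteq> {\<omega>\<in>space (M n). \<phi> t / 2 \<le> \<bar>?C n \<omega> / real n - \<phi> t\<bar>}"
      proof safe
        fix \<omega> assume "?C n \<omega> < ?r"
        then have "?C n \<omega> / real n < \<phi> t / 2" using n by (simp add: pos_divide_less_eq mult.commute)
        then show "\<phi> t / 2 \<le> \<bar>?C n \<omega> / real n - \<phi> t\<bar>" by linarith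
      qed
      show "{\<omega>\<in>space (M n). \<phi> t / 2 \<le> \<bar>?C n \<omega> / real n - \<phi> t\<bar>} \<in> sets (M n)"
        using Cm[of n] by measurable
    qed
    moreover have "\<bar>?q n - (1 - c) * ?e n\<bar> \<le> ?z n + (?small + 1 / ?r)"
    proof -
      note 1 = request_model.prob_pair_approx[OF model[of n] window[OF tt, of n], of ?Q]
      note 2 = request_model.joint_weight_large_ranks[OF model[of n] window[OF tt, of n] exchangeable_w c r]
      have e: "(\<Sum>(g, i)\<in>(Pow {1..n} \<times> {1..n}) \<inter> {(g, i). i \<in> g}.
          request_model.joint_weight (M n) n (w n) (horizon n t - (horizon n t - horizon n t)) g i) = ?e n"
        using request_model.sum_joint_weight_containing[OF model, of "horizon n t" n] t mean_pos by simp
      show ?thesis using 1 2 unfolding e by linarith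
    qed
    moreover have "1 / ?r = 1 / real n * (2 / \<phi> t)" by simp
    ultimately show ?thesis by linarith
  qed
  have "(\<lambda>n. ?z n + (?d n + 1 / real n * (2 / \<phi> t))) \<longlonglongrightarrow> 0 + (0 + 0 * (2 / \<phi> t))"
    using pt by (intro tendsto_add tendsto_mult prob_all_zero_tends tends_in_probD(2)[OF lim] inv_n tendsto_const) simp
  then have "(\<lambda>n. ?z n + (?d n + 1 / real n * (2 / \<phi> t))) \<longlonglongrightarrow> 0" by simp
  then have "(\<lambda>n. ?q n - (1 - c) * ?e n) \<longlonglongrightarrow> 0"
  proof (rule Lim_null_comparison[rotated])
    show "\<forall>\<^sub>F n in sequentially. norm (?q n - (1 - c) * ?e n) \<le> ?z n + (?d n + 1 / real n * (2 / \<phi> t))"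
      using eventually_ge_at_top[of 1] by eventually_elim (simp only: real_norm_def bound)
  qed
  from tendsto_add[OF this tendsto_mult[OF tendsto_const size_biased_expectation[OF t]], of "1 - c"]
  have "?q \<longlonglongrightarrow> (1 - c) * (mom 1 t / \<mu>)" by simp
  from tendsto_diff[OF tendsto_const this, of 1]
  have "(\<lambda>n. 1 - ?q n) \<longlonglongrightarrow> 1 - (1 - c) * (mom 1 t / \<mu>)" .
  moreover have "1 - (1 - c) * x = 1 - x + c * x" for x :: real by (simp add: algebra_simps)
  ultimately have "(\<lambda>n. 1 - ?q n) \<longlonglongrightarrow> 1 - mom 1 t / \<mu> + c * (mom 1 t / \<mu>)" by (simp only:)
  then show "(\<lambda>n. \<P>(\<omega> in M n. real (cost n \<omega> t) / real n \<le> ?Y n \<omega>))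
      \<longlonglongrightarrow> 1 - mom 1 t / \<mu> + c * (mom 1 t / \<mu>)"
  proof (rule Lim_transform_eventually)
    show "\<forall>\<^sub>F n in sequentially. 1 - ?q n = \<P>(\<omega> in M n. real (cost n \<omega> t) / real n \<le> ?Y n \<omega>)"
      using eventually_ge_at_top[of 1] by eventually_elim (simp only: eq)
  qed
qed

lemma cost_cdf_negative:
  assumes y: "y < 0"
  shows "\<P>(\<omega> in M n. real (cost n \<omega> t) / real n \<le> y) = 0"
proof -
  have "{\<omega>\<in>space (M n). real (cost n \<omega> t) / real n \<le> y} = {}"
    using y by (auto simp: not_le intro: less_le_trans)
  then show ?thesis by (simp only: measure_empty)
qed

lemma cost_cdf_ge_1:
  assumes t: "0 < t" and y: "1 \<le> y" and n: "1 \<le> n"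
  shows "\<P>(\<omega> in M n. real (cost n \<omega> t) / real n \<le> y) = 1"
proof -
  have "\<P>(\<omega> in M n. real (cost n \<omega> t) / real n \<le> y) = \<P>(\<omega> in M n. True)"
  proof (rule prob_cost_eq[OF n t])
    fix \<omega> assume \<omega>: "\<omega> \<in> space (M n)" and nt: "request_sets.no_ties n (A n \<omega>) (horizon n t)"
    have "cost n \<omega> t \<le> n"
      by (rule request_sets.search_cost_le[OF request_model.request_sets[OF model \<omega>] nt]) (use t mean_pos in simp)
    then have "real (cost n \<omega> t) \<le> real n * 1" by simp
    also have "\<dots> \<le> real n * y" using y by (intro mult_left_mono) auto
    finally show "real (cost n \<omega> t) \<le> real n * y \<longleftrightarrow> True" by simp
  qed auto
  then show ?thesis using prob_space.prob_space[OF prob_space_M, of n] by simp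
qed

text \<open>The cost is positive whenever there is a next object, so that only its membership in the unrequested
  set counts.\<close>

lemma prob_cost_out:
  assumes t: "0 < t"
  shows "(\<lambda>n. \<P>(\<omega> in M n. 0 < search_cost_out n id (A n \<omega>) (horizon n t))) \<longlonglongrightarrow> mom 1 t / \<mu>"
proof -
  have "{\<omega>\<in>space (M n). 0 < search_cost_out n id (A n \<omega>) (horizon n t)} =
      {\<omega>\<in>space (M n). next_obj n \<omega> t \<in> unreq n \<omega> t t}" for n
  proof (intro Collect_cong conj_cong refl)
    fix \<omega> assume "\<omega> \<in> space (M n)"
    from request_sets.search_cost_out_pos_iff[OF request_model.request_sets[OF model this], of id "horizon n t"]
    show "0 < search_cost_out n id (A n \<omega>) (horizon n t) \<longleftrightarrow> next_obj n \<omega> t \<in> unreq n \<omega> t t" by simp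
  qed
  then show ?thesis using prob_next_unrequested[OF t order_refl] by simp
qed

end

theorem corollary3p1:
  fixes P :: "real measure"
    and \<mu> p0 t :: real
    and \<phi> f :: "real \<Rightarrow> real"
    and M :: "nat \<Rightarrow> 'a measure"
    and w :: "nat \<Rightarrow> 'a \<Rightarrow> nat \<Rightarrow> real"
    and A :: "nat \<Rightarrow> 'a \<Rightarrow> nat \<Rightarrow> real set"
    and N :: "'b measure" and S_inf U :: "'b \<Rightarrow> real"
    and K :: "'c measure" and S :: "'c \<Rightarrow> real"
  assumes P: "P \<in> prob_measures_Rplus"
    and mean: "integrable P (\<lambda>x. x)" "\<mu> = (LINT x|P. x)" "\<mu> \<noteq> 0"
    and phi: "\<phi> = laplace_transform P"
    and p0: "p0 = measure P {0}"
    and f: "f = limit_density P"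
    and LLN: "LLN M w P"
    and exch: "\<And>n. exchangeable (M n) n (w n)"
    and requests: "\<And>n. poisson_requests (M n) n (w n) (A n)"
    and t: "t > 0"
    and N: "prob_space N"
    and S_inf: "distributed N lborel S_inf (\<lambda>x. ennreal (f x))"
    and U: "U \<in> borel_measurable N" "distr N borel U = uniform_measure lborel {1 - \<phi> t..1}"
    and indep: "prob_space.indep_var N borel S_inf borel U"
    and K: "prob_space K"
    and S: "S \<in> borel_measurable K"
      "distr K borel S =
       distr N borel (\<lambda>\<omega>. S_inf \<omega> * of_bool (S_inf \<omega> \<le> 1 - \<phi> t) + U \<omega> * of_bool (S_inf \<omega> > 1 - \<phi> t))"
  shows "weak_conv_m
           (\<lambda>n. distr (M n) borel (\<lambda>\<omega>. real (search_cost n id (A n \<omega>) (real n * \<mu> * t)) / real n))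
           (distr K borel S)
       \<and> (\<lambda>n. measure (M n) {\<omega> \<in> space (M n). search_cost_out n id (A n \<omega>) (real n * \<mu> * t) > 0})
           \<longlonglongrightarrow> measure N {\<omega> \<in> space N. S_inf \<omega> > 1 - \<phi> t}
       \<and> measure N {\<omega> \<in> space N. S_inf \<omega> > 1 - \<phi> t} = \<bar>deriv \<phi> t\<bar> / \<mu>
       \<and> distributed K lborel S
           (\<lambda>x. ennreal (f x * indicator {0..1 - \<phi> t} x
                          + \<bar>deriv \<phi> t\<bar> / (\<mu> * \<phi> t) * indicator {1 - \<phi> t..1} x))
       \<and> tv_dist (distr K borel S) (distr N borel S_inf) =
           (LINT x:{1 - \<phi> t..1 - p0}|lborel. \<bar>f x - \<bar>deriv \<phi> t\<bar> / (\<mu> * \<phi> t)\<bar>)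
             + \<bar>deriv \<phi> t\<bar> * p0 / (\<mu> * \<phi> t)
       \<and> (LINT x:{1 - \<phi> t..1 - p0}|lborel. \<bar>f x - \<bar>deriv \<phi> t\<bar> / (\<mu> * \<phi> t)\<bar>)
             + \<bar>deriv \<phi> t\<bar> * p0 / (\<mu> * \<phi> t)
           \<le> 2 * (\<bar>deriv \<phi> t\<bar> / \<mu>)"
proof -
  have P_props: "real_distribution P" "AE x in P. 0 \<le> x"
    using P by (auto simp: prob_measures_Rplus_def)
  have halfline: "halfline_law P"
    by (intro halfline_law.intro halfline_law_axioms.intro P_props) (use mean in auto)
  obtain Z where Z: "\<And>n. Z n \<in> borel_measurable (M n)" "\<And>n \<omega>. \<omega> \<in> space (M n) \<Longrightarrow> 0 < Z n \<omega>"
    "converges_in_law_to_point M (\<lambda>n \<omega>. empirical_measure n (\<lambda>i. Z n \<omega> * w n \<omega> i)) weak_topology_Rplus P"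
    "weak_conv_m (\<lambda>n. distr (M n) borel (\<lambda>\<omega>. (\<Sum>i=1..n. Z n \<omega> * w n \<omega> i) / real n)) (return borel (LINT x|P. x))"
    using LLN unfolding LLN_def by blast
  have w: "\<And>n. prob_space (M n)" "\<And>n i. i \<in> {1..n} \<Longrightarrow> (\<lambda>\<omega>. w n \<omega> i) \<in> borel_measurable (M n)"
    "\<And>n i \<omega>. i \<in> {1..n} \<Longrightarrow> \<omega> \<in> space (M n) \<Longrightarrow> 0 \<le> w n \<omega> i"
    using LLN unfolding LLN_def by blast+
  interpret m: mtf_array P M w Z A
    by (intro mtf_array.intro mtf_array_axioms.intro lln_array.intro lln_array_axioms.intro
        halfline w Z exch requests)
  have distr_S_inf: "distr N lborel S_inf = density lborel (\<lambda>x. ennreal (limit_density P x))"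
    and S_inf_meas: "S_inf \<in> borel_measurable N"
    and dens_meas: "(\<lambda>x. ennreal (limit_density P x)) \<in> borel_measurable borel"
    using S_inf by (auto simp: distributed_def f)
  have "prob_space (distr N lborel S_inf)"
    by (rule prob_space.prob_space_distr[OF N]) (use S_inf_meas in simp)
  then interpret L: limit_density_law P
    using dens_meas
    by (intro limit_density_law.intro limit_density_law_axioms.intro halfline) (auto simp: distr_S_inf)
  have \<phi>_t: "0 < \<phi> t" "\<phi> t < 1"
    using m.phi_pos[of t] m.phi_less_1[OF t] t by (auto simp: phi)
  have deriv: "\<bar>deriv \<phi> t\<bar> = tilted_moment P 1 t"
    using m.deriv_phi[OF t] m.mom_pos[OF t, of 1] by (simp add: phi)
  have kappa: "\<bar>deriv \<phi> t\<bar> / (\<mu> * \<phi> t) = L.kappa t"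
    unfolding deriv L.kappa_def by (simp add: mean phi)
  have tail: "measure N {\<omega> \<in> space N. S_inf \<omega> > 1 - \<phi> t} = tilted_moment P 1 t / \<mu>"
  proof -
    have "measure N {\<omega> \<in> space N. S_inf \<omega> > 1 - \<phi> t} = measure (distr N lborel S_inf) {1 - \<phi> t<..}"
      using S_inf_meas by (subst measure_distr) (auto intro!: arg_cong[where f = "measure N"])
    then show ?thesis
      unfolding distr_S_inf phi mean(2) by (simp only: L.D_greaterThan[OF t])
  qed
  let ?L = "density lborel (\<lambda>x. ennreal (L.switched_density t x))"
  let ?Y = "\<lambda>\<omega>. S_inf \<omega> * of_bool (S_inf \<omega> \<le> 1 - \<phi> t) + U \<omega> * of_bool (S_inf \<omega> > 1 - \<phi> t)"
  have law: "distr K borel S = ?L"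
  proof -
    have "distributed N lborel ?Y (\<lambda>x. ennreal (f x) * indicator {..1 - \<phi> t} x +
        ennreal (measure N {\<omega> \<in> space N. S_inf \<omega> > 1 - \<phi> t} / (1 - (1 - \<phi> t))) * indicator {1 - \<phi> t..1} x)"
      by (rule prob_space.distributed_switch_to_uniform[OF N S_inf U _ indep]) (use \<phi>_t in simp)
    moreover have "measure N {\<omega> \<in> space N. S_inf \<omega> > 1 - \<phi> t} / (1 - (1 - \<phi> t)) = L.kappa t"
      unfolding tail L.kappa_def by (simp add: mean phi)
    ultimately have "distr N lborel ?Y = density lborel (\<lambda>x. ennreal (f x) * indicator {..1 - \<phi> t} x +
        ennreal (L.kappa t) * indicator {1 - \<phi> t..1} x)"
      unfolding distributed_def by (simp only:)
    also have "\<dots> = ?L"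
      using L.AE_switched_density[OF t] dens_meas unfolding f phi by (intro density_cong) auto
    finally have "distr N lborel ?Y = ?L" .
    moreover have "distr N borel ?Y = distr N lborel ?Y" by (rule distr_cong) auto
    ultimately show ?thesis unfolding S(2) by simp
  qed
  have cdf_S: "cdf (distr K borel S) y = measure ?L {..y}" for y
    unfolding law cdf_def ..
  have weak: "weak_conv_m
           (\<lambda>n. distr (M n) borel (\<lambda>\<omega>. real (search_cost n id (A n \<omega>) (real n * \<mu> * t)) / real n))
           (distr K borel S)"
    unfolding mean(2)
  proof (rule weak_convI_random_points[where E = "- {0}", OF w(1) m.cost_measurable[OF t]])
    fix a b :: real assume ab: "a < b"
    show "\<exists>y\<in>- {0}. a < y \<and> y < b"
    proof (cases "(a + b) / 2 = 0")
      case True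
      then show ?thesis using ab by (intro bexI[of _ "b / 2"]) auto
    next
      case False
      then show ?thesis using ab by (intro bexI[of _ "(a + b) / 2"]) auto
    qed
  next
    fix y :: real assume "y \<in> - {0}"
    then consider "y < 0" | "0 < y" "y \<le> 1 - \<phi> t" | "1 - \<phi> t < y" "y \<le> 1" | "1 < y" by fastforce
    then show "\<exists>Y. tends_in_prob M Y y \<and>
      (\<lambda>n. measure (M n) {\<omega>\<in>space (M n). real (search_cost n id (A n \<omega>) (real n * (LINT x|P. x) * t)) / real n \<le> Y n \<omega>})
        \<longlonglongrightarrow> cdf (distr K borel S) y"
    proof cases
      case 1
      then show ?thesis
        unfolding cdf_S L.switched_cdf_nonpos[OF t 1]
        by (intro exI[of _ "\<lambda>_ _. y"] conjI tends_in_prob_deterministic tendsto_const)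
           (simp only: m.cost_cdf_negative[OF 1] tendsto_const)
    next
      case 2
      then obtain u where u: "0 < u" "laplace_transform P u = 1 - y"
        using m.phi_onto[of "1 - y"] m.phi_gt_mass_zero[of t] t by (auto simp: phi)
      have "u \<le> t"
        using m.phi_strict_antimono[of t u] u 2 t by (force simp: phi not_le[symmetric])
      then show ?thesis
        using m.cost_cdf_requested[OF u(1)] L.switched_cdf_early[OF u(1)] u(2) unfolding cdf_S by fastforce
    next
      case 3
      define c where "c = (y - (1 - \<phi> t)) / \<phi> t"
      have c: "0 \<le> c" "c \<le> 1" using 3 \<phi>_t by (auto simp: c_def divide_le_eq)
      have y: "y = 1 - laplace_transform P t + c * laplace_transform P t"
        using \<phi>_t by (simp add: c_def phi)
      show ?thesis
        unfolding cdf_S y L.switched_cdf_late[OF t c] by (rule m.cost_cdf_unrequested[OF t c])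
    next
      case 4
      then have y: "1 \<le> y" by simp
      have "(\<lambda>n. measure (M n) {\<omega>\<in>space (M n). real (search_cost n id (A n \<omega>) (real n * (LINT x|P. x) * t)) / real n \<le> y}) \<longlonglongrightarrow> 1"
      proof (rule tendsto_eventually)
        show "\<forall>\<^sub>F n in sequentially. measure (M n) {\<omega>\<in>space (M n). real (search_cost n id (A n \<omega>) (real n * (LINT x|P. x) * t)) / real n \<le> y} = 1"
          using eventually_ge_at_top[of 1] by eventually_elim (rule m.cost_cdf_ge_1[OF t y])
      qed
      then show ?thesis
        unfolding cdf_S L.switched_cdf_ge_1[OF t y]
        by (intro exI[of _ "\<lambda>_ _. y"] conjI tends_in_prob_deterministic tendsto_const)
    qed
  qed
  have dens_S: "distributed K lborel S
           (\<lambda>x. ennreal (f x * indicator {0..1 - \<phi> t} x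
                          + \<bar>deriv \<phi> t\<bar> / (\<mu> * \<phi> t) * indicator {1 - \<phi> t..1} x))"
  proof -
    have eq: "f x * indicator {0..1 - \<phi> t} x + \<bar>deriv \<phi> t\<bar> / (\<mu> * \<phi> t) * indicator {1 - \<phi> t..1} x
        = L.switched_density t x" for x
      unfolding kappa unfolding L.switched_density_def f phi ..
    have "distr K lborel S = distr K borel S" by (rule distr_cong) auto
    then show ?thesis
      unfolding eq distributed_def using law S(1) by simp
  qed
  have tv: "tv_dist (distr K borel S) (distr N borel S_inf) =
           (LINT x:{1 - \<phi> t..1 - p0}|lborel. \<bar>f x - \<bar>deriv \<phi> t\<bar> / (\<mu> * \<phi> t)\<bar>)
             + \<bar>deriv \<phi> t\<bar> * p0 / (\<mu> * \<phi> t)"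
  proof -
    have "distr N borel S_inf = distr N lborel S_inf" by (rule distr_cong) auto
    then show ?thesis
      unfolding law using L.tv_switched_eq[OF t] kappa
      by (simp add: distr_S_inf f phi p0 times_divide_eq_left[symmetric])
  qed
  have le: "(LINT x:{1 - \<phi> t..1 - p0}|lborel. \<bar>f x - \<bar>deriv \<phi> t\<bar> / (\<mu> * \<phi> t)\<bar>)
             + \<bar>deriv \<phi> t\<bar> * p0 / (\<mu> * \<phi> t) \<le> 2 * (\<bar>deriv \<phi> t\<bar> / \<mu>)"
  proof -
    have "\<bar>deriv \<phi> t\<bar> * p0 / (\<mu> * \<phi> t) = L.kappa t * p0" unfolding kappa[symmetric] by simp
    then show ?thesis
      unfolding kappa unfolding deriv using L.tv_switched_le[OF t] by (simp only: f phi p0 mean(2))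
  qed
  show ?thesis
    using weak m.prob_cost_out[OF t] tail dens_S tv le by (simp only: deriv mean(2) tail simp_thms)
qed

end
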